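(* There exists an algorithm $\mathcal{A}$ such that for every $n$, every submodular function $f:\{0,1\}^n\to[0,1]$ and every $\epsilon>0$, given $\epsilon$ and access to independent random examples $(x,f(x))$ with $x$ drawn from the uniform distribution on $\{0,1\}^n$, with probability at least $2/3$ the algorithm outputs a function $h:\{0,1\}^n\to\mathbb{R}$ such that $\|f-h\|_2\le\epsilon$. Moreover, $\mathcal{A}$ runs in time $2^{\tilde{O}(1/\epsilon^{4/5})}\cdot n^2$ and uses $2^{\tilde{O}(1/\epsilon^{4/5})}\log n$ random examples.
   Context: A function $f:\{0,1\}^n\to\mathbb{R}$ is identified with the set function on subsets of $[n]$ via indicator vectors; $f$ is submodular if $f(A\cup B)+f(A\cap B)\le f(A)+f(B)$ for all $A,B\subseteq[n]$. For $g:\{0,1\}^n\to\mathbb{R}$, $\|g\|_2=\sqrt{\mathbb{E}_{x}[g(x)^2]}$ with $x$ uniform on $\{0,1\}^n$. The notation $\tilde{O}(\cdot)$ hides factors polylogarithmic in $1/\epsilon$. *)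

theory Defs
  imports "HOL-Probability.Probability" "HOL-Library.Landau_Symbols"
begin

text \<open>
  A point of \<open>{0,1}\<^sup>n\<close> is represented by the set of its coordinates that are 1,
  so \<open>{0,1}\<^sup>n\<close> is \<open>Pow {..<n}\<close>, and a function on the cube is the set function it is
  identified with; its values outside \<open>Pow {..<n}\<close> play no role.
\<close>

definition cube :: "nat \<Rightarrow> nat set set" where
  "cube n = Pow {..<n}"

definition submodular :: "nat \<Rightarrow> (nat set \<Rightarrow> real) \<Rightarrow> bool" where
  "submodular n f \<longleftrightarrow>
     (\<forall>A \<in> cube n. \<forall>B \<in> cube n. f (A \<union> B) + f (A \<inter> B) \<le> f A + f B)"

definition l2_norm :: "nat \<Rightarrow> (nat set \<Rightarrow> real) \<Rightarrow> real" where
  "l2_norm n g = sqrt (measure_pmf.expectation (pmf_of_set (cube n)) (\<lambda>x. (g x)\<^sup>2))"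

text \<open>
  \<open>g \<in> soft_O u\<close>: as \<open>\<epsilon>\<close> tends to 0 from the right, \<open>g(\<epsilon>)\<close> is \<open>O(u(\<epsilon>))\<close> up to a factor polylogarithmic
  in \<open>1/\<epsilon>\<close>.  The Landau symbol says nothing about \<open>\<epsilon>\<close> away from 0; the
  second conjunct makes the bound meaningful there (\<open>g\<close> is \<open>O(1)\<close> on each \<open>[\<delta>, \<infinity>)\<close>).
\<close>

definition soft_O :: "(real \<Rightarrow> real) \<Rightarrow> (real \<Rightarrow> real) set" where
  "soft_O u =
     {g. (\<exists>k::nat. g \<in> O[at_right 0](\<lambda>\<epsilon>. u \<epsilon> * (ln (1 / \<epsilon>)) ^ k)) \<and>
         (\<forall>\<delta>>0. bounded (g ` {\<delta>..}))}"

text \<open>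
  Algorithms are programs of a unit-cost RAM with a memory of natural numbers (used for
  indices, counters and addresses) and a memory of real numbers, as in the real-RAM model;
  the real memory holds \<open>\<epsilon>\<close> and the labels \<open>f(x)\<close>.  A program is a fixed finite object, not
  depending on \<open>n\<close> or \<open>\<epsilon>\<close>.  Its only literals are natural numbers: real literals
  could encode uncomputable advice.  There is no rounding from reals to naturals, since
  unit-cost rounding makes real RAMs unrealistically powerful.  For the same reason the size of
  the naturals is bounded below (\<open>word_bounded\<close>), as in the word-RAM model.

  Literal arguments of type \<^typ>\<open>nat\<close> are addresses, except for the second argument of
  \<open>NConst\<close>.  The loads and stores use indirect addressing.
\<close>

datatype instr =
    NConst nat nat
  | NAdd nat nat nat
  | NSub nat nat nat
  | NMul nat nat nat
  | NDiv nat nat nat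
  | NLoad nat nat
  | NStore nat nat
  | ROfN nat nat
  | RAdd nat nat nat
  | RSub nat nat nat
  | RMul nat nat nat
  | RDiv nat nat nat
  | RLoad nat nat
  | RStore nat nat
  | Draw
  | ReadBit nat nat
  | ReadLabel nat
  | Flip nat

datatype test = NLess nat nat | RLess nat nat

datatype com =
    Skip
  | Instr instr
  | Seq com com
  | If test com com
  | While test com

text \<open>
  \<open>point\<close> and \<open>label\<close> hold the most recently drawn example (or, when a hypothesis is
  evaluated, \<open>point\<close> holds its argument); \<open>draws\<close> counts the examples drawn so far and
  cannot be read by programs.
\<close>

record state =
  nmem :: "nat \<Rightarrow> nat"
  rmem :: "nat \<Rightarrow> real"
  point :: "nat set"
  label :: real
  draws :: nat

definition set_n :: "nat \<Rightarrow> nat \<Rightarrow> state \<Rightarrow> state" where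
  "set_n a v s = s\<lparr>nmem := (nmem s)(a := v)\<rparr>"

definition set_r :: "nat \<Rightarrow> real \<Rightarrow> state \<Rightarrow> state" where
  "set_r a v s = s\<lparr>rmem := (rmem s)(a := v)\<rparr>"

text \<open>
  The argument \<open>D\<close> is the distribution of a labelled example; each \<open>Draw\<close> samples
  from it afresh, so examples are independent.  \<open>Draw\<close> takes a single step and the bits of
  the example are then read one at a time.
\<close>

fun exec :: "(nat set \<times> real) pmf \<Rightarrow> instr \<Rightarrow> state \<Rightarrow> state pmf" where
  "exec D (NConst a k) s = return_pmf (set_n a k s)"
| "exec D (NAdd a b c) s = return_pmf (set_n a (nmem s b + nmem s c) s)"
| "exec D (NSub a b c) s = return_pmf (set_n a (nmem s b - nmem s c) s)"
| "exec D (NMul a b c) s = return_pmf (set_n a (nmem s b * nmem s c) s)"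
| "exec D (NDiv a b c) s = return_pmf (set_n a (nmem s b div nmem s c) s)"
| "exec D (NLoad a b) s = return_pmf (set_n a (nmem s (nmem s b)) s)"
| "exec D (NStore a b) s = return_pmf (set_n (nmem s a) (nmem s b) s)"
| "exec D (ROfN a b) s = return_pmf (set_r a (real (nmem s b)) s)"
| "exec D (RAdd a b c) s = return_pmf (set_r a (rmem s b + rmem s c) s)"
| "exec D (RSub a b c) s = return_pmf (set_r a (rmem s b - rmem s c) s)"
| "exec D (RMul a b c) s = return_pmf (set_r a (rmem s b * rmem s c) s)"
| "exec D (RDiv a b c) s = return_pmf (set_r a (rmem s b / rmem s c) s)"
| "exec D (RLoad a b) s = return_pmf (set_r a (rmem s (nmem s b)) s)"
| "exec D (RStore a b) s = return_pmf (set_r (nmem s a) (rmem s b) s)"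
| "exec D Draw s =
     map_pmf (\<lambda>(x, y). s\<lparr>point := x, label := y, draws := Suc (draws s)\<rparr>) D"
| "exec D (ReadBit a b) s = return_pmf (set_n a (if nmem s b \<in> point s then 1 else 0) s)"
| "exec D (ReadLabel a) s = return_pmf (set_r a (label s) s)"
| "exec D (Flip a) s =
     map_pmf (\<lambda>b. set_n a (if b then 1 else 0) s) (pmf_of_set (UNIV :: bool set))"

fun holds :: "test \<Rightarrow> state \<Rightarrow> bool" where
  "holds (NLess a b) s \<longleftrightarrow> nmem s a < nmem s b"
| "holds (RLess a b) s \<longleftrightarrow> rmem s a < rmem s b"

text \<open>\<open>Skip\<close> is the halted program; halted configurations do not change.\<close>

fun step :: "(nat set \<times> real) pmf \<Rightarrow> com \<times> state \<Rightarrow> (com \<times> state) pmf" where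
  "step D (Skip, s) = return_pmf (Skip, s)"
| "step D (Instr i, s) = map_pmf (\<lambda>s'. (Skip, s')) (exec D i s)"
| "step D (Seq c d, s) =
     (if c = Skip then return_pmf (d, s)
      else map_pmf (\<lambda>(c', s'). (Seq c' d, s')) (step D (c, s)))"
| "step D (If b c d, s) = return_pmf (if holds b s then c else d, s)"
| "step D (While b c, s) = return_pmf (If b (Seq c (While b c)) Skip, s)"

fun run :: "(nat set \<times> real) pmf \<Rightarrow> nat \<Rightarrow> com \<times> state \<Rightarrow> (com \<times> state) pmf" where
  "run D 0 cs = return_pmf cs"
| "run D (Suc t) cs = bind_pmf (step D cs) (run D t)"

definition halts_within :: "(nat set \<times> real) pmf \<Rightarrow> real \<Rightarrow> com \<times> state \<Rightarrow> bool" where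
  "halts_within D T cs \<longleftrightarrow> (\<forall>(c, s) \<in> set_pmf (run D (nat \<lfloor>T\<rfloor>) cs). c = Skip)"

definition word_bounded :: "(nat set \<times> real) pmf \<Rightarrow> real \<Rightarrow> com \<times> state \<Rightarrow> bool" where
  "word_bounded D W cs \<longleftrightarrow>
     (\<forall>t. \<forall>(c, s) \<in> set_pmf (run D t cs). \<forall>a. real (nmem s a) \<le> W)"

text \<open>
  \<open>runs_in_time D T cs\<close>: on every execution path at most \<open>T\<close> steps are made, with machine words of
  \<open>O(log T)\<close> bits.
\<close>

definition runs_in_time :: "(nat set \<times> real) pmf \<Rightarrow> real \<Rightarrow> com \<times> state \<Rightarrow> bool" where
  "runs_in_time D T cs \<longleftrightarrow> halts_within D T cs \<and> word_bounded D T cs"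

definition uses_examples :: "(nat set \<times> real) pmf \<Rightarrow> real \<Rightarrow> com \<times> state \<Rightarrow> bool" where
  "uses_examples D M cs \<longleftrightarrow>
     (\<forall>t. \<forall>(c, s) \<in> set_pmf (run D t cs). real (draws s) \<le> M)"

definition examples :: "nat \<Rightarrow> (nat set \<Rightarrow> real) \<Rightarrow> (nat set \<times> real) pmf" where
  "examples n f = map_pmf (\<lambda>x. (x, f x)) (pmf_of_set (cube n))"

definition init :: "nat \<Rightarrow> real \<Rightarrow> state" where
  "init n \<epsilon> =
     \<lparr>nmem = (\<lambda>_. 0)(0 := n), rmem = (\<lambda>_. 0)(0 := \<epsilon>), point = {}, label = 0, draws = 0\<rparr>"

fun oracle_free :: "com \<Rightarrow> bool" where
  "oracle_free Skip \<longleftrightarrow> True"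
| "oracle_free (Instr i) \<longleftrightarrow> i \<noteq> Draw \<and> (\<forall>a. i \<noteq> Flip a)"
| "oracle_free (Seq c d) \<longleftrightarrow> oracle_free c \<and> oracle_free d"
| "oracle_free (If b c d) \<longleftrightarrow> oracle_free c \<and> oracle_free d"
| "oracle_free (While b c) \<longleftrightarrow> oracle_free c"

text \<open>
  A learner outputs a function by leaving a description of it in memory.  Descriptions are
  interpreted by a fixed program \<open>dec\<close> with no access to examples or coins: the function
  described by a memory \<open>s\<close> maps \<open>x\<close> to the content of real cell 0 when \<open>dec\<close>, started on \<open>s\<close>
  with \<open>x\<close> as its input point, has halted.  The time limit \<open>T\<close> on this evaluation keeps the work
  of the learner from being moved into \<open>dec\<close>.  (As \<open>dec\<close> is intended to be \<open>oracle_free\<close>, the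
  distribution \<open>D\<close> is immaterial here.)  The label is erased, as it is not part of the input
  of \<open>h\<close>.
\<close>

definition describes ::
  "(nat set \<times> real) pmf \<Rightarrow> real \<Rightarrow> nat \<Rightarrow> com \<Rightarrow> state \<Rightarrow> (nat set \<Rightarrow> real) \<Rightarrow> bool" where
  "describes D T n dec s h \<longleftrightarrow>
     (\<forall>x \<in> cube n.
        let cs = (dec, s\<lparr>point := x, label := 0\<rparr>) in
        runs_in_time D T cs \<and>
        (\<forall>(c', s') \<in> set_pmf (run D (nat \<lfloor>T\<rfloor>) cs). rmem s' 0 = h x))"

end

theory Submission imports Defs
begin

text \<open>
  Write \<open>h\<^sub>i\<close> for the marginal of \<open>f\<close> at \<open>i\<close> and choose \<open>p\<close> with \<open>(1 - p)\<^sup>m = 1/2\<close>, where \<open>m\<close> is of order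
  \<open>log (1/\<epsilon>)\<close>.  The positive part of \<open>h\<^sub>i\<close> is antitone and its negative part is monotone, so their \<open>m\<close>-th moments
  under the uniform measure are controlled by first moments under bias \<open>p\<close> and \<open>1 - p\<close>.  These first moments
  \<open>a\<^sub>i\<close> have sum \<open>O(m)\<close>, because \<open>f\<close> has values in \<open>[0,1]\<close>.  The second derivatives of \<open>f\<close> are nonpositive
  and are bounded by \<open>a\<^sub>i\<close> and \<open>a\<^sub>j\<close> in the same way.  Comparing the expectations of \<open>h\<^sub>i\<close> under two slightly different
  product measures bounds a weighted sum of the second derivatives, and this gives Fourier weight
  \<open>O(K\<^sup>-\<^sup>5\<^sup>/\<^sup>2)\<close> above degree \<open>K\<close>, up to powers of \<open>m\<close>.  Hence, up to logarithmic factors, degree \<open>\<epsilon>\<^sup>-\<^sup>4\<^sup>/\<^sup>5\<close> suffices.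
  Moreover \<open>f\<close> is close to a junta on the variables with large \<open>a\<^sub>i\<close>; a variable for which all coefficients of degree one and two
  are tiny can be dropped, since the second derivatives have constant sign.

  The learner estimates the coefficients of degree at most two, keeps the variables with a large one, and
  estimates the low-degree coefficients on those variables.  To test all \<open>n\<^sup>2\<close> coefficients in time
  of order \<open>n\<^sup>2\<close> although \<open>log n\<close> examples are needed for each, it stops a test as soon as the running sum
  falls behind; only large coefficients, which are few by Parseval, run through all the examples.
\<close>

section \<open>Product measures on the cube\<close>

text \<open>The exponent 4/5 solves K^(-5/2) = \<epsilon>^2. Counting pairs inside a set of size K
  gives K^-2. The further K^(-1/2) comes from discarding the O(m K) variables with marginal size
  above 1/K: every larger set keeps K small variables, and tilting the measure by
  sqrt(\<open>a\<^sub>i\<close>) in direction i weights each of them by at most K^(-1/2). Moments of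
  logarithmic order matter because the tilt controls only L1 norms of second derivatives; the
  passage to L2 costs just the typical size sqrt(\<open>a\<^sub>i\<close> \<open>a\<^sub>j\<close>)
  when the tail beyond it is negligible.

  The machine has no roots and no rounding, so \<epsilon>^(-4/5) is replaced by the least
  \<open>k\<close> with \<open>1 \<le> k ^ 5 * \<epsilon> ^ 4\<close>. The time bound is required on
  every path, so the tests share a fixed budget, and exceeding it is a failure event. All tests read
  the same examples and are dependent; linearity of expectation and union bounds do not mind. No
  coefficient is written down by the learner: the stored sample and the set of found variables are
  the description. Execution and probability are separated by fixing the stream of examples
  first.\<close>

definition bE :: "'a set \<Rightarrow> ('a \<Rightarrow> real) \<Rightarrow> ('a set \<Rightarrow> real) \<Rightarrow> real" where
  "bE V p g = (\<Sum>A\<in>Pow V. (\<Prod>i\<in>A. p i) * (\<Prod>i\<in>V - A. 1 - p i) * g A)"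

abbreviation uE :: "'a set \<Rightarrow> ('a set \<Rightarrow> real) \<Rightarrow> real" where
  "uE V \<equiv> bE V (\<lambda>_. 1/2)"

lemma bE_empty [simp]: "bE {} p g = g {}"
  by (simp add: bE_def)

text \<open>Conditioning on one coordinate. \<open>bE\<close> is a finite weighted sum with one bias
  per element of \<open>V\<close>, so that statements about product measures follow by induction on
  \<open>V\<close> through this equation, an identity of polynomials in the biases.\<close>

lemma bE_insert:
  assumes "finite V" "j \<notin> V"
  shows "bE (insert j V) p g = (1 - p j) * bE V p g + p j * bE V p (\<lambda>A. g (insert j A))"
proof -
  let ?w = "\<lambda>V A. (\<Prod>i\<in>A. p i) * (\<Prod>i\<in>V - A. 1 - p i)"
  have inj: "inj_on (insert j) (Pow V)"
    using assms(2) by (intro inj_onI) (metis Diff_insert_absorb PowD subsetD)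
  have disj: "Pow V \<inter> insert j ` Pow V = {}"
    using assms(2) by auto
  have w0: "?w (insert j V) A = (1 - p j) * ?w V A" if "A \<in> Pow V" for A
  proof -
    have "insert j V - A = insert j (V - A)" using that assms(2) by auto
    then show ?thesis using assms by simp
  qed
  have w1: "?w (insert j V) (insert j A) = p j * ?w V A" if "A \<in> Pow V" for A
  proof -
    have "insert j V - insert j A = V - A" "j \<notin> A" "finite A"
      using that assms by (auto intro: finite_subset)
    then show ?thesis by simp
  qed
  have "bE (insert j V) p g
      = (\<Sum>A\<in>Pow V. ?w (insert j V) A * g A)
        + (\<Sum>A\<in>insert j ` Pow V. ?w (insert j V) A * g A)"
    unfolding bE_def Pow_insert by (rule sum.union_disjoint) (use assms disj in auto)
  also have "(\<Sum>A\<in>insert j ` Pow V. ?w (insert j V) A * g A)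
      = (\<Sum>A\<in>Pow V. ?w (insert j V) (insert j A) * g (insert j A))"
    by (simp add: sum.reindex[OF inj])
  also have "\<dots> = (\<Sum>A\<in>Pow V. p j * (?w V A * g (insert j A)))"
    by (intro sum.cong refl) (simp only: w1 mult.assoc)
  also have "(\<Sum>A\<in>Pow V. ?w (insert j V) A * g A) = (\<Sum>A\<in>Pow V. (1 - p j) * (?w V A * g A))"
    by (intro sum.cong refl) (simp only: w0 mult.assoc)
  finally show ?thesis
    by (simp add: bE_def sum_distrib_left)
qed

lemma bE_cong:
  assumes "\<And>A. A \<subseteq> V \<Longrightarrow> g A = h A"
  shows "bE V p g = bE V p h"
  unfolding bE_def by (intro sum.cong refl) (simp add: assms)

lemma bE_add: "bE V p (\<lambda>A. g A + h A) = bE V p g + bE V p h"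
  by (simp add: bE_def sum.distrib algebra_simps)

lemma bE_diff: "bE V p (\<lambda>A. g A - h A) = bE V p g - bE V p h"
  by (simp add: bE_def sum_subtractf algebra_simps)

lemma bE_minus: "bE V p (\<lambda>A. - g A) = - bE V p g"
  by (simp add: bE_def sum_negf)

lemma bE_cmult: "bE V p (\<lambda>A. c * g A) = c * bE V p g"
  by (simp add: bE_def sum_distrib_left algebra_simps)

lemma bE_divide: "bE V p (\<lambda>A. g A / c) = bE V p g / c"
  by (simp add: bE_def sum_divide_distrib)

lemma bE_sum: "bE V p (\<lambda>A. \<Sum>i\<in>I. g i A) = (\<Sum>i\<in>I. bE V p (g i))"
  unfolding bE_def sum_distrib_left by (rule sum.swap)

lemma bE_prod:
  assumes "finite V"
  shows "bE V p (\<lambda>A. \<Prod>i\<in>V. \<phi> i (i \<in> A)) = (\<Prod>i\<in>V. (1 - p i) * \<phi> i False + p i * \<phi> i True)"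
  using assms
proof (induction V)
  case (insert j V)
  have a: "bE V p (\<lambda>A. \<Prod>i\<in>insert j V. \<phi> i (i \<in> A)) = \<phi> j False * bE V p (\<lambda>A. \<Prod>i\<in>V. \<phi> i (i \<in> A))"
    unfolding bE_cmult[symmetric]
  proof (rule bE_cong)
    fix A assume "A \<subseteq> V"
    then have "j \<notin> A" using insert.hyps by auto
    then show "(\<Prod>i\<in>insert j V. \<phi> i (i \<in> A)) = \<phi> j False * (\<Prod>i\<in>V. \<phi> i (i \<in> A))"
      using insert.hyps by simp
  qed
  have "(\<Prod>i\<in>V. \<phi> i (i = j \<or> i \<in> A)) = (\<Prod>i\<in>V. \<phi> i (i \<in> A))" for A
    by (rule prod.cong) (use insert.hyps in \<open>auto intro!: arg_cong[of _ _ "\<phi> _"]\<close>)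
  then have b: "bE V p (\<lambda>A. \<Prod>i\<in>insert j V. \<phi> i (i \<in> insert j A)) = \<phi> j True * bE V p (\<lambda>A. \<Prod>i\<in>V. \<phi> i (i \<in> A))"
    unfolding bE_cmult[symmetric] by (intro bE_cong) (use insert.hyps in simp)
  show ?case
    unfolding bE_insert[OF insert.hyps] a b insert.IH using insert.hyps by (simp add: algebra_simps)
qed simp

lemma bE_const:
  assumes "finite V"
  shows "bE V p (\<lambda>_. c) = c"
  using bE_prod[OF assms, of p "\<lambda>_ _. 1"] bE_cmult[of V p c "\<lambda>_. 1"] by simp

lemma bE_mono:
  assumes "\<And>i. i \<in> V \<Longrightarrow> 0 \<le> p i \<and> p i \<le> 1" and "\<And>A. A \<subseteq> V \<Longrightarrow> g A \<le> h A"
  shows "bE V p g \<le> bE V p h"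
  unfolding bE_def using assms by (intro sum_mono mult_left_mono mult_nonneg_nonneg prod_nonneg) auto

lemma bE_nonneg:
  assumes "\<And>i. i \<in> V \<Longrightarrow> 0 \<le> p i \<and> p i \<le> 1" and "\<And>A. A \<subseteq> V \<Longrightarrow> 0 \<le> g A"
  shows "0 \<le> bE V p g"
  using bE_mono[of V p "\<lambda>_. 0" g] assms by (simp add: bE_def)

text \<open>Complementation exchanges the biases \<open>p\<close> and \<open>1 - p\<close> and turns
  antitone functions into monotone ones, so a moment bound needs a proof in only one
  direction.\<close>

lemma bE_reflect:
  "bE V (\<lambda>i. 1 - p i) g = bE V p (\<lambda>A. g (V - A))"
  unfolding bE_def
  by (rule sum.reindex_bij_witness[where i = "\<lambda>A. V - A" and j = "\<lambda>A. V - A"])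
     (auto simp: double_diff mult.commute)

lemma uE_eq_average:
  assumes "finite V"
  shows "uE V g = (\<Sum>A\<in>Pow V. g A) / 2 ^ card V"
proof -
  have "(\<Prod>i\<in>A. 1/2) * (\<Prod>i\<in>V - A. 1 - 1/2) = (1 / 2 ^ card V :: real)" if "A \<in> Pow V" for A
  proof -
    have "card A + card (V - A) = card V"
      using that assms by (metis PowD card_mono card_Diff_subset finite_subset le_add_diff_inverse)
    then show ?thesis
      by (simp add: power_add[symmetric] power_one_over)
  qed
  then show ?thesis
    by (simp add: bE_def sum_divide_distrib)
qed

text \<open>Membership of \<open>i\<close> is independent of a function that ignores
  \<open>i\<close>. This brings the condition \<open>i \<in> A\<close> or
  \<open>i \<notin> A\<close> into the expectation of a marginal at the price of a factor
  \<open>p i\<close> or \<open>1 - p i\<close>.\<close>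

lemma bE_independent:
  assumes "finite V" "i \<in> V" and "\<And>A. A \<subseteq> V \<Longrightarrow> i \<notin> A \<Longrightarrow> g (insert i A) = g A"
  shows "bE V p (\<lambda>A. if i \<in> A then g A else 0) = p i * bE V p g"
    and "bE V p (\<lambda>A. if i \<in> A then 0 else g A) = (1 - p i) * bE V p g"
proof -
  obtain U where U: "V = insert i U" "i \<notin> U" "finite U"
    using assms(1,2) by (metis finite_insert mk_disjoint_insert)
  have e: "bE U p (\<lambda>A. g (insert i A)) = bE U p g"
    by (rule bE_cong) (use U assms(3) in auto)
  have a: "bE U p (\<lambda>A. if i \<in> A then x A else y A) = bE U p y" for x y
    by (rule bE_cong) (use U in auto)
  have z: "bE U p (\<lambda>_. 0) = 0" by (simp add: bE_def)
  show "bE V p (\<lambda>A. if i \<in> A then g A else 0) = p i * bE V p g"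
    and "bE V p (\<lambda>A. if i \<in> A then 0 else g A) = (1 - p i) * bE V p g"
    using U e by (simp_all add: bE_insert a z algebra_simps)
qed

section \<open>Fourier analysis\<close>

text \<open>Taking the difference between \<open>A - {i}\<close> and \<open>insert i A\<close> makes
  the marginal a function on the whole cube that ignores membership of \<open>i\<close>. Since
  \<open>chi\<close> is -1 on members, its coefficients carry the factor -2 of
  \<open>fc_dif\<close>.\<close>

definition dif :: "'a \<Rightarrow> ('a set \<Rightarrow> real) \<Rightarrow> 'a set \<Rightarrow> real" where
  "dif i f A = f (insert i A) - f (A - {i})"

definition chi :: "'a set \<Rightarrow> 'a set \<Rightarrow> real" where
  "chi S A = (-1) ^ card (S \<inter> A)"

definition fc :: "'a set \<Rightarrow> ('a set \<Rightarrow> real) \<Rightarrow> 'a set \<Rightarrow> real" where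
  "fc V f S = uE V (\<lambda>A. f A * chi S A)"

lemma abs_chi [simp]: "\<bar>chi S A\<bar> = 1"
  by (simp add: chi_def power_abs)

lemma chi_empty [simp]: "chi {} A = 1"
  by (simp add: chi_def)

lemma chi_prod:
  assumes "finite V" "S \<subseteq> V"
  shows "chi S A = (\<Prod>i\<in>V. if i \<in> S \<and> i \<in> A then - 1 else 1)"
proof -
  have "(\<Prod>i\<in>V. if i \<in> S \<and> i \<in> A then - 1 else (1::real)) = (\<Prod>i\<in>S \<inter> A. -1)"
    using assms by (intro prod.mono_neutral_cong_right) auto
  then show ?thesis by (simp add: chi_def)
qed

lemma chi_insert_right_notin: "j \<notin> S \<Longrightarrow> chi S (insert j A) = chi S A"
  by (simp add: chi_def)

lemma chi_insert_left: "finite S \<Longrightarrow> j \<notin> S \<Longrightarrow> chi (insert j S) A = (if j \<in> A then -1 else 1) * chi S A"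
  by (simp add: chi_def)

lemma uE_chi_chi:
  assumes "finite V" "S \<subseteq> V" "T \<subseteq> V"
  shows "uE V (\<lambda>A. chi S A * chi T A) = (if S = T then 1 else 0)"
proof -
  define \<phi> :: "'a \<Rightarrow> bool \<Rightarrow> real" where
    "\<phi> i b = (if i \<in> S \<and> b then -1 else 1) * (if i \<in> T \<and> b then -1 else 1)" for i b
  have "uE V (\<lambda>A. chi S A * chi T A) = uE V (\<lambda>A. \<Prod>i\<in>V. \<phi> i (i \<in> A))"
    unfolding \<phi>_def prod.distrib chi_prod[OF assms(1,2)] chi_prod[OF assms(1,3)] ..
  also have "\<dots> = (\<Prod>i\<in>V. if i \<in> S \<longleftrightarrow> i \<in> T then 1 else 0)"
    unfolding bE_prod[OF assms(1)] by (rule prod.cong) (auto simp: \<phi>_def)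
  also have "\<dots> = (if S = T then 1 else 0)"
    using assms by (auto simp: prod_zero_iff)
  finally show ?thesis .
qed

lemma fc_insert:
  assumes "finite V" "j \<notin> V" "S \<subseteq> V"
  shows "fc (insert j V) f S = (fc V f S + fc V (\<lambda>A. f (insert j A)) S) / 2"
    and "fc (insert j V) f (insert j S) = (fc V f S - fc V (\<lambda>A. f (insert j A)) S) / 2"
proof -
  have S: "j \<notin> S" "finite S" using assms by (auto intro: finite_subset)
  have "fc (insert j V) f S
      = (fc V f S + uE V (\<lambda>A. f (insert j A) * chi S (insert j A))) / 2"
    by (simp add: fc_def bE_insert[OF assms(1,2)])
  then show "fc (insert j V) f S = (fc V f S + fc V (\<lambda>A. f (insert j A)) S) / 2"
    using S by (simp add: fc_def chi_insert_right_notin)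
  have a: "uE V (\<lambda>A. f A * chi (insert j S) A) = fc V f S"
    unfolding fc_def by (rule bE_cong) (use assms in \<open>auto simp: chi_insert_left S\<close>)
  have b: "uE V (\<lambda>A. f (insert j A) * chi (insert j S) (insert j A)) = - fc V (\<lambda>A. f (insert j A)) S"
    unfolding fc_def bE_minus[symmetric]
    by (rule bE_cong) (use S in \<open>auto simp: chi_insert_left chi_insert_right_notin\<close>)
  show "fc (insert j V) f (insert j S) = (fc V f S - fc V (\<lambda>A. f (insert j A)) S) / 2"
    unfolding fc_def[of "insert j V"] bE_insert[OF assms(1,2)] a b by simp
qed

lemma sum_Pow_insert:
  assumes "finite V" "j \<notin> V"
  shows "(\<Sum>S\<in>Pow (insert j V). g S) = (\<Sum>S\<in>Pow V. g S) + (\<Sum>S\<in>Pow V. g (insert j S))"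
proof -
  have inj: "inj_on (insert j) (Pow V)"
    using assms(2) by (intro inj_onI) (metis Diff_insert_absorb PowD subsetD)
  have "(\<Sum>S\<in>Pow (insert j V). g S) = sum g (Pow V) + sum g (insert j ` Pow V)"
    unfolding Pow_insert by (rule sum.union_disjoint) (use assms in auto)
  then show ?thesis by (simp add: sum.reindex[OF inj])
qed

text \<open>The coefficients over \<open>insert j V\<close> are the half sum and the half difference
  of those of the two restrictions, and the parallelogram law adds their squares.\<close>

theorem parseval:
  assumes "finite V"
  shows "(\<Sum>S\<in>Pow V. (fc V f S)\<^sup>2) = uE V (\<lambda>A. (f A)\<^sup>2)"
  using assms
proof (induction V arbitrary: f)
  case empty
  then show ?case by (simp add: fc_def)
next
  case (insert j V)
  let ?f1 = "\<lambda>A. f (insert j A)"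
  have "(\<Sum>S\<in>Pow (insert j V). (fc (insert j V) f S)\<^sup>2)
      = (\<Sum>S\<in>Pow V. ((fc V f S + fc V ?f1 S) / 2)\<^sup>2 + ((fc V f S - fc V ?f1 S) / 2)\<^sup>2)"
    unfolding sum_Pow_insert[OF insert.hyps] sum.distrib[symmetric]
    by (intro sum.cong refl) (simp only: Pow_iff fc_insert[OF insert.hyps])
  also have "\<dots> = (\<Sum>S\<in>Pow V. (fc V f S)\<^sup>2 / 2 + (fc V ?f1 S)\<^sup>2 / 2)"
    by (intro sum.cong refl) (simp add: power2_eq_square field_simps)
  also have "\<dots> = uE V (\<lambda>A. (f A)\<^sup>2) / 2 + uE V (\<lambda>A. (?f1 A)\<^sup>2) / 2"
    by (simp only: sum.distrib sum_divide_distrib[symmetric] insert.IH)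
  also have "\<dots> = uE (insert j V) (\<lambda>A. (f A)\<^sup>2)"
    by (simp add: bE_insert[OF insert.hyps])
  finally show ?case .
qed

lemma fc_dif:
  assumes "finite V" "i \<in> V" "S \<subseteq> V"
  shows "fc V (dif i f) S = (if i \<in> S then 0 else - 2 * fc V f (insert i S))"
proof -
  obtain U where U: "V = insert i U" "i \<notin> U" "finite U"
    using assms(1,2) by (metis finite_insert mk_disjoint_insert)
  have e: "fc U (dif i f) T = fc U (\<lambda>A. f (insert i A)) T - fc U f T"
    "fc U (\<lambda>A. dif i f (insert i A)) T = fc U (\<lambda>A. f (insert i A)) T - fc U f T" for T
    unfolding fc_def bE_diff[symmetric]
    by (rule bE_cong; use U in \<open>auto simp: dif_def algebra_simps intro!: arg_cong[of _ _ f]\<close>)+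
  show ?thesis
  proof (cases "i \<in> S")
    case True
    then obtain T where T: "S = insert i T" "T \<subseteq> U"
      using assms(3) U by (metis Diff_insert_absorb insert_Diff subset_insert_iff)
    then show ?thesis using fc_insert(2)[OF U(3,2) T(2), of "dif i f"] U e by simp
  next
    case False
    then have "S \<subseteq> U" using assms U by auto
    then show ?thesis
      using fc_insert(1)[OF U(3,2), of S "dif i f"] fc_insert(2)[OF U(3,2), of S f] U e False by simp
  qed
qed

text \<open>Parseval for the derivative: removing \<open>i\<close> maps the sets that contain
  \<open>i\<close> bijectively to the support of the coefficients of \<open>dif i f\<close>, each of
  them doubled. Doing this for a second variable produces the 16 of the next lemma.\<close>

lemma fourier_weight_containing:
  assumes "finite V" "i \<in> V"
  shows "(\<Sum>S | S \<subseteq> V \<and> i \<in> S. (fc V f S)\<^sup>2) = uE V (\<lambda>A. (dif i f A)\<^sup>2) / 4"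
proof -
  have "uE V (\<lambda>A. (dif i f A)\<^sup>2) = (\<Sum>S\<in>Pow V. (fc V (dif i f) S)\<^sup>2)"
    using parseval[OF assms(1)] by simp
  also have "\<dots> = (\<Sum>S | S \<subseteq> V \<and> i \<notin> S. 4 * (fc V f (insert i S))\<^sup>2)"
    using assms by (intro sum.mono_neutral_cong_right) (auto simp: fc_dif power_mult_distrib)
  also have "\<dots> = (\<Sum>S | S \<subseteq> V \<and> i \<in> S. 4 * (fc V f S)\<^sup>2)"
    by (rule sum.reindex_bij_witness[where i = "\<lambda>S. S - {i}" and j = "insert i"])
       (use assms in \<open>auto simp: insert_absorb\<close>)
  finally show ?thesis by (simp add: sum_distrib_left[symmetric])
qed

lemma fourier_weight_containing2:
  assumes "finite V" "i \<in> V" "j \<in> V" "i \<noteq> j"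
  shows "(\<Sum>S | S \<subseteq> V \<and> i \<in> S \<and> j \<in> S. (fc V f S)\<^sup>2) = uE V (\<lambda>A. (dif j (dif i f) A)\<^sup>2) / 16"
proof -
  have "uE V (\<lambda>A. (dif j (dif i f) A)\<^sup>2) / 4 = (\<Sum>S | S \<subseteq> V \<and> j \<in> S. (fc V (dif i f) S)\<^sup>2)"
    using fourier_weight_containing[OF assms(1,3)] by simp
  also have "\<dots> = (\<Sum>S | S \<subseteq> V \<and> j \<in> S \<and> i \<notin> S. 4 * (fc V f (insert i S))\<^sup>2)"
    using assms by (intro sum.mono_neutral_cong_right) (auto simp: fc_dif power_mult_distrib)
  also have "\<dots> = (\<Sum>S | S \<subseteq> V \<and> i \<in> S \<and> j \<in> S. 4 * (fc V f S)\<^sup>2)"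
    by (rule sum.reindex_bij_witness[where i = "\<lambda>S. S - {i}" and j = "insert i"])
       (use assms in \<open>auto simp: insert_absorb\<close>)
  finally show ?thesis by (simp add: sum_distrib_left[symmetric])
qed

section \<open>Marginals of submodular functions\<close>

text \<open>The two-point case of the moment comparison below. Pick \<open>m\<close> times
  independently, \<open>a\<close> with probability \<open>s\<close> and \<open>b\<close> otherwise:
  all picks are \<open>a\<close> with probability \<open>s ^ m\<close>, and in any other case the
  product is at least \<open>b ^ m\<close>.\<close>

lemma mixture_power_le:
  fixes a b s :: real
  assumes "0 \<le> b" "b \<le> a" "0 \<le> s" "s \<le> 1"
  shows "s ^ m * a ^ m + (1 - s ^ m) * b ^ m \<le> (s * a + (1 - s) * b) ^ m"
proof (induction m)
  case (Suc m)
  have sm: "0 \<le> s ^ m" "s ^ m \<le> 1" using assms by (auto intro: power_le_one)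
  have pw: "b ^ Suc m \<le> a ^ m * b" "b ^ Suc m \<le> b ^ m * a"
    using assms by (auto simp: mult.commute intro!: mult_right_mono mult_left_mono power_mono)
  have "s ^ Suc m * a ^ Suc m + (1 - s ^ Suc m) * b ^ Suc m
      = s * s ^ m * a ^ Suc m + (s ^ m * (1 - s) * b ^ Suc m + (1 - s ^ m) * s * b ^ Suc m
          + (1 - s ^ m) * (1 - s) * b ^ Suc m)"
    by (simp add: algebra_simps)
  also have "\<dots> \<le> s * s ^ m * a ^ Suc m + (s ^ m * (1 - s) * (a ^ m * b) + (1 - s ^ m) * s * (b ^ m * a)
          + (1 - s ^ m) * (1 - s) * b ^ Suc m)"
    using assms sm pw by (intro add_left_mono add_mono mult_left_mono order.refl mult_nonneg_nonneg) auto
  also have "\<dots> = (s ^ m * a ^ m + (1 - s ^ m) * b ^ m) * (s * a + (1 - s) * b)"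
    by (simp add: algebra_simps)
  also have "\<dots> \<le> (s * a + (1 - s) * b) ^ m * (s * a + (1 - s) * b)"
    using assms by (intro mult_right_mono Suc.IH) auto
  finally show ?case by (simp add: mult.commute)
qed simp

text \<open>
  The union of \<open>m\<close> independent random sets of bias \<open>p\<close> has bias \<open>q\<close>, and an antitone function of
  the union is at most the product over the \<open>m\<close> sets of its \<open>m\<close>-th root.
\<close>

lemma antitone_moment:
  assumes "finite V" and "\<And>A B. A \<subseteq> B \<Longrightarrow> B \<subseteq> V \<Longrightarrow> u B \<le> u A" and "\<And>A. A \<subseteq> V \<Longrightarrow> 0 \<le> u A"
    and p: "0 \<le> p" "p \<le> 1" and q: "1 - q = (1 - p) ^ m"
  shows "bE V (\<lambda>_. q) (\<lambda>A. u A ^ m) \<le> (bE V (\<lambda>_. p) u) ^ m"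
  using assms(1-3)
proof (induction V arbitrary: u)
  case (insert j V)
  let ?u1 = "\<lambda>A. u (insert j A)" and ?E = "bE V (\<lambda>_. p)"
  have q01: "0 \<le> q" "q \<le> 1"
  proof -
    have "0 \<le> (1 - p) ^ m" "(1 - p) ^ m \<le> 1" using p by (auto intro: power_le_one)
    then show "0 \<le> q" "q \<le> 1" using q by linarith+
  qed
  have IH0: "bE V (\<lambda>_. q) (\<lambda>A. u A ^ m) \<le> (?E u) ^ m"
    by (rule insert.IH) (auto intro: insert.prems)
  have IH1: "bE V (\<lambda>_. q) (\<lambda>A. ?u1 A ^ m) \<le> (?E ?u1) ^ m"
    by (rule insert.IH) (auto intro!: insert.prems)
  have le: "?E ?u1 \<le> ?E u" and nn: "0 \<le> ?E ?u1"
    using p by (auto intro!: bE_mono bE_nonneg insert.prems)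
  have "bE (insert j V) (\<lambda>_. q) (\<lambda>A. u A ^ m) \<le> (1 - q) * (?E u) ^ m + q * (?E ?u1) ^ m"
    unfolding bE_insert[OF insert.hyps] using q01 IH0 IH1 by (intro add_mono mult_left_mono) auto
  also have "\<dots> = (1 - p) ^ m * (?E u) ^ m + (1 - (1 - p) ^ m) * (?E ?u1) ^ m"
    using q by (simp flip: q)
  also have "\<dots> \<le> ((1 - p) * ?E u + (1 - (1 - p)) * ?E ?u1) ^ m"
    using p nn le by (intro mixture_power_le) auto
  also have "\<dots> = (bE (insert j V) (\<lambda>_. p) u) ^ m"
    by (simp add: bE_insert[OF insert.hyps])
  finally show ?case .
qed simp

lemma monotone_moment:
  assumes "finite V" and "\<And>A B. A \<subseteq> B \<Longrightarrow> B \<subseteq> V \<Longrightarrow> v A \<le> v B" and "\<And>A. A \<subseteq> V \<Longrightarrow> 0 \<le> v A"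
    and "0 \<le> p" "p \<le> 1" and "1 - q = (1 - p) ^ m"
  shows "bE V (\<lambda>_. 1 - q) (\<lambda>A. v A ^ m) \<le> (bE V (\<lambda>_. 1 - p) v) ^ m"
  unfolding bE_reflect by (rule antitone_moment[OF assms(1)]) (use assms in \<open>auto simp: Diff_mono\<close>)

text \<open>At every \<open>A\<close> the product of the two biased weights is the square of the
  uniform weight times the product of all \<open>1 - (s i)\<^sup>2\<close>, whichever elements lie
  in \<open>A\<close>. The Weierstrass inequality bounds that product below by 1/2, and the
  arithmetic-geometric mean inequality passes from the product of the weights to their sum.\<close>

lemma density_ge:
  assumes "finite V" and s: "\<And>i. i \<in> V \<Longrightarrow> 0 \<le> s i \<and> s i < 1" and sq: "(\<Sum>i\<in>V. (s i)\<^sup>2) \<le> 1/2"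
    and g: "\<And>A. A \<subseteq> V \<Longrightarrow> 0 \<le> g A"
  shows "uE V g \<le> bE V (\<lambda>i. (1 - s i) / 2) g + bE V (\<lambda>i. (1 + s i) / 2) g"
proof -
  have "1 / 2 * (\<Prod>i\<in>A. 1/2) * (\<Prod>i\<in>V - A. 1 - 1/2) * 2
      \<le> (\<Prod>i\<in>A. (1 - s i) / 2) * (\<Prod>i\<in>V - A. 1 - (1 - s i) / 2)
        + (\<Prod>i\<in>A. (1 + s i) / 2) * (\<Prod>i\<in>V - A. 1 - (1 + s i) / 2)" (is "_ \<le> ?X + ?Y")
    if A: "A \<in> Pow V" for A
  proof -
    have split: "(\<Prod>i\<in>V. x i) = (\<Prod>i\<in>A. x i) * (\<Prod>i\<in>V - A. x i)" for x :: "'a \<Rightarrow> real"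
      using A assms(1) by (simp add: prod.subset_diff[of A V] mult.commute)
    let ?h = "(\<Prod>i\<in>A. 1/2) * (\<Prod>i\<in>V - A. 1/2 :: real)"
    have h: "?h = (\<Prod>i\<in>V. 1/2)"
      by (rule split[symmetric])
    have "?X * ?Y = (\<Prod>i\<in>A. (1 - (s i)\<^sup>2) * (1/4)) * (\<Prod>i\<in>V - A. (1 - (s i)\<^sup>2) * (1/4))"
      unfolding mult.assoc[symmetric]
      by (subst mult.assoc, subst mult.commute[of "\<Prod>i\<in>V - A. 1 - (1 - s i) / 2"])
         (simp add: prod.distrib[symmetric] mult.assoc[symmetric] power2_eq_square field_simps)
    also have "\<dots> = (\<Prod>i\<in>V. (1 - (s i)\<^sup>2) * (1/4))"
      by (rule split[symmetric])
    also have "\<dots> = (\<Prod>i\<in>V. 1 - (s i)\<^sup>2) * (?h * ?h)"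
      unfolding h prod.distrib[symmetric] by simp
    finally have XY: "?X * ?Y = (\<Prod>i\<in>V. 1 - (s i)\<^sup>2) * (?h * ?h)" .
    have "1 - (\<Sum>i\<in>V. (s i)\<^sup>2) \<le> (\<Prod>i\<in>V. 1 - (s i)\<^sup>2)"
      by (rule Weierstrass_prod_ineq) (use s in \<open>force intro: power_le_one\<close>)
    then have "1/2 * (?h * ?h) \<le> ?X * ?Y"
      unfolding XY using sq by (intro mult_right_mono) auto
    moreover have "4 * (?X * ?Y) \<le> (?X + ?Y)\<^sup>2"
      using zero_le_power2[of "?X - ?Y"] by (simp add: power2_eq_square algebra_simps)
    ultimately have "?h\<^sup>2 \<le> (?X + ?Y)\<^sup>2"
      using zero_le_power2[of ?h] unfolding power2_eq_square by linarith
    moreover have "0 \<le> ?X + ?Y"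
      using s A by (intro add_nonneg_nonneg mult_nonneg_nonneg prod_nonneg) (force simp: field_simps)+
    ultimately show ?thesis
      using power2_le_imp_le by force
  qed
  then have "(\<Prod>i\<in>A. 1/2) * (\<Prod>i\<in>V - A. 1 - 1/2) * g A
      \<le> (\<Prod>i\<in>A. (1 - s i) / 2) * (\<Prod>i\<in>V - A. 1 - (1 - s i) / 2) * g A
        + (\<Prod>i\<in>A. (1 + s i) / 2) * (\<Prod>i\<in>V - A. 1 - (1 + s i) / 2) * g A" if "A \<in> Pow V" for A
    using that g[of A] by (simp only: distrib_right[symmetric]) (force intro: mult_right_mono)
  then show ?thesis
    unfolding bE_def sum.distrib[symmetric] by (intro sum_mono)
qed

lemma dif_commute_insert:
  "l \<noteq> j \<Longrightarrow> dif l g (insert j A) = dif l (\<lambda>A. g (insert j A)) A"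
  by (simp add: dif_def insert_commute insert_Diff_if)

text \<open>
  A discrete form of \<open>\<phi>'(-1) - \<phi>'(1) = \<integral> -\<phi>''\<close>.  Averaging the two opposite biases
  \<open>(1 \<plusminus> s i) / 2\<close> makes their density with respect to the uniform measure bounded below pointwise,
  by the inequality of arithmetic and geometric means.
\<close>

lemma bias_gap:
  assumes "finite V" and "\<And>i. i \<in> V \<Longrightarrow> 0 \<le> s i \<and> s i < 1" and "(\<Sum>i\<in>V. (s i)\<^sup>2) \<le> 1/2"
    and "\<And>A B. A \<subseteq> B \<Longrightarrow> B \<subseteq> V \<Longrightarrow> g B \<le> g A"
  shows "(\<Sum>j\<in>V. s j / 2 * uE V (\<lambda>A. - dif j g A))
    \<le> bE V (\<lambda>i. (1 - s i) / 2) g - bE V (\<lambda>i. (1 + s i) / 2) g"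
  using assms
proof (induction V arbitrary: g)
  case (insert j V)
  let ?g1 = "\<lambda>A. g (insert j A)" and ?k = "\<lambda>A. (g A + g (insert j A)) / 2"
  let ?m = "bE V (\<lambda>i. (1 - s i) / 2)" and ?p = "bE V (\<lambda>i. (1 + s i) / 2)"
  have sj: "0 \<le> s j" and sq: "(\<Sum>i\<in>V. (s i)\<^sup>2) \<le> 1/2"
    using insert.prems(1)[of j] insert.prems(2) insert.hyps by (auto intro: order_trans[rotated])
  have k: "(\<Sum>l\<in>V. s l / 2 * uE V (\<lambda>A. - dif l ?k A)) \<le> ?m ?k - ?p ?k"
  proof (rule insert.IH)
    fix A B assume AB: "A \<subseteq> B" "B \<subseteq> V"
    then have "g B \<le> g A" "g (insert j B) \<le> g (insert j A)"
      by (auto intro!: insert.prems(3))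
    then show "?k B \<le> ?k A" by simp
  qed (use insert.prems sq in auto)
  have dl: "uE (insert j V) (\<lambda>A. - dif l g A) = uE V (\<lambda>A. - dif l ?k A)" if "l \<in> V" for l
  proof -
    have lj: "l \<noteq> j" using that insert.hyps by auto
    have "uE (insert j V) (\<lambda>A. - dif l g A)
        = uE V (\<lambda>A. - dif l g A) / 2 + uE V (\<lambda>A. - dif l ?g1 A) / 2"
      unfolding bE_insert[OF insert.hyps] dif_commute_insert[OF lj] by simp
    also have "\<dots> = uE V (\<lambda>A. - dif l ?k A)"
      unfolding bE_divide[symmetric] bE_add[symmetric] by (rule bE_cong) (simp add: dif_def field_simps)
    finally show ?thesis .
  qed
  have dj: "uE (insert j V) (\<lambda>A. - dif j g A) = uE V (\<lambda>A. g A - ?g1 A)"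
  proof -
    have "uE V (\<lambda>A. - dif j g A) = uE V (\<lambda>A. g A - ?g1 A)"
      "uE V (\<lambda>A. - dif j g (insert j A)) = uE V (\<lambda>A. g A - ?g1 A)"
      by (rule bE_cong; use insert.hyps in \<open>auto simp: dif_def intro!: arg_cong[of _ _ g]\<close>)+
    then show ?thesis by (simp add: bE_insert[OF insert.hyps])
  qed
  have "uE V (\<lambda>A. g A - ?g1 A) \<le> ?m (\<lambda>A. g A - ?g1 A) + ?p (\<lambda>A. g A - ?g1 A)"
  proof (rule density_ge[OF insert.hyps(1) _ sq])
    fix A assume "A \<subseteq> V"
    then show "0 \<le> g A - g (insert j A)"
      using insert.prems(3)[of A "insert j A"] by auto
  qed (use insert.prems in auto)
  then have "s j / 2 * uE V (\<lambda>A. g A - ?g1 A) \<le> s j / 2 * (?m (\<lambda>A. g A - ?g1 A) + ?p (\<lambda>A. g A - ?g1 A))"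
    using sj by (intro mult_left_mono) auto
  \<comment> \<open>Splitting off coordinate \<open>j\<close> leaves the gap for the average
    \<open>?k\<close> of the two restrictions, plus a tilt of \<open>s j / 2\<close> under both
    measures. The sum of both measures in that tilt is the quantity that \<open>density_ge\<close>
    bounds below.\<close>
  moreover have "bE (insert j V) (\<lambda>i. (1 - s i) / 2) g - bE (insert j V) (\<lambda>i. (1 + s i) / 2) g
      = ?m ?k - ?p ?k + s j / 2 * (?m (\<lambda>A. g A - ?g1 A) + ?p (\<lambda>A. g A - ?g1 A))"
    unfolding bE_insert[OF insert.hyps] bE_divide bE_add bE_diff by (simp add: field_simps)
  moreover have "(\<Sum>l\<in>insert j V. s l / 2 * uE (insert j V) (\<lambda>A. - dif l g A))
      = s j / 2 * uE V (\<lambda>A. g A - ?g1 A) + (\<Sum>l\<in>V. s l / 2 * uE V (\<lambda>A. - dif l ?k A))"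
    using insert.hyps by (simp add: dl dj)
  ultimately show ?case using k by linarith
qed simp

lemma uE_power_eq_0:
  assumes "finite V" "\<And>A. A \<subseteq> V \<Longrightarrow> 0 \<le> g A" "uE V (\<lambda>A. g A ^ m) \<le> 0" "A \<subseteq> V" "m > 0"
  shows "g A = 0"
proof -
  have "(\<Sum>A\<in>Pow V. g A ^ m) \<le> 0"
    using assms(3) unfolding uE_eq_average[OF assms(1)]
    by (smt (verit) divide_pos_pos zero_less_power)
  moreover have "0 \<le> (\<Sum>A\<in>Pow V. g A ^ m)" using assms(2) by (intro sum_nonneg) auto
  ultimately have "(\<Sum>A\<in>Pow V. g A ^ m) = 0" by linarith
  then have "g A ^ m = 0"
    using assms by (subst (asm) sum_nonneg_eq_0_iff) auto
  then show ?thesis by simp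
qed

text \<open>Truncation at level \<open>c\<close>: below it the square is at most
  \<open>c * g A\<close>, above it at most \<open>g A ^ m / c ^ (m - 2)\<close>. If \<open>c\<close>
  exceeds the scale \<open>b\<close> by a constant factor, the second term is exponentially small in
  \<open>m\<close>. Only a first moment remains, and for functions of constant sign that is just an
  expectation.\<close>

lemma second_moment_from_tail:
  assumes "finite V" "\<And>A. A \<subseteq> V \<Longrightarrow> 0 \<le> g A" "2 \<le> m" "0 \<le> b" "0 \<le> c"
    and "uE V (\<lambda>A. g A ^ m) \<le> C * b ^ m" and "c = 0 \<Longrightarrow> b = 0"
  shows "uE V (\<lambda>A. (g A)\<^sup>2) \<le> c * uE V g + C * b ^ m / c ^ (m - 2)"
proof (cases "c = 0")
  case True
  then have "uE V (\<lambda>A. g A ^ m) \<le> 0" using assms(3,6,7) by (simp add: power_0_left)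
  then have "uE V (\<lambda>A. (g A)\<^sup>2) = uE V (\<lambda>A. 0)"
    using uE_power_eq_0[OF assms(1,2) _ _ less_le_trans[OF _ assms(3)]] by (intro bE_cong) simp
  then show ?thesis using True assms(3,7) by (simp add: bE_def power_0_left)
next
  case False
  then have c: "c > 0" using assms by simp
  have "(g A)\<^sup>2 \<le> c * g A + g A ^ m / c ^ (m - 2)" if "A \<subseteq> V" for A
  proof (cases "g A \<le> c")
    case True
    then have "(g A)\<^sup>2 \<le> c * g A" using assms(2)[OF that] by (simp add: power2_eq_square mult_right_mono)
    moreover have "0 \<le> g A ^ m / c ^ (m - 2)" using c assms(2)[OF that] by simp
    ultimately show ?thesis by linarith
  next
    case False
    then have "(g A)\<^sup>2 * c ^ (m - 2) \<le> (g A)\<^sup>2 * g A ^ (m - 2)"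
      using c by (intro mult_left_mono power_mono) auto
    also have "\<dots> = g A ^ m" using assms(3) by (metis le_add_diff_inverse power_add)
    finally have "(g A)\<^sup>2 \<le> g A ^ m / c ^ (m - 2)" using c by (simp add: field_simps)
    then show ?thesis using c assms(2)[OF that] by (smt (verit) mult_nonneg_nonneg)
  qed
  then have "uE V (\<lambda>A. (g A)\<^sup>2) \<le> uE V (\<lambda>A. c * g A + g A ^ m / c ^ (m - 2))"
    by (intro bE_mono) auto
  also have "\<dots> = c * uE V g + uE V (\<lambda>A. g A ^ m) / c ^ (m - 2)"
    by (simp add: bE_add bE_cmult bE_divide)
  also have "\<dots> \<le> c * uE V g + C * b ^ m / c ^ (m - 2)"
    using assms c by (intro add_left_mono divide_right_mono) auto
  finally show ?thesis .
qed

section \<open>Marginals of a submodular function with values in [0,1]\<close>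

locale unit_submodular =
  fixes V :: "'a set" and f :: "'a set \<Rightarrow> real"
  assumes fin: "finite V"
    and submod: "\<And>A B. A \<subseteq> V \<Longrightarrow> B \<subseteq> V \<Longrightarrow> f (A \<union> B) + f (A \<inter> B) \<le> f A + f B"
    and f_nonneg: "\<And>A. A \<subseteq> V \<Longrightarrow> 0 \<le> f A" and f_le_1: "\<And>A. A \<subseteq> V \<Longrightarrow> f A \<le> 1"
begin

text \<open>Diminishing returns: submodularity for \<open>insert i A\<close> and
  \<open>B - {i}\<close>.\<close>

lemma dif_antimono:
  assumes "i \<in> V" "A \<subseteq> B" "B \<subseteq> V"
  shows "dif i f B \<le> dif i f A"
proof -
  have "insert i A \<union> (B - {i}) = insert i B" "insert i A \<inter> (B - {i}) = A - {i}"
    using assms by auto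
  moreover have "insert i A \<subseteq> V" "B - {i} \<subseteq> V"
    using assms by auto
  ultimately have "f (insert i B) + f (A - {i}) \<le> f (insert i A) + f (B - {i})"
    using submod by metis
  then show ?thesis
    by (simp add: dif_def)
qed

lemma dif_dif_nonpos:
  assumes "i \<in> V" "j \<in> V" "A \<subseteq> V"
  shows "dif j (dif i f) A \<le> 0"
  using dif_antimono[of i "A - {j}" "insert j A"] assms by (auto simp: dif_def[of j])

text \<open>Remove from \<open>A\<close>, one by one, the elements with positive marginal. Marginals
  grow as the set shrinks, so each removal lowers \<open>f\<close> by at least the marginal at
  \<open>A\<close>, and the total drop is at most 1. The next lemma is the dual: adding elements of
  negative marginal lowers \<open>f\<close> at least as much as the marginals at \<open>A\<close>
  predict.\<close>

lemma dif_pos_sum_le_1: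
  assumes "A \<subseteq> V"
  shows "(\<Sum>i\<in>A. max 0 (dif i f A)) \<le> 1"
proof -
  have fA: "finite A" using assms fin finite_subset by blast
  have rem: "f (A - R) + (\<Sum>i\<in>R. dif i f A) \<le> f A" if "R \<subseteq> A" for R
    using finite_subset[OF that fA] that
  proof (induction R)
    case (insert i R)
    then have "insert i (A - R) = A - R" "A - R - {i} = A - insert i R" by auto
    then have "f (A - insert i R) = f (A - R) - dif i f (A - R)" by (simp add: dif_def)
    moreover have "dif i f A \<le> dif i f (A - R)"
      using insert.prems assms by (intro dif_antimono) auto
    ultimately show ?case using insert by simp
  qed simp
  let ?R = "{i\<in>A. 0 < dif i f A}"
  have "(\<Sum>i\<in>A. max 0 (dif i f A)) = (\<Sum>i\<in>?R. dif i f A)"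
    using fA by (intro sum.mono_neutral_cong_right) auto
  also have "\<dots> \<le> f A - f (A - ?R)" using rem[of ?R] by auto
  also have "\<dots> \<le> 1" using f_le_1[OF assms] f_nonneg[OF subset_trans[OF Diff_subset assms]] by (smt (verit))
  finally show ?thesis .
qed

lemma dif_neg_sum_le_1:
  assumes "A \<subseteq> V"
  shows "(\<Sum>i\<in>V - A. max 0 (- dif i f A)) \<le> 1"
proof -
  have add: "f (A \<union> R) \<le> f A + (\<Sum>i\<in>R. dif i f A)" if "R \<subseteq> V - A" for R
    using finite_subset[OF that finite_Diff[OF fin]] that
  proof (induction R)
    case (insert i R)
    then have "insert i (A \<union> R) = A \<union> insert i R" "A \<union> R - {i} = A \<union> R" by auto
    then have "f (A \<union> insert i R) = f (A \<union> R) + dif i f (A \<union> R)" by (simp add: dif_def)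
    moreover have "dif i f (A \<union> R) \<le> dif i f A"
      using insert.prems assms by (intro dif_antimono) auto
    ultimately show ?case using insert by simp
  qed simp
  let ?R = "{i\<in>V - A. dif i f A < 0}"
  have "(\<Sum>i\<in>V - A. max 0 (- dif i f A)) = (\<Sum>i\<in>?R. - dif i f A)"
    using fin by (intro sum.mono_neutral_cong_right) auto
  also have "\<dots> \<le> f A - f (A \<union> ?R)" using add[of ?R] by (simp add: sum_negf subset_iff)
  also have "\<dots> \<le> f A"
  proof -
    have "A \<union> ?R \<subseteq> V" using assms by auto
    then show ?thesis using f_nonneg by force
  qed
  also have "\<dots> \<le> 1" by (rule f_le_1[OF assms])
  finally show ?thesis .
qed

lemma dif_insert_same: "dif i f (insert i A) = dif i f A"
  by (simp add: dif_def)

text \<open>A pointwise bound is available only for the sum over \<open>i \<in> A\<close>. The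
  marginal ignores whether \<open>i\<close> belongs to \<open>A\<close>, so restricting to that
  event costs exactly the factor \<open>p i\<close>, which is at least \<open>c\<close>. The biases
  may differ between coordinates, as the tilted measures of \<open>sum_dif_dif_le\<close>
  require.\<close>

lemma expected_pos_dif:
  assumes "\<And>i. i \<in> V \<Longrightarrow> c \<le> p i \<and> 0 \<le> p i \<and> p i \<le> 1"
  shows "c * (\<Sum>i\<in>V. bE V p (\<lambda>A. max 0 (dif i f A))) \<le> 1"
proof -
  have "c * (\<Sum>i\<in>V. bE V p (\<lambda>A. max 0 (dif i f A))) \<le> (\<Sum>i\<in>V. p i * bE V p (\<lambda>A. max 0 (dif i f A)))"
    unfolding sum_distrib_left using assms by (intro sum_mono mult_right_mono bE_nonneg) auto
  also have "\<dots> = (\<Sum>i\<in>V. bE V p (\<lambda>A. if i \<in> A then max 0 (dif i f A) else 0))"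
    by (intro sum.cong refl bE_independent(1)[symmetric] fin) (auto simp: dif_insert_same)
  also have "\<dots> = bE V p (\<lambda>A. \<Sum>i\<in>A. max 0 (dif i f A))"
    unfolding bE_sum[symmetric] using fin
    by (intro bE_cong sum.mono_neutral_cong_right) auto
  also have "\<dots> \<le> bE V p (\<lambda>_. 1)"
    using assms by (intro bE_mono dif_pos_sum_le_1) auto
  finally show ?thesis by (simp add: bE_const fin)
qed

lemma expected_neg_dif:
  assumes "\<And>i. i \<in> V \<Longrightarrow> c \<le> 1 - p i \<and> 0 \<le> p i \<and> p i \<le> 1"
  shows "c * (\<Sum>i\<in>V. bE V p (\<lambda>A. max 0 (- dif i f A))) \<le> 1"
proof -
  have "c * (\<Sum>i\<in>V. bE V p (\<lambda>A. max 0 (- dif i f A))) \<le> (\<Sum>i\<in>V. (1 - p i) * bE V p (\<lambda>A. max 0 (- dif i f A)))"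
    unfolding sum_distrib_left using assms by (intro sum_mono mult_right_mono bE_nonneg) auto
  also have "\<dots> = (\<Sum>i\<in>V. bE V p (\<lambda>A. if i \<in> A then 0 else max 0 (- dif i f A)))"
    by (intro sum.cong refl bE_independent(2)[symmetric] fin) (auto simp: dif_insert_same)
  also have "\<dots> = bE V p (\<lambda>A. \<Sum>i\<in>V - A. max 0 (- dif i f A))"
    unfolding bE_sum[symmetric] using fin
    by (intro bE_cong sum.mono_neutral_cong_right) auto
  also have "\<dots> \<le> bE V p (\<lambda>_. 1)"
    using assms by (intro bE_mono dif_neg_sum_le_1) auto
  finally show ?thesis by (simp add: bE_const fin)
qed

end

section \<open>Low-degree concentration and juntas\<close>

lemma power_add_le_abs:
  fixes x y :: real
  shows "\<bar>x - y\<bar> ^ m \<le> 2 ^ m * (\<bar>x\<bar> ^ m + \<bar>y\<bar> ^ m)"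
proof -
  have "\<bar>x - y\<bar> ^ m \<le> (2 * max \<bar>x\<bar> \<bar>y\<bar>) ^ m"
    by (rule power_mono) auto
  also have "\<dots> = 2 ^ m * (max \<bar>x\<bar> \<bar>y\<bar>) ^ m"
    by (rule power_mult_distrib)
  also have "\<dots> \<le> 2 ^ m * (\<bar>x\<bar> ^ m + \<bar>y\<bar> ^ m)"
    by (intro mult_left_mono) (auto simp: max_def)
  finally show ?thesis .
qed

lemma bE_shift_sum:
  assumes "finite V" "j \<in> V"
  shows "uE V (\<lambda>A. g (insert j A) + g (A - {j})) = 2 * uE V g"
proof -
  obtain U where U: "V = insert j U" "j \<notin> U" "finite U"
    using assms by (metis finite_insert mk_disjoint_insert)
  have "uE U (\<lambda>A. g (A - {j})) = uE U g" 
    by (rule bE_cong) (use U in \<open>auto intro!: arg_cong[of _ _ g]\<close>)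
  moreover have "uE U (\<lambda>A. g (insert j A - {j})) = uE U g"
    by (rule bE_cong) (use U in \<open>auto intro!: arg_cong[of _ _ g]\<close>)
  ultimately show ?thesis
    unfolding U(1) bE_insert[OF U(3,2)] bE_add by simp
qed

lemma dif_dif_commute:
  assumes "i \<noteq> j"
  shows "dif i (dif j f) A = dif j (dif i f) A"
proof -
  have "insert j (insert i A) = insert i (insert j A)" "insert i A - {j} = insert i (A - {j})"
    "insert j (A - {i}) = insert j A - {i}" "A - {i} - {j} = A - {j} - {i}"
    using assms by auto
  then show ?thesis unfolding dif_def by simp
qed

lemma card_pairs:
  assumes "finite W"
  shows "(\<Sum>i\<in>W. \<Sum>j\<in>W - {i}. if i \<in> S \<and> j \<in> S then 1 else 0 :: real)
    = real (card (S \<inter> W)) * (real (card (S \<inter> W)) - 1)"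
proof -
  have "(\<Sum>j\<in>W - {i}. if i \<in> S \<and> j \<in> S then 1 else 0 :: real) = (if i \<in> S then real (card (S \<inter> W)) - 1 else 0)"
    if "i \<in> W" for i
  proof (cases "i \<in> S")
    case True
    have "(\<Sum>j\<in>W - {i}. if i \<in> S \<and> j \<in> S then 1 else 0 :: real) = (\<Sum>j\<in>S \<inter> W - {i}. 1)"
      using assms True by (intro sum.mono_neutral_cong_right) auto
    also have "\<dots> = real (card (S \<inter> W)) - 1"
    proof -
      have "card (S \<inter> W) \<ge> 1"
        using True that assms by (metis IntI One_nat_def Suc_leI card_gt_0_iff empty_iff finite_Int)
      then show ?thesis using True that assms by (simp add: of_nat_diff card_Diff_singleton)
    qed
    finally show ?thesis using True by simp
  qed simp
  then have "(\<Sum>i\<in>W. \<Sum>j\<in>W - {i}. if i \<in> S \<and> j \<in> S then 1 else 0 :: real)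
      = (\<Sum>i\<in>W. if i \<in> S then real (card (S \<inter> W)) - 1 else 0)"
    by (intro sum.cong) auto
  also have "\<dots> = (\<Sum>i\<in>S \<inter> W. real (card (S \<inter> W)) - 1)"
    using assms by (intro sum.mono_neutral_cong_right) auto
  finally show ?thesis by simp
qed

section \<open>Influences, the junta theorem and the weight at high degree\<close>

locale unit_submodular_moment = unit_submodular +
  fixes m :: nat and p :: real
  assumes m2: "2 \<le> m" and p: "0 < p" "p \<le> 1/2" and pm: "(1 - p) ^ m = 1/2" and pinv: "1 / p \<le> 2 * real m"
begin

text \<open>The \<open>a\<^sub>i\<close> of the overview. The two biases are those from which
  \<open>antitone_moment\<close> and \<open>monotone_moment\<close> reach the uniform measure after
  \<open>m\<close> unions or intersections. As \<open>1 / p\<close> is at most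
  \<open>2 * real m\<close>, the sum of all influences stays of order \<open>m\<close>.\<close>

definition infl :: "'a \<Rightarrow> real" where
  "infl i = bE V (\<lambda>_. p) (\<lambda>A. max 0 (dif i f A)) + bE V (\<lambda>_. 1 - p) (\<lambda>A. max 0 (- dif i f A))"

lemma infl_parts_nonneg:
  "0 \<le> bE V (\<lambda>_. p) (\<lambda>A. max 0 (dif i f A))" "0 \<le> bE V (\<lambda>_. 1 - p) (\<lambda>A. max 0 (- dif i f A))"
  using p by (auto intro!: bE_nonneg)

lemma infl_nonneg: "0 \<le> infl i"
  unfolding infl_def using infl_parts_nonneg[of i] by linarith

lemma sum_infl_le: "(\<Sum>i\<in>V. infl i) \<le> 4 * real m"
proof -
  have "p * (\<Sum>i\<in>V. bE V (\<lambda>_. p) (\<lambda>A. max 0 (dif i f A))) \<le> 1"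
    by (rule expected_pos_dif) (use p in auto)
  moreover have "p * (\<Sum>i\<in>V. bE V (\<lambda>_. 1 - p) (\<lambda>A. max 0 (- dif i f A))) \<le> 1"
    by (rule expected_neg_dif) (use p in auto)
  ultimately have "p * (\<Sum>i\<in>V. infl i) \<le> 2"
    by (simp add: infl_def sum.distrib algebra_simps)
  then have "(\<Sum>i\<in>V. infl i) \<le> 2 * (1 / p)"
    using p by (simp add: field_simps)
  then show ?thesis using pinv by linarith
qed

text \<open>At each point at most one of the positive and the negative part is nonzero, so the
  moment splits into two, and \<open>x ^ m + y ^ m \<le> (x + y) ^ m\<close> joins the two bounds
  again.\<close>

lemma moment_dif:
  assumes "i \<in> V"
  shows "uE V (\<lambda>A. \<bar>dif i f A\<bar> ^ m) \<le> infl i ^ m"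
proof -
  let ?u = "\<lambda>A. max 0 (dif i f A)" and ?v = "\<lambda>A. max 0 (- dif i f A)"
  have "uE V (\<lambda>A. ?u A ^ m) \<le> (bE V (\<lambda>_. p) ?u) ^ m"
    by (rule antitone_moment[OF fin]) (use p pm dif_antimono[OF assms] in \<open>auto simp: max_def intro: order_trans\<close>)
  moreover have "bE V (\<lambda>_. 1 - 1/2) (\<lambda>A. ?v A ^ m) \<le> (bE V (\<lambda>_. 1 - p) ?v) ^ m"
  proof (rule monotone_moment[OF fin])
    fix A B assume "A \<subseteq> B" "B \<subseteq> V"
    then show "?v A \<le> ?v B" using dif_antimono[OF assms, of A B] by (auto simp: max_def)
  qed (use p pm in auto)
  moreover have "uE V (\<lambda>A. \<bar>dif i f A\<bar> ^ m) = uE V (\<lambda>A. ?u A ^ m + ?v A ^ m)"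
    by (rule bE_cong) (use m2 in \<open>auto simp: max_def power_0_left\<close>)
  moreover have "x ^ m + y ^ m \<le> (x + y) ^ m" if "0 \<le> x" "0 \<le> y" for x y :: real
  proof -
    obtain r where m: "m = Suc r" using m2 by (cases m) auto
    have "x * x ^ r + y * y ^ r \<le> x * (x + y) ^ r + y * (x + y) ^ r"
      using that by (intro add_mono mult_left_mono power_mono) auto
    then show ?thesis by (simp add: m algebra_simps)
  qed
  moreover have "bE V (\<lambda>_. 1 - 1/2) = uE V"
    by simp
  ultimately show ?thesis
    using infl_parts_nonneg[of i] unfolding infl_def bE_add by (smt (verit, ccfv_threshold))
qed

text \<open>Truncation at \<open>infl i\<close> itself derives the second moment from the
  \<open>m\<close>-th one, at the cost of a factor 2 compared with the inequality between power
  means.\<close>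

lemma second_moment_dif:
  assumes "i \<in> V"
  shows "uE V (\<lambda>A. (dif i f A)\<^sup>2) \<le> 2 * (infl i)\<^sup>2"
proof -
  let ?a = "infl i" and ?g = "\<lambda>A. \<bar>dif i f A\<bar>"
  show ?thesis
  proof (cases "?a = 0")
    case True
    then have "uE V (\<lambda>A. ?g A ^ m) \<le> 0" using moment_dif[OF assms] m2 by (simp add: power_0_left)
    then have "?g A = 0" if "A \<subseteq> V" for A
      by (rule uE_power_eq_0[OF fin abs_ge_zero]) (use that m2 in auto)
    then have "uE V (\<lambda>A. (dif i f A)\<^sup>2) = uE V (\<lambda>_. 0)" by (intro bE_cong) simp
    then show ?thesis by (simp add: bE_const fin)
  next
    case False
    then have a: "0 < ?a" using infl_nonneg[of i] by simp
    have "(dif i f A)\<^sup>2 \<le> ?a\<^sup>2 + ?g A ^ m / ?a ^ (m - 2)" for A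
    proof (cases "?g A \<le> ?a")
      case True
      then have "(dif i f A)\<^sup>2 \<le> ?a\<^sup>2" by (metis abs_ge_zero power2_abs power_mono)
      moreover have "0 \<le> ?g A ^ m / ?a ^ (m - 2)" using a by simp
      ultimately show ?thesis by linarith
    next
      case False
      then have "(dif i f A)\<^sup>2 * ?a ^ (m - 2) \<le> ?g A ^ 2 * ?g A ^ (m - 2)"
        unfolding power2_abs using a by (intro mult_left_mono power_mono) auto
      also have "\<dots> = ?g A ^ m" using m2 by (metis le_add_diff_inverse power_add)
      finally have "(dif i f A)\<^sup>2 \<le> ?g A ^ m / ?a ^ (m - 2)" using a by (simp add: field_simps)
      then show ?thesis by (smt (verit) zero_le_power2)
    qed
    then have "uE V (\<lambda>A. (dif i f A)\<^sup>2) \<le> uE V (\<lambda>A. ?a\<^sup>2 + ?g A ^ m / ?a ^ (m - 2))"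
      by (intro bE_mono) auto
    also have "\<dots> = ?a\<^sup>2 + uE V (\<lambda>A. ?g A ^ m) / ?a ^ (m - 2)"
      by (simp add: bE_add bE_divide bE_const fin)
    also have "\<dots> \<le> ?a\<^sup>2 + ?a ^ m / ?a ^ (m - 2)"
      using a by (intro add_left_mono divide_right_mono moment_dif assms) auto
    also have "?a ^ m / ?a ^ (m - 2) = ?a\<^sup>2"
      using a m2 power_diff[of ?a "m - 2" m] by simp
    finally show ?thesis by simp
  qed
qed

lemma moment_dif_dif:
  assumes "i \<in> V" "j \<in> V"
  shows "uE V (\<lambda>A. \<bar>dif j (dif i f) A\<bar> ^ m) \<le> 2 * (2 * infl i) ^ m"
proof -
  let ?g = "\<lambda>A. \<bar>dif i f A\<bar> ^ m"
  have "uE V (\<lambda>A. \<bar>dif j (dif i f) A\<bar> ^ m) \<le> uE V (\<lambda>A. 2 ^ m * (?g (insert j A) + ?g (A - {j})))"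
    unfolding dif_def[of j] by (intro bE_mono power_add_le_abs) auto
  also have "\<dots> = 2 ^ m * (2 * uE V ?g)"
    using bE_shift_sum[OF fin assms(2), of ?g] by (simp only: bE_cmult)
  also have "\<dots> \<le> 2 ^ m * (2 * infl i ^ m)"
    using moment_dif[OF assms(1)] by simp
  finally show ?thesis by (simp add: power_mult_distrib algebra_simps)
qed

text \<open>The moment bound holds with either variable taken first, hence with the smaller
  influence and hence with the geometric mean \<open>b\<close>. Its scale is \<open>2 * b\<close>;
  truncating at \<open>4 * b\<close> leaves a tail smaller by \<open>2 ^ m\<close>.\<close>

lemma second_moment_dif_dif:
  assumes "i \<in> V" "j \<in> V" "i \<noteq> j"
  defines "b \<equiv> sqrt (infl i * infl j)"
  shows "uE V (\<lambda>A. (dif j (dif i f) A)\<^sup>2) \<le> 4 * b * uE V (\<lambda>A. \<bar>dif j (dif i f) A\<bar>) + 32 * b\<^sup>2 / 2 ^ m"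
proof -
  let ?g = "\<lambda>A. \<bar>dif j (dif i f) A\<bar>"
  have b0: "0 \<le> b" using infl_nonneg by (simp add: b_def)
  have "uE V (\<lambda>A. ?g A ^ m) \<le> 2 * (2 * min (infl i) (infl j)) ^ m"
    using moment_dif_dif[OF assms(1,2)] moment_dif_dif[OF assms(2,1)] assms(3)
    by (simp add: min_def dif_dif_commute[of i j])
  also have "\<dots> \<le> 2 * (2 * b) ^ m"
  proof -
    have "(min (infl i) (infl j))\<^sup>2 \<le> infl i * infl j"
      unfolding power2_eq_square using infl_nonneg by (intro mult_mono) auto
    then have "min (infl i) (infl j) \<le> b" unfolding b_def by (rule real_le_rsqrt)
    then show ?thesis using infl_nonneg by (intro mult_left_mono power_mono) auto
  qed
  finally have "uE V (\<lambda>A. ?g A ^ m) \<le> 2 * (2 * b) ^ m" .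
  then have "uE V (\<lambda>A. (?g A)\<^sup>2) \<le> 4 * b * uE V ?g + 2 * (2 * b) ^ m / (4 * b) ^ (m - 2)"
    by (intro second_moment_from_tail fin m2) (use b0 in auto)
  also have "2 * (2 * b) ^ m / (4 * b) ^ (m - 2) = 32 * b\<^sup>2 / 2 ^ m"
  proof (cases "b = 0")
    case False
    obtain r where m: "m = r + 2" using m2 by (metis add.commute le_Suc_ex)
    have "(4::real) ^ r = 2 ^ r * 2 ^ r" by (simp flip: power_mult_distrib)
    then show ?thesis using False by (simp add: m power_mult_distrib power_add field_simps power2_eq_square)
  qed (use m2 in \<open>simp add: power_0_left\<close>)
  finally show ?thesis by simp
qed

text \<open>Keep the variables with \<open>infl i > \<theta>\<close>, of which there are few since
  the influences have sum at most \<open>4 * real m\<close>. A discarded variable carries weight at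
  most \<open>(infl i)\<^sup>2 / 2 \<le> \<theta> * infl i / 2\<close>, and these bounds are
  summable.\<close>

lemma junta_exists:
  assumes "0 < \<theta>"
  obtains J where "J \<subseteq> V" "real (card J) \<le> 4 * real m / \<theta>"
    "(\<Sum>S | S \<subseteq> V \<and> \<not> S \<subseteq> J. (fc V f S)\<^sup>2) \<le> 2 * \<theta> * real m"
proof
  let ?J = "{i\<in>V. \<theta> < infl i}"
  show "?J \<subseteq> V" by auto
  have "real (card ?J) * \<theta> = (\<Sum>i\<in>?J. \<theta>)" by simp
  also have "\<dots> \<le> (\<Sum>i\<in>?J. infl i)" by (intro sum_mono) auto
  also have "\<dots> \<le> (\<Sum>i\<in>V. infl i)" using fin infl_nonneg by (intro sum_mono2) auto
  finally show "real (card ?J) \<le> 4 * real m / \<theta>" using sum_infl_le assms by (simp add: field_simps)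
  have "(\<Sum>S | S \<subseteq> V \<and> \<not> S \<subseteq> ?J. (fc V f S)\<^sup>2)
      \<le> (\<Sum>S\<in>Pow V. \<Sum>i\<in>V - ?J. if i \<in> S then (fc V f S)\<^sup>2 else 0)"
  proof (rule order_trans[OF _ sum_mono2])
    show "(\<Sum>S | S \<subseteq> V \<and> \<not> S \<subseteq> ?J. (fc V f S)\<^sup>2)
        \<le> (\<Sum>S | S \<subseteq> V \<and> \<not> S \<subseteq> ?J. \<Sum>i\<in>V - ?J. if i \<in> S then (fc V f S)\<^sup>2 else 0)"
    proof (rule sum_mono)
      fix S assume "S \<in> {S. S \<subseteq> V \<and> \<not> S \<subseteq> ?J}"
      then obtain i where i: "i \<in> V - ?J" "i \<in> S" by auto
      have "(\<Sum>i\<in>{i}. if i \<in> S then (fc V f S)\<^sup>2 else 0)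
          \<le> (\<Sum>i\<in>V - ?J. if i \<in> S then (fc V f S)\<^sup>2 else 0)"
        using i fin by (intro sum_mono2) auto
      then show "(fc V f S)\<^sup>2 \<le> (\<Sum>i\<in>V - ?J. if i \<in> S then (fc V f S)\<^sup>2 else 0)"
        using i by simp
    qed
  qed (use fin in \<open>auto intro!: sum_nonneg split: if_splits simp del: Diff_iff\<close>)
  also have "\<dots> = (\<Sum>i\<in>V - ?J. \<Sum>S\<in>Pow V. if i \<in> S then (fc V f S)\<^sup>2 else 0)"
    by (rule sum.swap)
  also have "\<dots> = (\<Sum>i\<in>V - ?J. \<Sum>S | S \<subseteq> V \<and> i \<in> S. (fc V f S)\<^sup>2)"
    using fin by (intro sum.cong refl sum.mono_neutral_cong_right) auto
  also have "\<dots> \<le> (\<Sum>i\<in>V - ?J. \<theta> * infl i / 2)"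
  proof (rule sum_mono)
    fix i assume i: "i \<in> V - ?J"
    then have "(\<Sum>S | S \<subseteq> V \<and> i \<in> S. (fc V f S)\<^sup>2) \<le> (infl i)\<^sup>2 / 2"
      using fourier_weight_containing[OF fin, of i f] second_moment_dif[of i] by simp
    also have "\<dots> \<le> \<theta> * infl i / 2"
      using i infl_nonneg[of i] by (auto simp: power2_eq_square intro!: mult_right_mono)
    finally show "(\<Sum>S | S \<subseteq> V \<and> i \<in> S. (fc V f S)\<^sup>2) \<le> \<theta> * infl i / 2" .
  qed
  also have "\<dots> \<le> (\<Sum>i\<in>V. \<theta> * infl i / 2)"
    using fin infl_nonneg assms by (intro sum_mono2) auto
  also have "\<dots> = \<theta> / 2 * (\<Sum>i\<in>V. infl i)" by (simp add: sum_distrib_left)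
  also have "\<dots> \<le> \<theta> / 2 * (4 * real m)" using assms by (intro mult_left_mono sum_infl_le) auto
  finally show "(\<Sum>S | S \<subseteq> V \<and> \<not> S \<subseteq> ?J. (fc V f S)\<^sup>2) \<le> 2 * \<theta> * real m" by simp
qed

text \<open>The source of the extra factor K^(-1/2). Apply \<open>bias_gap\<close> to each marginal
  \<open>dif i f\<close>, tilting coordinate \<open>j\<close> in proportion to
  sqrt(\<open>infl j\<close>). The gaps over all \<open>i\<close> have sum at most 8 because
  \<open>f\<close> is bounded, and summing them with weights proportional to
  sqrt(\<open>infl i\<close>) produces the left-hand side.\<close>

lemma sum_dif_dif_le:
  assumes "2 \<le> K"
  defines "W \<equiv> {i\<in>V. infl i \<le> 1 / real K}"
  shows "(\<Sum>i\<in>W. \<Sum>j\<in>W. sqrt (infl i * infl j) * uE V (\<lambda>A. \<bar>dif j (dif i f) A\<bar>))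
    \<le> 8 * sqrt (32 * real m / real K)"
proof -
  \<comment> \<open>The tilts must satisfy the condition of \<open>density_ge\<close> that their
    squares sum to at most 1/2. Together with \<open>sum_infl_le\<close> this value uses the
    condition up exactly.\<close>
  define lam where "lam = 1 / sqrt (32 * real m)"
  have m0: "0 < real m" using m2 by simp
  have lam0: "0 < lam" using m0 by (simp add: lam_def)
  have lam2: "lam\<^sup>2 = 1 / (32 * real m)" by (simp add: lam_def power_divide)
  have lam1: "lam \<le> 1/8"
  proof (rule power2_le_imp_le)
    show "lam\<^sup>2 \<le> (1/8)\<^sup>2" unfolding lam2 using m2 by (simp add: power_divide field_simps)
  qed simp
  define s where "s i = (if i \<in> W then 2 * lam * sqrt (infl i) else 0)" for i
  have sq_le: "sqrt (infl i) \<le> 1 / sqrt (real K)" if "i \<in> W" for i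
    using that by (simp add: W_def real_sqrt_divide[symmetric] del: real_sqrt_divide)
      (metis real_sqrt_divide real_sqrt_le_iff real_sqrt_one)
  have K1: "1 / sqrt (real K) \<le> 1" using assms by simp
  have s_ge: "0 \<le> s i" for i using lam0 infl_nonneg[of i] by (simp add: s_def)
  have s_le: "s i \<le> 2 * lam / sqrt (real K)" for i
    using sq_le[of i] lam0 mult_left_mono[OF sq_le[of i], of "2 * lam"] by (auto simp: s_def)
  have s_half: "s i \<le> 1/2" for i
  proof -
    have "2 * lam * (1 / sqrt (real K)) \<le> 2 * lam * 1" using lam0 K1 by (intro mult_left_mono) auto
    then show ?thesis using s_le[of i] lam1 by simp
  qed
  have s_lt_1: "s i < 1" for i using s_half[of i] by simp
  have ssq: "(\<Sum>i\<in>V. (s i)\<^sup>2) \<le> 1/2"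
  proof -
    have "(\<Sum>i\<in>V. (s i)\<^sup>2) \<le> (\<Sum>i\<in>V. 4 * lam\<^sup>2 * infl i)"
      using infl_nonneg by (intro sum_mono) (simp add: s_def power_mult_distrib)
    also have "\<dots> = 4 * lam\<^sup>2 * (\<Sum>i\<in>V. infl i)" by (simp add: sum_distrib_left)
    also have "\<dots> \<le> 4 * lam\<^sup>2 * (4 * real m)" by (intro mult_left_mono sum_infl_le) auto
    also have "\<dots> = 1/2" using m0 by (simp add: lam2)
    finally show ?thesis .
  qed
  let ?D = "\<lambda>i j. uE V (\<lambda>A. \<bar>dif j (dif i f) A\<bar>)"
  let ?m = "bE V (\<lambda>i. (1 - s i) / 2)" and ?p = "bE V (\<lambda>i. (1 + s i) / 2)"
  have D: "?D i j = uE V (\<lambda>A. - dif j (dif i f) A)" if "i \<in> V" "j \<in> V" for i j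
    by (rule bE_cong) (use dif_dif_nonpos[OF that] in auto)
  have bias: "0 \<le> (1 - s i) / 2 \<and> (1 - s i) / 2 \<le> 1" "0 \<le> (1 + s i) / 2 \<and> (1 + s i) / 2 \<le> 1" for i
    using s_ge[of i] s_half[of i] by auto
  have gap: "(\<Sum>j\<in>V. s j / 2 * ?D i j) \<le> ?m (\<lambda>A. max 0 (dif i f A)) + ?p (\<lambda>A. max 0 (- dif i f A))"
    if i: "i \<in> V" for i
  proof -
    have "(\<Sum>j\<in>V. s j / 2 * ?D i j) = (\<Sum>j\<in>V. s j / 2 * uE V (\<lambda>A. - dif j (dif i f) A))"
      using D[OF i] by (intro sum.cong) auto
    also have "\<dots> \<le> ?m (dif i f) - ?p (dif i f)"
      by (rule bias_gap[OF fin _ ssq dif_antimono[OF i]]) (auto simp: s_ge s_lt_1)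
    also have "\<dots> = ?m (dif i f) + ?p (\<lambda>A. - dif i f A)" by (simp add: bE_minus)
    \<comment> \<open>Positive parts are summable when every element is included with probability at
      least 1/4, negative parts when it is excluded with probability at least 1/4. Both hold since
      the tilts are at most 1/2.\<close>
    also have "\<dots> \<le> ?m (\<lambda>A. max 0 (dif i f A)) + ?p (\<lambda>A. max 0 (- dif i f A))"
      using bias by (intro add_mono bE_mono) auto
    finally show ?thesis .
  qed
  have nonneg: "0 \<le> ?m (\<lambda>A. max 0 (dif i f A)) + ?p (\<lambda>A. max 0 (- dif i f A))" for i
    using bias by (intro add_nonneg_nonneg bE_nonneg) auto
  have q: "1/4 \<le> (1 - s i) / 2" "1/4 \<le> 1 - (1 + s i) / 2" for i using s_half[of i] by auto
  have "1/4 * (\<Sum>i\<in>V. ?m (\<lambda>A. max 0 (dif i f A))) \<le> 1"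
    using bias q by (intro expected_pos_dif) auto
  moreover have "1/4 * (\<Sum>i\<in>V. ?p (\<lambda>A. max 0 (- dif i f A))) \<le> 1"
    using bias q by (intro expected_neg_dif) auto
  ultimately have tot: "(\<Sum>i\<in>V. ?m (\<lambda>A. max 0 (dif i f A)) + ?p (\<lambda>A. max 0 (- dif i f A))) \<le> 8"
    by (simp add: sum.distrib)
  have Dnn: "0 \<le> ?D i j" for i j by (intro bE_nonneg) auto
  have WV: "W \<subseteq> V" by (auto simp: W_def)
  have "lam\<^sup>2 * (\<Sum>i\<in>W. \<Sum>j\<in>W. sqrt (infl i * infl j) * ?D i j) = (\<Sum>i\<in>W. \<Sum>j\<in>W. s i / 2 * (s j / 2 * ?D i j))"
    unfolding sum_distrib_left
    by (intro sum.cong refl) (simp add: s_def real_sqrt_mult power2_eq_square)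
  also have "\<dots> = (\<Sum>i\<in>W. s i / 2 * (\<Sum>j\<in>W. s j / 2 * ?D i j))"
    by (simp add: sum_distrib_left)
  also have "\<dots> \<le> (\<Sum>i\<in>W. s i / 2 * (\<Sum>j\<in>V. s j / 2 * ?D i j))"
    using s_ge Dnn WV fin by (intro sum_mono mult_left_mono sum_mono2) auto
  \<comment> \<open>Only here is the smallness of the influences in \<open>W\<close> decisive: it
    makes the outer weight at most \<open>lam / sqrt (real K)\<close>.\<close>
  also have "\<dots> \<le> (\<Sum>i\<in>W. (lam / sqrt (real K)) * (?m (\<lambda>A. max 0 (dif i f A)) + ?p (\<lambda>A. max 0 (- dif i f A))))"
  proof (rule sum_mono)
    fix i assume "i \<in> W"
    then have "s i / 2 * (\<Sum>j\<in>V. s j / 2 * ?D i j)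
        \<le> s i / 2 * (?m (\<lambda>A. max 0 (dif i f A)) + ?p (\<lambda>A. max 0 (- dif i f A)))"
      using s_ge WV by (intro mult_left_mono gap) auto
    also have "\<dots> \<le> (lam / sqrt (real K)) * (?m (\<lambda>A. max 0 (dif i f A)) + ?p (\<lambda>A. max 0 (- dif i f A)))"
      using s_le[of i] by (intro mult_right_mono nonneg) (simp add: mult.commute)
    finally show "s i / 2 * (\<Sum>j\<in>V. s j / 2 * ?D i j) \<le> \<dots>" .
  qed
  also have "\<dots> \<le> (\<Sum>i\<in>V. (lam / sqrt (real K)) * (?m (\<lambda>A. max 0 (dif i f A)) + ?p (\<lambda>A. max 0 (- dif i f A))))"
    using lam0 nonneg WV fin by (intro sum_mono2 mult_nonneg_nonneg) auto
  also have "\<dots> \<le> (lam / sqrt (real K)) * 8"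
    unfolding sum_distrib_left[symmetric] using lam0 by (intro mult_left_mono tot) auto
  finally have "lam * (lam * (\<Sum>i\<in>W. \<Sum>j\<in>W. sqrt (infl i * infl j) * ?D i j)) \<le> lam * (8 / sqrt (real K))"
    by (simp add: power2_eq_square mult.assoc)
  then have "lam * (\<Sum>i\<in>W. \<Sum>j\<in>W. sqrt (infl i * infl j) * ?D i j) \<le> 8 / sqrt (real K)"
    by (rule mult_left_le_imp_le[OF _ lam0])
  then show ?thesis
    using m0 by (simp add: lam_def real_sqrt_divide field_simps)
qed

text \<open>At most \<open>4 * m * K\<close> variables lie outside \<open>W\<close>, so a set of
  more than \<open>5 * m * K\<close> elements has at least \<open>K\<close> elements in
  \<open>W\<close> and at least \<open>(real K)\<^sup>2 / 2\<close> ordered pairs of them. Weighting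
  each set by its pairs turns the Fourier weight into a sum of second moments of second derivatives,
  where \<open>second_moment_dif_dif\<close> and \<open>sum_dif_dif_le\<close> apply.\<close>

lemma degree_tail:
  assumes K: "2 \<le> K"
  shows "(\<Sum>S | S \<subseteq> V \<and> 5 * m * K < card S. (fc V f S)\<^sup>2)
    \<le> (32 * sqrt (32 * real m / real K) + 512 * (real m)\<^sup>2 / 2 ^ m) / (8 * (real K)\<^sup>2)"
proof -
  define W where "W = {i\<in>V. infl i \<le> 1 / real K}"
  let ?D = "\<lambda>i j. uE V (\<lambda>A. \<bar>dif j (dif i f) A\<bar>)"
  have WV: "W \<subseteq> V" and finW: "finite W" using fin by (auto simp: W_def)
  have cardL: "real (card (V - W)) \<le> 4 * real m * real K"
  proof -
    have "real (card (V - W)) * (1 / real K) = (\<Sum>i\<in>V - W. 1 / real K)" by simp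
    also have "\<dots> \<le> (\<Sum>i\<in>V - W. infl i)" by (intro sum_mono) (auto simp: W_def)
    also have "\<dots> \<le> (\<Sum>i\<in>V. infl i)" using fin infl_nonneg by (intro sum_mono2) auto
    also have "\<dots> \<le> 4 * real m" by (rule sum_infl_le)
    finally show ?thesis using K by (simp add: field_simps)
  qed
  have many: "K \<le> card (S \<inter> W)" if "S \<subseteq> V" "5 * m * K < card S" for S
  proof -
    have "card S = card (S \<inter> W) + card (S - W)"
      using that fin by (metis card_Int_Diff finite_subset)
    moreover have "card (S - W) \<le> card (V - W)" using that fin by (intro card_mono) auto
    moreover have "card (V - W) \<le> 4 * m * K"
    proof -
      have "real (card (V - W)) \<le> real (4 * m * K)" using cardL by simp
      then show ?thesis by (simp only: of_nat_le_iff)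
    qed
    moreover have "K \<le> m * K" using m2 by simp
    ultimately show ?thesis using that(2) by linarith
  qed
  let ?c = "\<lambda>S. real (card (S \<inter> W)) * (real (card (S \<inter> W)) - 1)"
  have "(real K)\<^sup>2 / 2 * (\<Sum>S | S \<subseteq> V \<and> 5 * m * K < card S. (fc V f S)\<^sup>2)
      \<le> (\<Sum>S | S \<subseteq> V \<and> 5 * m * K < card S. ?c S * (fc V f S)\<^sup>2)"
    unfolding sum_distrib_left
  proof (intro sum_mono mult_right_mono)
    fix S assume "S \<in> {S. S \<subseteq> V \<and> 5 * m * K < card S}"
    then have c: "real K \<le> real (card (S \<inter> W))" using many by auto
    have "(real K)\<^sup>2 / 2 \<le> real K * (real K - 1)"
    proof -
      have "2 * real K \<le> real K * real K" using K by (intro mult_right_mono) auto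
      then show ?thesis by (simp add: power2_eq_square algebra_simps)
    qed
    also have "\<dots> \<le> ?c S" using c K by (intro mult_mono) auto
    finally show "(real K)\<^sup>2 / 2 \<le> ?c S" .
  qed auto
  also have "\<dots> \<le> (\<Sum>S\<in>Pow V. ?c S * (fc V f S)\<^sup>2)"
  proof (intro sum_mono2)
    fix S assume "S \<in> Pow V - {S. S \<subseteq> V \<and> 5 * m * K < card S}"
    show "0 \<le> ?c S * (fc V f S)\<^sup>2" by (cases "card (S \<inter> W)") auto
  qed (use fin in auto)
  also have "\<dots> = (\<Sum>S\<in>Pow V. \<Sum>i\<in>W. \<Sum>j\<in>W - {i}. (if i \<in> S \<and> j \<in> S then 1 else 0) * (fc V f S)\<^sup>2)"
    by (simp add: card_pairs[OF finW, symmetric] sum_distrib_right)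
  also have "\<dots> = (\<Sum>i\<in>W. \<Sum>j\<in>W - {i}. \<Sum>S\<in>Pow V. (if i \<in> S \<and> j \<in> S then 1 else 0) * (fc V f S)\<^sup>2)"
    by (subst sum.swap, intro sum.cong refl, subst sum.swap, rule refl)
  also have "\<dots> = (\<Sum>i\<in>W. \<Sum>j\<in>W - {i}. uE V (\<lambda>A. (dif j (dif i f) A)\<^sup>2) / 16)"
  proof (intro sum.cong refl)
    fix i j assume "i \<in> W" "j \<in> W - {i}"
    then have ij: "i \<in> V" "j \<in> V" "i \<noteq> j" using WV by auto
    have "(\<Sum>S\<in>Pow V. (if i \<in> S \<and> j \<in> S then 1 else 0) * (fc V f S)\<^sup>2) = (\<Sum>S | S \<subseteq> V \<and> i \<in> S \<and> j \<in> S. (fc V f S)\<^sup>2)"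
      using fin by (intro sum.mono_neutral_cong_right) auto
    then show "(\<Sum>S\<in>Pow V. (if i \<in> S \<and> j \<in> S then 1 else 0) * (fc V f S)\<^sup>2) = uE V (\<lambda>A. (dif j (dif i f) A)\<^sup>2) / 16"
      using fourier_weight_containing2[OF fin ij] by simp
  qed
  also have "\<dots> \<le> (\<Sum>i\<in>W. \<Sum>j\<in>W - {i}. (4 * sqrt (infl i * infl j) * ?D i j + 32 * (infl i * infl j) / 2 ^ m) / 16)"
  proof (intro sum_mono divide_right_mono)
    fix i j assume "i \<in> W" "j \<in> W - {i}"
    then have ij: "i \<in> V" "j \<in> V" "i \<noteq> j" using WV by auto
    show "uE V (\<lambda>A. (dif j (dif i f) A)\<^sup>2) \<le> 4 * sqrt (infl i * infl j) * ?D i j + 32 * (infl i * infl j) / 2 ^ m"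
      using second_moment_dif_dif[OF ij] infl_nonneg by simp
  qed simp
  \<comment> \<open>The nonnegative diagonal terms are added so that the second summand becomes a
    product of two sums of influences.\<close>
  also have "\<dots> \<le> (\<Sum>i\<in>W. \<Sum>j\<in>W. (4 * sqrt (infl i * infl j) * ?D i j + 32 * (infl i * infl j) / 2 ^ m) / 16)"
    using finW infl_nonneg
    by (intro sum_mono sum_mono2 divide_nonneg_nonneg add_nonneg_nonneg mult_nonneg_nonneg bE_nonneg) auto
  also have "\<dots> = (4 * (\<Sum>i\<in>W. \<Sum>j\<in>W. sqrt (infl i * infl j) * ?D i j)
      + 32 * ((\<Sum>i\<in>W. infl i) * (\<Sum>j\<in>W. infl j)) / 2 ^ m) / 16"
    unfolding sum_product by (simp add: sum.distrib sum_distrib_left sum_divide_distrib add_divide_distrib mult.assoc)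
  also have "\<dots> \<le> (4 * (8 * sqrt (32 * real m / real K)) + 32 * ((4 * real m) * (4 * real m)) / 2 ^ m) / 16"
  proof -
    have "(\<Sum>i\<in>W. infl i) \<le> (\<Sum>i\<in>V. infl i)" using fin WV infl_nonneg by (intro sum_mono2) auto
    then have "(\<Sum>i\<in>W. infl i) \<le> 4 * real m" using sum_infl_le by linarith
    then show ?thesis
      using sum_dif_dif_le[OF K] unfolding W_def[symmetric]
      by (intro divide_right_mono add_mono mult_left_mono mult_mono) (auto intro: sum_nonneg infl_nonneg)
  qed
  finally have "(real K)\<^sup>2 / 2 * (\<Sum>S | S \<subseteq> V \<and> 5 * m * K < card S. (fc V f S)\<^sup>2)
      \<le> (32 * sqrt (32 * real m / real K) + 512 * (real m)\<^sup>2 / 2 ^ m) / 16"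
    by (simp add: power2_eq_square)
  then show ?thesis using K by (simp add: field_simps)
qed

end

text \<open>The required \<open>1 - p\<close> is the \<open>m\<close>-th root of 1/2. By the
  inequality of Bernoulli \<open>(1 - 1 / (2 * m)) ^ m\<close> is at least 1/2, so the root is at
  most \<open>1 - 1 / (2 * m)\<close>, and \<open>p\<close> is not much smaller than
  \<open>1 / m\<close>.\<close>

lemma (in unit_submodular) moment_parameter:
  assumes "2 \<le> m"
  obtains p where "unit_submodular_moment V f m p"
proof
  define t where "t = root m (1/2)"
  have m0: "0 < m" using assms by simp
  have t: "0 < t" "t ^ m = 1/2" using m0 by (simp_all add: t_def real_root_gt_zero)
  have b: "t \<le> 1 - 1 / (2 * real m)"
  proof (rule ccontr)
    assume "\<not> ?thesis"
    then have lt: "1 - 1 / (2 * real m) < t" by simp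
    have nn: "0 \<le> 1 - 1 / (2 * real m)" using assms by simp
    have "1 + real m * (- (1 / (2 * real m))) \<le> (1 + - (1 / (2 * real m))) ^ m"
      using assms by (intro Bernoulli_inequality) auto
    then have "1/2 \<le> (1 - 1 / (2 * real m)) ^ m" using m0 by simp
    also have "\<dots> < t ^ m" using lt nn m0 by (intro power_strict_mono) auto
    finally show False using t by simp
  qed
  have half: "1/2 \<le> t"
  proof (rule ccontr)
    assume "\<not> ?thesis"
    then have "t ^ m \<le> t" using t m0 power_decreasing[of 1 m t] by auto
    then show False using t \<open>\<not> 1/2 \<le> t\<close> by simp
  qed
  have pos: "0 < 1 - t" using b m0 by (smt (verit) divide_pos_pos of_nat_0_less_iff)
  have "1 / (1 - t) \<le> 2 * real m"
  proof -
    have "1 / (2 * real m) \<le> 1 - t" using b by simp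
    then show ?thesis using pos m0 by (simp add: field_simps)
  qed
  then show "unit_submodular_moment V f m (1 - t)"
    using assms t half pos by unfold_locales auto
qed

section \<open>Averaging out variables, and detection from degrees one and two\<close>

lemma bE_Un:
  assumes "finite A" "finite B" "A \<inter> B = {}"
  shows "bE (A \<union> B) p g = bE A p (\<lambda>X. bE B p (\<lambda>Y. g (X \<union> Y)))"
  using assms(1,3)
proof (induction A arbitrary: g)
  case (insert j A)
  then have j: "j \<notin> A \<union> B" "finite (A \<union> B)" "A \<inter> B = {}" using assms(2) by auto
  show ?case
    using insert.IH[OF j(3), of g] insert.IH[OF j(3), of "\<lambda>X. g (insert j X)"]
    by (simp add: bE_insert[OF j(2,1)] bE_insert[OF insert.hyps])
qed simp

text \<open>A Poincare inequality in L1. Averaging over coordinate \<open>j\<close> loses at most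
  the mean of \<open>\<bar>dif j g\<bar>\<close> and does not increase the derivatives in the other
  directions.\<close>

lemma abs_uE_le:
  assumes "finite V"
  shows "uE V (\<lambda>A. \<bar>g A\<bar>) \<le> \<bar>uE V g\<bar> + (\<Sum>j\<in>V. uE V (\<lambda>A. \<bar>dif j g A\<bar>))"
  using assms
proof (induction V arbitrary: g)
  case (insert j V)
  let ?g1 = "\<lambda>A. g (insert j A)" and ?k = "\<lambda>A. (g A + g (insert j A)) / 2"
  have k: "uE (insert j V) g = uE V ?k"
    by (simp add: bE_insert[OF insert.hyps] bE_add bE_divide)
  have dj: "uE (insert j V) (\<lambda>A. \<bar>dif j g A\<bar>) = uE V (\<lambda>A. \<bar>?g1 A - g A\<bar>)"
  proof -
    have "uE V (\<lambda>A. \<bar>dif j g A\<bar>) = uE V (\<lambda>A. \<bar>?g1 A - g A\<bar>)"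
      "uE V (\<lambda>A. \<bar>dif j g (insert j A)\<bar>) = uE V (\<lambda>A. \<bar>?g1 A - g A\<bar>)"
      by (rule bE_cong; use insert.hyps in \<open>auto simp: dif_def intro!: arg_cong[of _ _ g] arg_cong[of _ _ abs]\<close>)+
    then show ?thesis by (simp add: bE_insert[OF insert.hyps])
  qed
  have dl: "uE V (\<lambda>A. \<bar>dif l ?k A\<bar>) \<le> uE (insert j V) (\<lambda>A. \<bar>dif l g A\<bar>)" if "l \<in> V" for l
  proof -
    have lj: "l \<noteq> j" using that insert.hyps by auto
    have "uE V (\<lambda>A. \<bar>dif l ?k A\<bar>) \<le> uE V (\<lambda>A. \<bar>dif l g A\<bar> / 2 + \<bar>dif l ?g1 A\<bar> / 2)"
      by (intro bE_mono) (auto simp: dif_def field_simps abs_if)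
    also have "\<dots> = uE (insert j V) (\<lambda>A. \<bar>dif l g A\<bar>)"
      unfolding bE_insert[OF insert.hyps] dif_commute_insert[OF lj] by (simp add: bE_add bE_divide)
    finally show ?thesis .
  qed
  have "uE (insert j V) (\<lambda>A. \<bar>g A\<bar>) = uE V (\<lambda>A. (\<bar>g A\<bar> + \<bar>?g1 A\<bar>) / 2)"
    by (simp add: bE_insert[OF insert.hyps] bE_add bE_divide)
  also have "\<dots> \<le> uE V (\<lambda>A. \<bar>?k A\<bar> + \<bar>?g1 A - g A\<bar>)"
    by (intro bE_mono) (auto simp: abs_if field_simps)
  also have "\<dots> = uE V (\<lambda>A. \<bar>?k A\<bar>) + uE V (\<lambda>A. \<bar>?g1 A - g A\<bar>)" by (rule bE_add)
  also have "\<dots> \<le> \<bar>uE V ?k\<bar> + (\<Sum>l\<in>V. uE V (\<lambda>A. \<bar>dif l ?k A\<bar>)) + uE V (\<lambda>A. \<bar>?g1 A - g A\<bar>)"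
    using insert.IH[of ?k] by simp
  also have "\<dots> \<le> \<bar>uE V ?k\<bar> + (\<Sum>l\<in>V. uE (insert j V) (\<lambda>A. \<bar>dif l g A\<bar>)) + uE V (\<lambda>A. \<bar>?g1 A - g A\<bar>)"
    by (intro add_mono sum_mono dl order.refl)
  finally show ?case using insert.hyps by (simp add: k dj)
qed simp

lemma fc_singleton:
  assumes "finite V" "i \<in> V"
  shows "uE V (dif i f) = - 2 * fc V f {i}"
  using fc_dif[OF assms, of "{}" f] by (simp add: fc_def)

lemma fc_pair:
  assumes "finite V" "i \<in> V" "j \<in> V" "i \<noteq> j"
  shows "uE V (dif j (dif i f)) = 4 * fc V f {i, j}"
  using fc_dif[OF assms(1,3), of "{}" "dif i f"] fc_dif[OF assms(1,2), of "{j}" f] assms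
  by (simp add: fc_def)

text \<open>The conditional expectation on the coordinates outside \<open>U\<close>. It stays
  submodular with values in [0,1] and keeps the coefficients of the sets disjoint from
  \<open>U\<close>. Passing to it makes the cost of the L1 inequality proportional to the size of
  the junta instead of \<open>n\<close>.\<close>

definition avg_out :: "'a set \<Rightarrow> ('a set \<Rightarrow> real) \<Rightarrow> 'a set \<Rightarrow> real" where
  "avg_out U f B = uE U (\<lambda>C. f (B \<union> C))"

context unit_submodular
begin

lemma fc_pair_nonpos:
  assumes "i \<in> V" "j \<in> V" "i \<noteq> j"
  shows "fc V f {i, j} \<le> 0"
proof -
  have "uE V (dif j (dif i f)) \<le> uE V (\<lambda>_. 0)"
    using dif_dif_nonpos[OF assms(1,2)] by (intro bE_mono) auto
  then show ?thesis using fc_pair[OF fin assms, of f] by (simp add: bE_const fin)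
qed

lemma unit_submodular_avg_out:
  assumes "J \<subseteq> V"
  shows "unit_submodular J (avg_out (V - J) f)"
proof
  show "finite J" using assms fin finite_subset by blast
  have "avg_out (V - J) f B \<le> uE (V - J) (\<lambda>_. 1)" if "B \<subseteq> J" for B
    unfolding avg_out_def using that assms by (intro bE_mono f_le_1) auto
  then show "avg_out (V - J) f B \<le> 1" if "B \<subseteq> J" for B
    using that fin by (simp add: bE_const)
  show "0 \<le> avg_out (V - J) f B" if "B \<subseteq> J" for B
    unfolding avg_out_def using that assms by (intro bE_nonneg f_nonneg) auto
  fix A B assume AB: "A \<subseteq> J" "B \<subseteq> J"
  show "avg_out (V - J) f (A \<union> B) + avg_out (V - J) f (A \<inter> B) \<le> avg_out (V - J) f A + avg_out (V - J) f B"
    unfolding avg_out_def bE_add[symmetric]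
  proof (rule bE_mono)
    fix C assume C: "C \<subseteq> V - J"
    have "A \<union> B \<union> C = (A \<union> C) \<union> (B \<union> C)" "A \<inter> B \<union> C = (A \<union> C) \<inter> (B \<union> C)" by auto
    moreover have "A \<union> C \<subseteq> V" "B \<union> C \<subseteq> V" using AB C assms by auto
    ultimately show "f (A \<union> B \<union> C) + f (A \<inter> B \<union> C) \<le> f (A \<union> C) + f (B \<union> C)"
      using submod[of "A \<union> C" "B \<union> C"] by simp
  qed simp
qed

lemma fc_avg_out:
  assumes "J \<subseteq> V" "S \<subseteq> J"
  shows "fc J (avg_out (V - J) f) S = fc V f S"
proof -
  have V: "V = J \<union> (V - J)" using assms by auto
  have chi: "chi S (B \<union> C) = chi S B" if "C \<subseteq> V - J" for B C
  proof -
    have "S \<inter> (B \<union> C) = S \<inter> B" using that assms by auto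
    then show ?thesis by (simp add: chi_def)
  qed
  have "fc V f S = uE J (\<lambda>B. uE (V - J) (\<lambda>C. f (B \<union> C) * chi S (B \<union> C)))"
    unfolding fc_def by (subst V, subst bE_Un) (use fin assms in \<open>auto intro: finite_subset\<close>)
  also have "\<dots> = uE J (\<lambda>B. uE (V - J) (\<lambda>C. chi S B * f (B \<union> C)))"
    by (intro bE_cong) (simp add: chi)
  finally show ?thesis by (simp add: bE_cmult fc_def avg_out_def mult.commute)
qed

text \<open>Second derivatives have constant sign, so their L1 norms are absolute values of means,
  that is, four times a coefficient of degree two. By \<open>abs_uE_le\<close> tiny coefficients of
  degrees one and two force the marginal at \<open>i\<close> to be small in L1, and with it every
  coefficient that involves \<open>i\<close>.\<close>

lemma undetected_weight:
  assumes "J \<subseteq> V" "i \<in> J" "0 \<le> \<tau>" "\<bar>fc V f {i}\<bar> \<le> \<tau>"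
    and "\<And>j. j \<in> J - {i} \<Longrightarrow> \<bar>fc V f {i, j}\<bar> \<le> \<tau>"
  shows "(\<Sum>S | S \<subseteq> J \<and> i \<in> S. (fc V f S)\<^sup>2) \<le> \<tau> * (1 / 2 + real (card J))"
proof -
  let ?g = "avg_out (V - J) f"
  interpret g: unit_submodular J ?g by (rule unit_submodular_avg_out[OF assms(1)])
  have dd: "uE J (\<lambda>A. \<bar>dif j (dif i ?g) A\<bar>) \<le> 4 * \<tau>" if j: "j \<in> J" for j
  proof (cases "j = i")
    case True
    then have "uE J (\<lambda>A. \<bar>dif j (dif i ?g) A\<bar>) = 0" by (simp add: dif_def bE_const g.fin)
    then show ?thesis using assms by simp
  next
    case False
    have "uE J (\<lambda>A. \<bar>dif j (dif i ?g) A\<bar>) = uE J (\<lambda>A. - dif j (dif i ?g) A)"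
      by (rule bE_cong) (use g.dif_dif_nonpos[OF assms(2) j] in auto)
    also have "\<dots> = - 4 * fc V f {i, j}"
      using fc_pair[OF g.fin assms(2) j, of ?g] False assms j fc_avg_out[of J "{i, j}"] by (simp add: bE_minus)
    finally show ?thesis using assms(5)[of j] False j by auto
  qed
  have "(\<Sum>S | S \<subseteq> J \<and> i \<in> S. (fc V f S)\<^sup>2) = (\<Sum>S | S \<subseteq> J \<and> i \<in> S. (fc J ?g S)\<^sup>2)"
    using assms fc_avg_out by (intro sum.cong) auto
  also have "\<dots> = uE J (\<lambda>A. (dif i ?g A)\<^sup>2) / 4"
    by (rule fourier_weight_containing[OF g.fin assms(2)])
  \<comment> \<open>The marginal has absolute value at most 1. This trades the square for the L1
    norm, where the constant sign can be used.\<close>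
  also have "uE J (\<lambda>A. (dif i ?g A)\<^sup>2) \<le> uE J (\<lambda>A. \<bar>dif i ?g A\<bar>)"
  proof (rule bE_mono)
    fix A assume A: "A \<subseteq> J"
    have "0 \<le> ?g (insert i A)" "?g (insert i A) \<le> 1" "0 \<le> ?g (A - {i})" "?g (A - {i}) \<le> 1"
      using A assms(2) by (auto intro!: g.f_nonneg g.f_le_1)
    then have "\<bar>dif i ?g A\<bar> \<le> 1" by (simp add: dif_def abs_le_iff)
    then have "\<bar>dif i ?g A\<bar> * \<bar>dif i ?g A\<bar> \<le> \<bar>dif i ?g A\<bar>" by (intro mult_left_le) auto
    then show "(dif i ?g A)\<^sup>2 \<le> \<bar>dif i ?g A\<bar>" by (simp add: power2_eq_square)
  qed simp
  also have "uE J (\<lambda>A. \<bar>dif i ?g A\<bar>) \<le> \<bar>uE J (dif i ?g)\<bar> + (\<Sum>j\<in>J. uE J (\<lambda>A. \<bar>dif j (dif i ?g) A\<bar>))"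
    by (rule abs_uE_le[OF g.fin])
  also have "\<dots> \<le> 2 * \<tau> + (\<Sum>j\<in>J. 4 * \<tau>)"
  proof (intro add_mono sum_mono dd)
    show "\<bar>uE J (dif i ?g)\<bar> \<le> 2 * \<tau>"
      using fc_singleton[OF g.fin assms(2), of ?g] fc_avg_out[of J "{i}"] assms by (simp add: abs_mult)
  qed
  finally show ?thesis by (simp add: algebra_simps)
qed

text \<open>Stated for every superset \<open>F\<close> of \<open>Q\<close>, since the learner may
  keep further variables, depending on the sample. The three summands are the weight outside the
  junta, the weight on undetected junta variables, and the weight at high degree.\<close>

theorem learnable_structure:
  assumes "2 \<le> m" "2 \<le> K" "0 < \<theta>" "0 \<le> \<tau>"
  obtains Q where "Q \<subseteq> V" "real (card Q) \<le> 4 * real m / \<theta>"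
    and "\<And>i. i \<in> Q \<Longrightarrow> \<tau> < \<bar>fc V f {i}\<bar> \<or> (\<exists>j\<in>V - {i}. \<tau> < \<bar>fc V f {i, j}\<bar>)"
    and "\<And>F. Q \<subseteq> F \<Longrightarrow> (\<Sum>S | S \<subseteq> V \<and> \<not> (S \<subseteq> F \<and> card S \<le> 5 * m * K). (fc V f S)\<^sup>2)
      \<le> 2 * \<theta> * real m + 4 * real m / \<theta> * (\<tau> * (1 / 2 + 4 * real m / \<theta>))
        + (32 * sqrt (32 * real m / real K) + 512 * (real m)\<^sup>2 / 2 ^ m) / (8 * (real K)\<^sup>2)"
proof -
  obtain p where "unit_submodular_moment V f m p" using moment_parameter[OF assms(1)] .
  then interpret unit_submodular_moment V f m p .
  obtain J where J: "J \<subseteq> V" "real (card J) \<le> 4 * real m / \<theta>"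
    "(\<Sum>S | S \<subseteq> V \<and> \<not> S \<subseteq> J. (fc V f S)\<^sup>2) \<le> 2 * \<theta> * real m"
    using junta_exists[OF assms(3)] by blast
  have finJ: "finite J" using J fin finite_subset by blast
  define s where "s = 4 * real m / \<theta>"
  \<comment> \<open>The partner \<open>j\<close> is sought only inside the junta: after averaging
    out the rest, no other pair enters \<open>undetected_weight\<close>.\<close>
  define Q where "Q = {i\<in>J. \<tau> < \<bar>fc V f {i}\<bar> \<or> (\<exists>j\<in>J - {i}. \<tau> < \<bar>fc V f {i, j}\<bar>)}"
  have QJ: "Q \<subseteq> J" by (auto simp: Q_def)
  show thesis
  proof
    show "Q \<subseteq> V" using QJ J by auto
    have "card Q \<le> card J" using QJ finJ by (rule card_mono[rotated])
    then show "real (card Q) \<le> 4 * real m / \<theta>" using J by linarith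
    show "\<tau> < \<bar>fc V f {i}\<bar> \<or> (\<exists>j\<in>V - {i}. \<tau> < \<bar>fc V f {i, j}\<bar>)" if "i \<in> Q" for i
      using that J by (auto simp: Q_def)
    fix F assume QF: "Q \<subseteq> F"
    let ?c = "\<lambda>S. (fc V f S)\<^sup>2"
    have und: "(\<Sum>i\<in>J - Q. \<Sum>S | S \<subseteq> J \<and> i \<in> S. ?c S) \<le> s * (\<tau> * (1 / 2 + s))"
    proof -
      have "(\<Sum>i\<in>J - Q. \<Sum>S | S \<subseteq> J \<and> i \<in> S. ?c S) \<le> (\<Sum>i\<in>J - Q. \<tau> * (1 / 2 + real (card J)))"
      proof (rule sum_mono)
        fix i assume i: "i \<in> J - Q"
        show "(\<Sum>S | S \<subseteq> J \<and> i \<in> S. ?c S) \<le> \<tau> * (1 / 2 + real (card J))"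
          by (rule undetected_weight) (use i J assms in \<open>auto simp: Q_def not_less\<close>)
      qed
      also have "\<dots> = real (card (J - Q)) * (\<tau> * (1 / 2 + real (card J)))" by simp
      also have "\<dots> \<le> s * (\<tau> * (1 / 2 + s))"
      proof -
        have "card (J - Q) \<le> card J" using finJ by (intro card_mono) auto
        then have "real (card (J - Q)) \<le> s" using J by (simp add: s_def)
        then show ?thesis using J assms by (intro mult_mono mult_left_mono add_left_mono) (auto simp: s_def)
      qed
      finally show ?thesis .
    qed
    have "(\<Sum>S | S \<subseteq> V \<and> \<not> (S \<subseteq> F \<and> card S \<le> 5 * m * K). ?c S)
        \<le> (\<Sum>S\<in>Pow V. (if \<not> S \<subseteq> J then ?c S else 0) + (\<Sum>i\<in>J - Q. if S \<subseteq> J \<and> i \<in> S then ?c S else 0)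
            + (if 5 * m * K < card S then ?c S else 0))"
    proof (rule order_trans[OF _ sum_mono2])
      show "(\<Sum>S | S \<subseteq> V \<and> \<not> (S \<subseteq> F \<and> card S \<le> 5 * m * K). ?c S)
        \<le> (\<Sum>S | S \<subseteq> V \<and> \<not> (S \<subseteq> F \<and> card S \<le> 5 * m * K).
            (if \<not> S \<subseteq> J then ?c S else 0) + (\<Sum>i\<in>J - Q. if S \<subseteq> J \<and> i \<in> S then ?c S else 0)
            + (if 5 * m * K < card S then ?c S else 0))"
      proof (rule sum_mono)
        fix S assume S: "S \<in> {S. S \<subseteq> V \<and> \<not> (S \<subseteq> F \<and> card S \<le> 5 * m * K)}"
        have nn: "0 \<le> (\<Sum>i\<in>J - Q. if S \<subseteq> J \<and> i \<in> S then ?c S else 0)" by (intro sum_nonneg) auto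
        show "?c S \<le> (if \<not> S \<subseteq> J then ?c S else 0) + (\<Sum>i\<in>J - Q. if S \<subseteq> J \<and> i \<in> S then ?c S else 0)
            + (if 5 * m * K < card S then ?c S else 0)"
        proof (cases "S \<subseteq> J \<and> card S \<le> 5 * m * K")
          case True
          then obtain i where i: "i \<in> J - Q" "i \<in> S" using S QF by auto
          have "(\<Sum>i\<in>{i}. if S \<subseteq> J \<and> i \<in> S then ?c S else 0) \<le> (\<Sum>i\<in>J - Q. if S \<subseteq> J \<and> i \<in> S then ?c S else 0)"
            using i finJ by (intro sum_mono2) auto
          then show ?thesis using i True by simp
        next
          case False
          then show ?thesis using nn by auto
        qed
      qed
    qed (use fin in \<open>auto intro!: add_nonneg_nonneg sum_nonneg split: if_splits simp del: Diff_iff\<close>)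
    also have "\<dots> = (\<Sum>S\<in>Pow V. if \<not> S \<subseteq> J then ?c S else 0)
        + (\<Sum>i\<in>J - Q. \<Sum>S\<in>Pow V. if S \<subseteq> J \<and> i \<in> S then ?c S else 0)
        + (\<Sum>S\<in>Pow V. if 5 * m * K < card S then ?c S else 0)"
      unfolding sum.distrib by (subst (2) sum.swap) (rule refl)
    also have "(\<Sum>S\<in>Pow V. if \<not> S \<subseteq> J then ?c S else 0) = (\<Sum>S | S \<subseteq> V \<and> \<not> S \<subseteq> J. ?c S)"
      using fin by (intro sum.mono_neutral_cong_right) auto
    also have "(\<Sum>S\<in>Pow V. if 5 * m * K < card S then ?c S else 0) = (\<Sum>S | S \<subseteq> V \<and> 5 * m * K < card S. ?c S)"
      using fin by (intro sum.mono_neutral_cong_right) auto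
    also have "(\<Sum>i\<in>J - Q. \<Sum>S\<in>Pow V. if S \<subseteq> J \<and> i \<in> S then ?c S else 0)
        = (\<Sum>i\<in>J - Q. \<Sum>S | S \<subseteq> J \<and> i \<in> S. ?c S)"
      using fin J by (intro sum.cong refl sum.mono_neutral_cong_right) auto
    finally show "(\<Sum>S | S \<subseteq> V \<and> \<not> (S \<subseteq> F \<and> card S \<le> 5 * m * K). ?c S)
      \<le> 2 * \<theta> * real m + 4 * real m / \<theta> * (\<tau> * (1 / 2 + 4 * real m / \<theta>))
        + (32 * sqrt (32 * real m / real K) + 512 * (real m)\<^sup>2 / 2 ^ m) / (8 * (real K)\<^sup>2)"
      using J(3) und degree_tail[OF assms(2)] unfolding s_def by linarith
  qed
qed

end

section \<open>Deterministic execution from a stream of examples\<close>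

text \<open>The draw counter of the state doubles as the position in the stream, so that execution
  becomes a function of the stream. Coins are not simulated; the comparison with \<open>exec\<close>
  is for \<open>flip_free\<close> programs.\<close>

fun dexec :: "(nat \<Rightarrow> nat set \<times> real) \<Rightarrow> instr \<Rightarrow> state \<Rightarrow> state" where
  "dexec \<omega> (NConst a k) s = set_n a k s"
| "dexec \<omega> (NAdd a b c) s = set_n a (nmem s b + nmem s c) s"
| "dexec \<omega> (NSub a b c) s = set_n a (nmem s b - nmem s c) s"
| "dexec \<omega> (NMul a b c) s = set_n a (nmem s b * nmem s c) s"
| "dexec \<omega> (NDiv a b c) s = set_n a (nmem s b div nmem s c) s"
| "dexec \<omega> (NLoad a b) s = set_n a (nmem s (nmem s b)) s"
| "dexec \<omega> (NStore a b) s = set_n (nmem s a) (nmem s b) s"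
| "dexec \<omega> (ROfN a b) s = set_r a (real (nmem s b)) s"
| "dexec \<omega> (RAdd a b c) s = set_r a (rmem s b + rmem s c) s"
| "dexec \<omega> (RSub a b c) s = set_r a (rmem s b - rmem s c) s"
| "dexec \<omega> (RMul a b c) s = set_r a (rmem s b * rmem s c) s"
| "dexec \<omega> (RDiv a b c) s = set_r a (rmem s b / rmem s c) s"
| "dexec \<omega> (RLoad a b) s = set_r a (rmem s (nmem s b)) s"
| "dexec \<omega> (RStore a b) s = set_r (nmem s a) (rmem s b) s"
| "dexec \<omega> Draw s =
     s\<lparr>point := fst (\<omega> (draws s)), label := snd (\<omega> (draws s)), draws := Suc (draws s)\<rparr>"
| "dexec \<omega> (ReadBit a b) s = set_n a (if nmem s b \<in> point s then 1 else 0) s"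
| "dexec \<omega> (ReadLabel a) s = set_r a (label s) s"
| "dexec \<omega> (Flip a) s = s"

fun dstep :: "(nat \<Rightarrow> nat set \<times> real) \<Rightarrow> com \<times> state \<Rightarrow> com \<times> state" where
  "dstep \<omega> (Skip, s) = (Skip, s)"
| "dstep \<omega> (Instr i, s) = (Skip, dexec \<omega> i s)"
| "dstep \<omega> (Seq c d, s) =
     (if c = Skip then (d, s) else (case dstep \<omega> (c, s) of (c', s') \<Rightarrow> (Seq c' d, s')))"
| "dstep \<omega> (If b c d, s) = (if holds b s then c else d, s)"
| "dstep \<omega> (While b c, s) = (If b (Seq c (While b c)) Skip, s)"

fun flip_free :: "com \<Rightarrow> bool" where
  "flip_free Skip \<longleftrightarrow> True"
| "flip_free (Instr i) \<longleftrightarrow> (\<forall>a. i \<noteq> Flip a)"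
| "flip_free (Seq c d) \<longleftrightarrow> flip_free c \<and> flip_free d"
| "flip_free (If b c d) \<longleftrightarrow> flip_free c \<and> flip_free d"
| "flip_free (While b c) \<longleftrightarrow> flip_free c"

lemma oracle_free_imp_flip_free: "oracle_free c \<Longrightarrow> flip_free c"
  by (induction c) auto

lemma set_n_draws [simp]: "draws (set_n a v s) = draws s" "draws (set_r a w s) = draws s"
  by (simp_all add: set_n_def set_r_def)

text \<open>A step either ignores the stream or consumes exactly the entry at position
  \<open>draws s\<close>. This dichotomy is the whole interface between \<open>step\<close> and
  \<open>dstep\<close>.\<close>

lemma step_cases:
  assumes "flip_free c"
  shows "(\<exists>c' s'. step D (c, s) = return_pmf (c', s') \<and> (\<forall>\<omega>. dstep \<omega> (c, s) = (c', s'))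
        \<and> draws s' = draws s \<and> flip_free c')
    \<or> (\<exists>c' g. step D (c, s) = map_pmf (\<lambda>z. (c', g z)) D \<and> (\<forall>\<omega>. dstep \<omega> (c, s) = (c', g (\<omega> (draws s))))
        \<and> (\<forall>z. draws (g z) = Suc (draws s)) \<and> flip_free c')"
  using assms
proof (induction c)
  case (Instr i)
  show ?case
  proof (cases "i = Draw")
    case True
    let ?g = "\<lambda>z. s\<lparr>point := fst z, label := snd z, draws := Suc (draws s)\<rparr>"
    have "step D (Instr i, s) = map_pmf (\<lambda>z. (Skip, ?g z)) D"
      by (simp add: True map_pmf_comp case_prod_beta)
    then show ?thesis
      by (intro disjI2 exI[of _ Skip] exI[of _ ?g]) (simp add: True)
  next
    case False
    then show ?thesis using Instr by (cases i) auto
  qed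
next
  case (Seq c d)
  show ?case
  proof (cases "c = Skip")
    case False
    from Seq consider (det) c' s' where "step D (c, s) = return_pmf (c', s')" "\<forall>\<omega>. dstep \<omega> (c, s) = (c', s')"
        "draws s' = draws s" "flip_free c'"
      | (draw) c' g where "step D (c, s) = map_pmf (\<lambda>z. (c', g z)) D" "\<forall>\<omega>. dstep \<omega> (c, s) = (c', g (\<omega> (draws s)))"
        "\<forall>z. draws (g z) = Suc (draws s)" "flip_free c'"
      by auto
    then show ?thesis
    proof cases
      case det
      then show ?thesis using False Seq.prems by auto
    next
      case draw
      then show ?thesis using False Seq.prems
        by (intro disjI2 exI[of _ "Seq c' d"] exI[of _ g]) (auto simp: map_pmf_comp)
    qed
  qed (use Seq.prems in auto)
qed auto

lemma funpow_Suc_apply: "(f ^^ Suc t) x = (f ^^ t) (f x)"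
  by (simp add: funpow_swap1)

lemma dstep_funpow_cong:
  assumes "flip_free c" "\<And>j. draws s \<le> j \<Longrightarrow> \<omega> j = \<omega>' j"
  shows "(dstep \<omega> ^^ t) (c, s) = (dstep \<omega>' ^^ t) (c, s)"
  using assms
proof (induction t arbitrary: c s)
  case (Suc t)
  from step_cases[OF Suc.prems(1), of undefined s]
  have "\<exists>c' s'. dstep \<omega> (c, s) = (c', s') \<and> dstep \<omega>' (c, s) = (c', s') \<and> draws s \<le> draws s' \<and> flip_free c'"
    using Suc.prems(2)[of "draws s"] by (auto simp del: split_paired_All)
  then obtain c' s' where "dstep \<omega> (c, s) = (c', s')" "dstep \<omega>' (c, s) = (c', s')" "draws s \<le> draws s'" "flip_free c'"
    by blast
  then show ?case using Suc.IH[of c' s'] Suc.prems(2) by (simp add: funpow_Suc_apply del: funpow.simps)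
qed simp

text \<open>Drawing examples when they are asked for is the same as drawing them all in advance. In
  \<open>t\<close> steps at most \<open>t\<close> entries are consumed, so any stream at least that
  long will do. Afterwards programs can be verified for each stream separately.\<close>

theorem run_eq_map_stream:
  assumes "flip_free c" "draws s + t \<le> K"
  shows "run D t (c, s) = map_pmf (\<lambda>\<omega>. (dstep \<omega> ^^ t) (c, s)) (Pi_pmf {draws s..<K} dflt (\<lambda>_. D))"
  using assms
proof (induction t arbitrary: c s)
  case (Suc t)
  from step_cases[OF Suc.prems(1), of D s]
  consider (det) c' s' where "step D (c, s) = return_pmf (c', s')" "\<forall>\<omega>. dstep \<omega> (c, s) = (c', s')"
      "draws s' = draws s" "flip_free c'"
    | (draw) c' g where "step D (c, s) = map_pmf (\<lambda>z. (c', g z)) D" "\<forall>\<omega>. dstep \<omega> (c, s) = (c', g (\<omega> (draws s)))"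
      "\<forall>z. draws (g z) = Suc (draws s)" "flip_free c'"
    by auto
  then show ?case
  proof cases
    case det
    have "run D (Suc t) (c, s) = run D t (c', s')" using det by (simp add: bind_return_pmf)
    also have "\<dots> = map_pmf (\<lambda>\<omega>. (dstep \<omega> ^^ t) (c', s')) (Pi_pmf {draws s'..<K} dflt (\<lambda>_. D))"
      using det Suc.prems by (intro Suc.IH) auto
    finally show ?thesis using det by (simp add: funpow_Suc_apply del: funpow.simps)
  next
    case draw
    let ?k = "draws s"
    have k: "{?k..<K} = insert ?k {Suc ?k..<K}" using Suc.prems by auto
    have "run D (Suc t) (c, s) = bind_pmf D (\<lambda>z. run D t (c', g z))"
      using draw by (simp add: bind_map_pmf)
    also have "\<dots> = bind_pmf D (\<lambda>z. map_pmf (\<lambda>\<omega>. (dstep \<omega> ^^ t) (c', g z)) (Pi_pmf {Suc ?k..<K} dflt (\<lambda>_. D)))"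
    proof (rule bind_pmf_cong[OF refl])
      fix z
      have "draws (g z) = Suc ?k" using draw(3) by blast
      then show "run D t (c', g z) = map_pmf (\<lambda>\<omega>. (dstep \<omega> ^^ t) (c', g z)) (Pi_pmf {Suc ?k..<K} dflt (\<lambda>_. D))"
        using Suc.IH[OF draw(4), of "g z"] Suc.prems(2) by simp
    qed
    \<comment> \<open>The drawn value is written at its own position of the stream, which the
      remaining steps never read.\<close>
    also have "\<dots> = bind_pmf D (\<lambda>z. map_pmf (\<lambda>\<omega>. (dstep (fun_upd \<omega> ?k z) ^^ Suc t) (c, s)) (Pi_pmf {Suc ?k..<K} dflt (\<lambda>_. D)))"
    proof (intro bind_pmf_cong[OF refl] map_pmf_cong[OF refl])
      fix z \<omega>
      have "(dstep (fun_upd \<omega> ?k z) ^^ Suc t) (c, s) = (dstep (fun_upd \<omega> ?k z) ^^ t) (c', g z)"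
        using draw by (simp add: funpow_Suc_apply del: funpow.simps)
      also have "\<dots> = (dstep \<omega> ^^ t) (c', g z)"
      proof (rule dstep_funpow_cong[OF draw(4)])
        fix j assume "draws (g z) \<le> j"
        then have "Suc ?k \<le> j" using draw(3) by metis
        then show "fun_upd \<omega> ?k z j = \<omega> j" by simp
      qed
      finally show "(dstep \<omega> ^^ t) (c', g z) = (dstep (fun_upd \<omega> ?k z) ^^ Suc t) (c, s)" ..
    qed
    also have "\<dots> = map_pmf (\<lambda>\<omega>. (dstep \<omega> ^^ Suc t) (c, s)) (Pi_pmf {?k..<K} dflt (\<lambda>_. D))"
      unfolding k by (subst Pi_pmf_insert)
        (auto simp: map_pmf_comp pair_pmf_def map_bind_pmf bind_return_pmf map_pmf_def bind_assoc_pmf)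
    finally show ?thesis .
  qed
qed simp

section \<open>A program logic with time and word bounds\<close>

definition ok :: "nat \<Rightarrow> nat \<Rightarrow> state \<Rightarrow> bool" where
  "ok W M s \<longleftrightarrow> (\<forall>a. nmem s a \<le> W) \<and> draws s \<le> M"

text \<open>\<open>T\<close> is an upper bound on the number of steps. The condition
  \<open>ok\<close> is imposed on every configuration visited, not only on the last one, because
  \<open>word_bounded\<close> and \<open>uses_examples\<close> speak about all times.\<close>

inductive big :: "(nat \<Rightarrow> nat set \<times> real) \<Rightarrow> nat \<Rightarrow> nat \<Rightarrow> com \<Rightarrow> state \<Rightarrow> nat \<Rightarrow> state \<Rightarrow> bool"
  for \<omega> W M where
  big_Skip: "ok W M s \<Longrightarrow> big \<omega> W M Skip s T s"
| big_step: "ok W M s \<Longrightarrow> dstep \<omega> (c, s) = (c', s'') \<Longrightarrow> big \<omega> W M c' s'' T s' \<Longrightarrow> big \<omega> W M c s (Suc T) s'"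

lemma big_mono: "big \<omega> W M c s T s' \<Longrightarrow> T \<le> T' \<Longrightarrow> big \<omega> W M c s T' s'"
proof (induction arbitrary: T' rule: big.induct)
  case (big_step s c c' s'' T s')
  then show ?case by (cases T') (auto intro: big.big_step)
qed (rule big_Skip)

lemma big_ok: "big \<omega> W M c s T s' \<Longrightarrow> ok W M s'"
  by (induction rule: big.induct)

lemma big_If:
  "ok W M s \<Longrightarrow> big \<omega> W M (if holds b s then c else d) s T s' \<Longrightarrow> big \<omega> W M (If b c d) s (Suc T) s'"
  by (rule big_step) auto

lemma big_While:
  "ok W M s \<Longrightarrow> big \<omega> W M (If b (Seq c (While b c)) Skip) s T s' \<Longrightarrow> big \<omega> W M (While b c) s (Suc T) s'"
  by (rule big_step) auto

lemma big_Seq: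
  assumes "big \<omega> W M c s T1 s1" "big \<omega> W M d s1 T2 s2"
  shows "big \<omega> W M (Seq c d) s (T1 + T2 + 1) s2"
  using assms
proof (induction rule: big.induct)
  case (big_Skip s T)
  then have "big \<omega> W M (Seq Skip d) s (Suc T2) s2" by (intro big_step) auto
  then show ?case by (rule big_mono) simp
next
  case (big_step s c c' s'' T s')
  show ?case
  proof (cases "c = Skip")
    case True
    then show ?thesis using big_step by (auto intro: big_mono)
  next
    case False
    then show ?thesis using big_step by (auto intro!: big.big_step[of _ _ _ _ _ "Seq c' d" s''])
  qed
qed

lemma big_funpow:
  assumes "big \<omega> W M c s T s'"
  shows "T \<le> t \<Longrightarrow> (dstep \<omega> ^^ t) (c, s) = (Skip, s')" and "ok W M (snd ((dstep \<omega> ^^ u) (c, s)))"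
proof -
  have Skip: "(dstep \<omega> ^^ t) (Skip, s) = (Skip, s)" for t s by (induction t) auto
  have "\<forall>t\<ge>T. (dstep \<omega> ^^ t) (c, s) = (Skip, s')"
    using assms
  proof (induction rule: big.induct)
    case (big_step s c c' s'' T s')
    then show ?case by (auto simp: funpow_Suc_apply Suc_le_eq less_eq_Suc_le[symmetric] gr0_conv_Suc
        simp del: funpow.simps dest!: less_imp_Suc_add)
  qed (simp add: Skip)
  then show "T \<le> t \<Longrightarrow> (dstep \<omega> ^^ t) (c, s) = (Skip, s')" by blast
  show "ok W M (snd ((dstep \<omega> ^^ u) (c, s)))"
    using assms
  proof (induction arbitrary: u rule: big.induct)
    case (big_step s c c' s'' T s')
    then show ?case by (cases u) (auto simp: funpow_Suc_apply simp del: funpow.simps(2))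
  qed (simp add: Skip)
qed

definition wp :: "(nat \<Rightarrow> nat set \<times> real) \<Rightarrow> nat \<Rightarrow> nat \<Rightarrow> com \<Rightarrow> nat \<Rightarrow> (state \<Rightarrow> bool) \<Rightarrow> state \<Rightarrow> bool" where
  "wp \<omega> W M c T Q s \<longleftrightarrow> (\<exists>s'. big \<omega> W M c s T s' \<and> Q s')"

lemma wp_mono:
  assumes "wp \<omega> W M c T Q s" "T \<le> T'" "\<And>s'. ok W M s' \<Longrightarrow> Q s' \<Longrightarrow> Q' s'"
  shows "wp \<omega> W M c T' Q' s"
  using assms unfolding wp_def by (meson big_mono big_ok)

lemma wp_Seq:
  assumes "wp \<omega> W M c T1 R s" "\<And>s'. ok W M s' \<Longrightarrow> R s' \<Longrightarrow> wp \<omega> W M d T2 Q s'"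
  shows "wp \<omega> W M (Seq c d) (T1 + T2 + 1) Q s"
  using assms unfolding wp_def by (meson big_Seq big_ok)

lemma wp_If:
  assumes "ok W M s" "holds b s \<Longrightarrow> wp \<omega> W M c T Q s" "\<not> holds b s \<Longrightarrow> wp \<omega> W M d T Q s"
  shows "wp \<omega> W M (If b c d) (Suc T) Q s"
  using assms unfolding wp_def by (cases "holds b s") (auto intro!: big_If)

text \<open>For loops whose number \<open>N\<close> of rounds is known beforehand; the invariant is
  indexed by the round. The overhead of a round is 3: unfolding the loop, testing, and dropping the
  finished body. The final 2 are the last unfolding and the failing test.\<close>

lemma wp_While:
  assumes body: "\<And>i s. i < N \<Longrightarrow> ok W M s \<Longrightarrow> I i s \<Longrightarrow> holds b s \<and> wp \<omega> W M c T (I (Suc i)) s"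
    and "\<And>s. I N s \<Longrightarrow> \<not> holds b s" and "ok W M s" "I 0 s"
  shows "wp \<omega> W M (While b c) (N * (T + 3) + 2) (I N) s"
proof -
  have "wp \<omega> W M (While b c) ((N - i) * (T + 3) + 2) (I N) s" if "i \<le> N" "ok W M s" "I i s" for i s
    using that
  proof (induction "N - i" arbitrary: i s)
    case 0
    then have "\<not> holds b s" "big \<omega> W M Skip s 0 s"
      using assms(2)[of s] by (auto intro: big_Skip)
    then have "big \<omega> W M (While b c) s (Suc (Suc 0)) s"
      using 0 by (intro big_While big_If) auto
    then show ?case using 0 by (auto simp: wp_def)
  next
    case (Suc r)
    then have i: "i < N" by simp
    have b: "holds b s" and w: "wp \<omega> W M c T (I (Suc i)) s" using body[OF i] Suc.prems by auto
    have "wp \<omega> W M (Seq c (While b c)) (T + ((N - Suc i) * (T + 3) + 2) + 1) (I N) s"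
      by (rule wp_Seq[OF w]) (use Suc i in auto)
    then obtain s' where s': "big \<omega> W M (Seq c (While b c)) s (T + ((N - Suc i) * (T + 3) + 2) + 1) s'" "I N s'"
      by (auto simp: wp_def)
    have "big \<omega> W M (While b c) s (Suc (Suc (T + ((N - Suc i) * (T + 3) + 2) + 1))) s'"
      using s'(1) b Suc.prems by (intro big_While big_If) auto
    moreover have "N - i = Suc (N - Suc i)" using i by simp
    ultimately have "big \<omega> W M (While b c) s ((N - i) * (T + 3) + 2) s'"
      by (elim big_mono) simp
    then show ?case using s' by (auto simp: wp_def)
  qed
  from this[of 0 s] assms(3,4) show ?thesis by simp
qed

section \<open>Verification conditions for loop-free code\<close>

fun tm :: "com \<Rightarrow> nat" where
  "tm Skip = 0"
| "tm (Instr i) = 1"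
| "tm (Seq c d) = tm c + tm d + 1"
| "tm (If b c d) = Suc (max (tm c) (tm d))"
| "tm (While b c) = 0"

fun safe :: "nat \<Rightarrow> nat \<Rightarrow> instr \<Rightarrow> state \<Rightarrow> bool" where
  "safe W M (NConst a k) s \<longleftrightarrow> k \<le> W"
| "safe W M (NAdd a b c) s \<longleftrightarrow> nmem s b + nmem s c \<le> W"
| "safe W M (NMul a b c) s \<longleftrightarrow> nmem s b * nmem s c \<le> W"
| "safe W M Draw s \<longleftrightarrow> draws s < M"
| "safe W M (ReadBit a b) s \<longleftrightarrow> 1 \<le> W"
| "safe W M _ s \<longleftrightarrow> True"

lemma safe_ok:
  assumes "ok W M s" "safe W M i s"
  shows "ok W M (dexec \<omega> i s)"
proof -
  have "nmem s a - b \<le> W" "nmem s a div b \<le> W" for a b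
    using assms(1) by (auto simp: ok_def intro: order_trans[OF diff_le_self] order_trans[OF div_le_dividend])
  then show ?thesis
    using assms by (cases i) (auto simp: ok_def set_n_def set_r_def)
qed

text \<open>Symbolic execution by rewriting. A loop receives the condition \<open>False\<close>, so
  \<open>vc\<close> covers straight-line and branching code, while loops go through
  \<open>wp_While\<close>.\<close>

fun vc :: "(nat \<Rightarrow> nat set \<times> real) \<Rightarrow> nat \<Rightarrow> nat \<Rightarrow> com \<Rightarrow> (state \<Rightarrow> bool) \<Rightarrow> state \<Rightarrow> bool" where
  "vc \<omega> W M Skip Q s \<longleftrightarrow> Q s"
| "vc \<omega> W M (Instr i) Q s \<longleftrightarrow> safe W M i s \<and> Q (dexec \<omega> i s)"
| "vc \<omega> W M (Seq c d) Q s \<longleftrightarrow> vc \<omega> W M c (vc \<omega> W M d Q) s"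
| "vc \<omega> W M (If b c d) Q s \<longleftrightarrow> (if holds b s then vc \<omega> W M c Q s else vc \<omega> W M d Q s)"
| "vc \<omega> W M (While b c) Q s \<longleftrightarrow> False"

lemma vc_wp:
  assumes "ok W M s" "vc \<omega> W M c Q s"
  shows "wp \<omega> W M c (tm c) Q s"
  using assms
proof (induction c arbitrary: Q s)
  case Skip
  then show ?case by (auto simp: wp_def intro: big_Skip)
next
  case (Instr i)
  have "big \<omega> W M Skip (dexec \<omega> i s) 0 (dexec \<omega> i s)"
    by (rule big_Skip) (use Instr safe_ok in auto)
  then have "big \<omega> W M (Instr i) s (Suc 0) (dexec \<omega> i s)"
    using Instr by (intro big_step) auto
  then show ?case using Instr by (auto simp: wp_def)
next
  case (Seq c d)
  show ?case
    unfolding tm.simps by (rule wp_Seq[of _ _ _ _ _ "vc \<omega> W M d Q"]) (use Seq in auto)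
next
  case (If b c d)
  show ?case
    unfolding tm.simps
    by (rule wp_If[OF If.prems(1)]; rule wp_mono[where Q = Q]) (use If in auto)
qed auto

fun block :: "instr list \<Rightarrow> com" where
  "block [] = Skip"
| "block (i # is) = Seq (Instr i) (block is)"

lemma nmem_set [simp]:
  "nmem (set_n a v s) = (nmem s)(a := v)" "nmem (set_r a w s) = nmem s"
  "rmem (set_n a v s) = rmem s" "rmem (set_r a w s) = (rmem s)(a := w)"
  "point (set_n a v s) = point s" "point (set_r a w s) = point s"
  "label (set_n a v s) = label s" "label (set_r a w s) = label s"
  by (simp_all add: set_n_def set_r_def)

section \<open>The learning program\<close>

text \<open>A linear search for the least integer at or above \<epsilon>^(-4/5): comparing
  \<open>k ^ 5 * \<epsilon> ^ 4\<close> with 1 takes only multiplications, and the search lasts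
  \<open>k\<close> rounds, far below the time bound.\<close>

definition find_k :: com where
  "find_k = Seq (block [NConst 1 1, NConst 2 2, ROfN 1 1, RMul 2 0 0, RMul 2 2 2, NConst 3 1,
      ROfN 3 3, RMul 4 3 3, RMul 4 4 4, RMul 4 4 3, RMul 4 4 2])
    (While (RLess 4 1)
      (block [NAdd 3 3 1, ROfN 3 3, RMul 4 3 3, RMul 4 4 4, RMul 4 4 3, RMul 4 4 2]))"

definition find_q :: com where
  "find_q = Seq (block [NConst 4 0, NConst 5 1]) (While (NLess 5 3) (block [NAdd 4 4 1, NMul 5 5 2]))"

definition find_l :: com where
  "find_l = Seq (block [NConst 6 0, NConst 7 1, NAdd 8 0 1])
    (While (NLess 7 8) (block [NAdd 6 6 1, NMul 7 7 2]))"

definition comp_m :: com where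
  "comp_m = block [NMul 9 4 2, NConst 40 10, NAdd 9 9 40, NMul 41 3 3, NMul 41 41 3, NMul 42 9 9]"

definition comp_s :: com where
  "comp_s = block [NMul 10 42 41, NConst 40 32, NMul 10 10 40]"

definition comp_r :: com where
  "comp_r = block [NMul 11 10 10, NMul 11 11 41, NConst 40 4, NMul 11 11 40]"

definition comp_r2 :: com where
  "comp_r2 = block [NMul 12 11 11, NMul 13 42 3, NConst 40 10, NMul 13 13 40,
     NConst 40 32, NMul 14 12 40, NAdd 14 14 1, NConst 15 1, NConst 16 0]"

definition comp_N :: com where
  "comp_N = While (NLess 16 13) (block [NMul 15 15 14, NAdd 16 16 1])"

definition comp_M2 :: com where
  "comp_M2 = block [NMul 17 41 15, NConst 40 40, NMul 17 17 40,
     NMul 18 12 12, NMul 18 18 10, NConst 40 2560, NMul 18 18 40]"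

definition comp_tmax :: com where
  "comp_tmax = block [NConst 40 6, NMul 43 6 2, NAdd 43 43 40, NConst 40 32, NMul 43 43 40,
     NMul 43 43 12, NAdd 19 18 43, NAdd 22 0 2, NMul 26 0 22]"

definition comp_cap :: com where
  "comp_cap = block [NConst 40 64, NMul 43 12 40, NAdd 43 43 18, NAdd 43 43 1, NMul 43 43 26,
     NConst 40 32, NMul 44 12 40, NAdd 45 19 1, NMul 44 44 45, NAdd 43 43 44, NConst 40 20, NMul 20 43 40]"

definition comp_M :: com where
  "comp_M = block [NAdd 21 19 17, NMul 23 21 22, NConst 25 64, NAdd 24 25 23, NAdd 29 25 21, NAdd 27 13 1,
     NMul 30 17 8, NMul 30 30 27, ROfN 7 11, RAdd 7 7 7, NConst 32 0, NConst 37 0, NConst 38 0, NConst 39 0,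
     ROfN 6 31]"

definition comp_params :: com where
  "comp_params = Seq find_k (Seq find_q (Seq find_l (Seq comp_m (Seq comp_s (Seq comp_r (Seq comp_r2
     (Seq comp_N (Seq comp_M2 (Seq comp_tmax (Seq comp_cap comp_M))))))))))"

locale learner_params =
  fixes n :: nat and \<epsilon> :: real and k q l :: nat
  assumes k_pos: "1 \<le> k"
    and k_large: "1 \<le> real k ^ 5 * \<epsilon> ^ 4"
    and k_least: "\<And>k'. 1 \<le> k' \<Longrightarrow> k' < k \<Longrightarrow> real k' ^ 5 * \<epsilon> ^ 4 < 1"
    and q_large: "k \<le> 2 ^ q" and q_least: "\<And>q'. q' < q \<Longrightarrow> 2 ^ q' < k"
    and l_large: "n < 2 ^ l" and l_least: "\<And>l'. l' < l \<Longrightarrow> 2 ^ l' \<le> n"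
begin

text \<open>
  Here \<open>k\<close> is of order \<open>\<epsilon>\<^sup>-\<^sup>4\<^sup>/\<^sup>5\<close>, \<open>q\<close> and \<open>l\<close> are the logarithms of \<open>k\<close> and \<open>n\<close>, \<open>s\<close> bounds the number of
  relevant variables, \<open>1 / r\<close> is the threshold for a large coefficient, and \<open>d\<close> is the degree of the hypothesis.
  A test runs for at least \<open>B0\<close> and at most \<open>tmax\<close> examples, and all tests together for at most \<open>cap\<close> rounds; the
  \<open>M2\<close> examples after the first \<open>tmax\<close> are used for the hypothesis.  All natural numbers in memory are at most \<open>W\<close>.
\<close>

definition "m = q * 2 + 10"
definition "k3 = k * k * k"
definition "m2 = m * m"
definition "s = m2 * k3 * 32"
definition "r = s * s * k3 * 4"
definition "r2 = r * r"
definition "d = m2 * k * 10"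
definition "u1 = r2 * 32 + 1"
definition "NN = u1 ^ d"
definition "M2 = k3 * NN * 40"
definition "B0 = r2 * r2 * s * 2560"
definition "tmax = B0 + (l * 2 + 6) * 32 * r2"
definition "w = n + 2"
definition "np = n * w"
definition "cap = ((r2 * 64 + B0 + 1) * np + r2 * 32 * (tmax + 1)) * 20"
definition "M = tmax + M2"
definition "L = M2 * (n + 1) * (d + 1)"
definition "W = sum_list [2560, k, 2 ^ q * 2, q, 2 ^ l * 2, l, s, r, u1, NN, M2, B0, tmax + 1, np + 1, cap + 1,
  64 + M * w + n, 64 + M + L, d + 1, m, m2, n + 2]"

lemma pos: "0 < m" "0 < k3" "0 < m2" "0 < s" "0 < r" "0 < r2" "0 < d" "0 < u1" "0 < NN" "0 < M2" "0 < B0"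
    "0 < tmax" "0 < w"
proof -
  show 1: "0 < m" "0 < k3" using k_pos by (simp_all add: m_def k3_def)
  show 2: "0 < m2" using 1 by (simp add: m2_def)
  show 3: "0 < s" using 1 2 by (simp add: s_def)
  show 4: "0 < r" using 1 3 by (simp add: r_def)
  show 5: "0 < r2" using 4 by (simp add: r2_def)
  show "0 < d" using 2 k_pos by (simp add: d_def)
  show 6: "0 < u1" by (simp add: u1_def)
  show 7: "0 < NN" using 6 by (simp add: NN_def)
  show "0 < M2" using 1 7 by (simp add: M2_def)
  show 8: "0 < B0" using 3 5 by (simp add: B0_def)
  show "0 < tmax" using 8 by (simp add: tmax_def)
  show "0 < w" by (simp add: w_def)
qed

lemma W_ge: "2560 \<le> W" "k \<le> W" "2 ^ q * 2 \<le> W" "q \<le> W" "2 ^ l * 2 \<le> W" "l \<le> W" "s \<le> W" "r \<le> W" "u1 \<le> W" "NN \<le> W"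
   "M2 \<le> W" "B0 \<le> W" "tmax \<le> W" "np \<le> W" "cap \<le> W" "64 + M * w + n \<le> W" "64 + M + L \<le> W" "d + 1 \<le> W" "m \<le> W" "n + 2 \<le> W"
   "m2 \<le> W" "2 ^ q \<le> W" "2 ^ l \<le> W" "r2 \<le> W" "k3 \<le> W" "w \<le> W" "M \<le> W" "M * w \<le> W" "L \<le> W" "1 \<le> W" "cap + 1 \<le> W" 
   "M * w + 1 \<le> W" "np + 1 \<le> W" "tmax + 1 \<le> W" "L + 1 \<le> W"
proof -
  note mem = member_le_sum_list[OF _ zero_le, of _ "[2560, k, 2 ^ q * 2, q, 2 ^ l * 2, l, s, r, u1, NN, M2, B0, tmax + 1, np + 1, cap + 1,
    64 + M * w + n, 64 + M + L, d + 1, m, m2, n + 2]", folded W_def]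
  show 1: "2560 \<le> W" "k \<le> W" "2 ^ q * 2 \<le> W" "q \<le> W" "2 ^ l * 2 \<le> W" "l \<le> W" "s \<le> W" "r \<le> W" "u1 \<le> W" "NN \<le> W"
   "M2 \<le> W" "B0 \<le> W" "tmax + 1 \<le> W" "np + 1 \<le> W" "cap + 1 \<le> W" "64 + M * w + n \<le> W" "64 + M + L \<le> W" "d + 1 \<le> W"
   "m \<le> W" "n + 2 \<le> W" "m2 \<le> W"
    by (rule mem, simp only: list.set insert_iff simp_thms)+
  have "k3 \<le> s" using pos(3) by (simp add: s_def)
  then show "k3 \<le> W" using 1(7) by linarith
  have "r2 \<le> u1" by (simp add: u1_def)
  then show "r2 \<le> W" using 1(9) by linarith
  show "w \<le> W" using 1(20) by (simp add: w_def)
  show "tmax \<le> W" "np \<le> W" "cap \<le> W" using 1(13,14,15) by simp_all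
  show "2 ^ q \<le> W" using 1(3) by simp
  show "2 ^ l \<le> W" using 1(5) by simp
  show "M \<le> W" "L \<le> W" "L + 1 \<le> W" using 1(17) by simp_all
  show "M * w \<le> W" "M * w + 1 \<le> W" using 1(16) by simp_all
  show "1 \<le> W" using 1(1) by simp
qed

text \<open>
  Natural-number cells below 64 are registers; cell 31 always holds 0.  From cell 64 on, bit \<open>i\<close> of example \<open>t\<close> is
  stored in cell \<open>64 + t * w + i\<close>, followed at \<open>64 + M * w\<close> by the indicator of the set of variables found.  Label \<open>t\<close> is
  in real cell \<open>64 + t\<close>, and real cells from \<open>64 + M\<close> on hold the table of the evaluator.
\<close>

definition frame :: "state \<Rightarrow> bool" where
  "frame st \<longleftrightarrow> draws st = 0 \<and> (\<forall>a\<ge>64. nmem st a = 0) \<and> nmem st 0 = n \<and> nmem st 31 = 0"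

lemma small_le_W: "64 \<le> W" "40 \<le> W" "32 \<le> W" "20 \<le> W" "10 \<le> W" "6 \<le> W" "4 \<le> W" "2 \<le> W" "Suc 0 \<le> W"
  using W_ge(1) by simp_all

definition regs :: "(nat \<times> nat) list \<Rightarrow> state \<Rightarrow> bool" where
  "regs vs st \<longleftrightarrow> (\<forall>(a, v)\<in>set vs. nmem st a = v)"

lemma regs_simps [simp]: "regs [] st" "regs ((a, v) # vs) st \<longleftrightarrow> nmem st a = v \<and> regs vs st"
  by (auto simp: regs_def)

section \<open>The computation of the parameters\<close>

lemma wp_block:
  assumes "ok W D st" "vc \<omega> W D (block is) Q st" "tm (block is) \<le> T"
  shows "wp \<omega> W D (block is) T Q st"
  by (rule wp_mono[OF vc_wp[OF assms(1,2)] assms(3)])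

lemma find_k_wp:
  assumes "ok W D st" "frame st" "rmem st 0 = \<epsilon>"
  shows "wp \<omega> W D find_k (k * 20 + 40) (\<lambda>st. frame st \<and> regs [(1,1),(2,2),(3,k)] st) st"
proof -
  define test where "test j = real j * real j * (real j * real j) * real j * (\<epsilon> * \<epsilon> * (\<epsilon> * \<epsilon>))" for j :: nat
  have test: "test j = real j ^ 5 * \<epsilon> ^ 4" for j by (simp add: test_def eval_nat_numeral algebra_simps)
  define I where "I i st \<longleftrightarrow> frame st \<and> regs [(1,1),(2,2),(3,Suc i)] st \<and> rmem st 1 = 1 \<and>
    rmem st 2 = \<epsilon> * \<epsilon> * (\<epsilon> * \<epsilon>) \<and> rmem st 4 = test (Suc i)" for i st
  have init: "wp \<omega> W D (block [NConst 1 1, NConst 2 2, ROfN 1 1, RMul 2 0 0, RMul 2 2 2, NConst 3 1,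
      ROfN 3 3, RMul 4 3 3, RMul 4 4 4, RMul 4 4 3, RMul 4 4 2]) 30 (I 0) st"
    by (rule wp_block) (use assms in \<open>simp_all add: W_ge small_le_W I_def frame_def test_def\<close>)
  have "wp \<omega> W D (While (RLess 4 1)
      (block [NAdd 3 3 1, ROfN 3 3, RMul 4 3 3, RMul 4 4 4, RMul 4 4 3, RMul 4 4 2])) ((k - 1) * (15 + 3) + 2) (I (k - 1)) st'"
    if st': "ok W D st'" "I 0 st'" for st'
  proof (rule wp_While[where I = I, OF _ _ st'])
    fix i st assume i: "i < k - 1" "ok W D st" "I i st"
    have "test (Suc i) < 1" using k_least[of "Suc i"] i(1) by (simp add: test)
    then have "holds (RLess 4 1) st" using i(3) by (simp add: I_def)
    moreover have "wp \<omega> W D (block [NAdd 3 3 1, ROfN 3 3, RMul 4 3 3, RMul 4 4 4, RMul 4 4 3, RMul 4 4 2]) 15 (I (Suc i)) st"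
      by (rule wp_block) (use i W_ge(2) in \<open>simp_all add: small_le_W I_def frame_def test_def\<close>)
    ultimately show "holds (RLess 4 1) st \<and> wp \<omega> W D (block [NAdd 3 3 1, ROfN 3 3, RMul 4 3 3, RMul 4 4 4, RMul 4 4 3, RMul 4 4 2]) 15 (I (Suc i)) st" ..
  next
    fix st assume "I (k - 1) st"
    then show "\<not> holds (RLess 4 1) st" using k_large k_pos by (simp add: I_def test)
  qed
  note wp_Seq[OF init this]
  then show ?thesis unfolding find_k_def
    by (rule wp_mono) (use k_pos in \<open>simp_all add: I_def algebra_simps\<close>)
qed

lemma find_q_wp:
  assumes "ok W D st" "frame st" "regs [(1,1),(2,2),(3,k)] st"
  shows "wp \<omega> W D find_q (q * 20 + 40) (\<lambda>st. frame st \<and> regs [(1,1),(2,2),(3,k),(4,q)] st) st"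
proof -
  define I where "I i st \<longleftrightarrow> frame st \<and> regs [(1,1),(2,2),(3,k),(4,i),(5,2 ^ i)] st" for i st
  have init: "wp \<omega> W D (block [NConst 4 0, NConst 5 1]) 30 (I 0) st"
    by (rule wp_block) (use assms W_ge(20) in \<open>simp_all add: W_ge small_le_W I_def frame_def\<close>)
  have "wp \<omega> W D (While (NLess 5 3) (block [NAdd 4 4 1, NMul 5 5 2])) (q * (15 + 3) + 2) (I q) st'"
    if st': "ok W D st'" "I 0 st'" for st'
  proof (rule wp_While[where I = I, OF _ _ st'])
    fix i st assume i: "i < q" "ok W D st" "I i st"
    have "(2::nat) ^ i \<le> 2 ^ q" "Suc i \<le> q" using i by simp_all
    then have "2 ^ i * 2 \<le> W" "Suc i \<le> W" using W_ge(3,4) by linarith+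
    then have "wp \<omega> W D (block [NAdd 4 4 1, NMul 5 5 2]) 15 (I (Suc i)) st"
      by (intro wp_block) (use i in \<open>simp_all add: small_le_W I_def frame_def\<close>)
    then show "holds (NLess 5 3) st \<and> wp \<omega> W D (block [NAdd 4 4 1, NMul 5 5 2]) 15 (I (Suc i)) st"
      using q_least[of i] i by (simp add: I_def)
  next
    fix st assume "I q st"
    then show "\<not> holds (NLess 5 3) st" using q_large by (simp add: I_def)
  qed
  note wp_Seq[OF init this]
  then show ?thesis unfolding find_q_def
    by (rule wp_mono) (auto simp: I_def algebra_simps)
qed

lemma find_l_wp:
  assumes "ok W D st" "frame st" "regs [(1,1),(2,2),(3,k),(4,q)] st"
  shows "wp \<omega> W D find_l (l * 20 + 40) (\<lambda>st. frame st \<and> regs [(1,1),(2,2),(3,k),(4,q),(6,l),(8,n+1)] st) st"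
proof -
  define I where "I i st \<longleftrightarrow> frame st \<and> regs [(1,1),(2,2),(3,k),(4,q),(6,i),(7,2 ^ i),(8,n+1)] st" for i st
  have init: "wp \<omega> W D (block [NConst 6 0, NConst 7 1, NAdd 8 0 1]) 30 (I 0) st"
    by (rule wp_block) (use assms W_ge(20) in \<open>simp_all add: W_ge small_le_W I_def frame_def\<close>)
  have "wp \<omega> W D (While (NLess 7 8) (block [NAdd 6 6 1, NMul 7 7 2])) (l * (15 + 3) + 2) (I l) st'"
    if st': "ok W D st'" "I 0 st'" for st'
  proof (rule wp_While[where I = I, OF _ _ st'])
    fix i st assume i: "i < l" "ok W D st" "I i st"
    have "(2::nat) ^ i \<le> 2 ^ l" "Suc i \<le> l" using i by simp_all
    then have "2 ^ i * 2 \<le> W" "Suc i \<le> W" using W_ge(5,6) by linarith+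
    then have "wp \<omega> W D (block [NAdd 6 6 1, NMul 7 7 2]) 15 (I (Suc i)) st"
      by (intro wp_block) (use i in \<open>simp_all add: small_le_W I_def frame_def\<close>)
    then show "holds (NLess 7 8) st \<and> wp \<omega> W D (block [NAdd 6 6 1, NMul 7 7 2]) 15 (I (Suc i)) st"
      using l_least[of i] i by (simp add: I_def)
  next
    fix st assume "I l st"
    then show "\<not> holds (NLess 7 8) st" using l_large by (simp add: I_def)
  qed
  note wp_Seq[OF init this]
  then show ?thesis unfolding find_l_def
    by (rule wp_mono) (auto simp: I_def algebra_simps)
qed

lemma le_by_factor: "a * b \<le> W \<Longrightarrow> 0 < b \<Longrightarrow> a \<le> W" for a b :: nat
  by (cases b) auto

lemma mid_le_W:
  "k * k \<le> W" "k * k * k \<le> W" "q * 2 \<le> W" "m2 * k3 \<le> W" "s * s \<le> W" "s * s * k3 \<le> W" "m2 * k \<le> W" "r2 * 32 \<le> W" "m2 * k * 10 \<le> W"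
  "k3 * NN \<le> W" "r2 * r2 \<le> W" "r2 * r2 * s \<le> W" "l * 2 + 6 \<le> W" "l * 2 \<le> W" "(l * 2 + 6) * 32 \<le> W" "(l * 2 + 6) * 32 * r2 \<le> W"
  "r2 * 64 \<le> W" "r2 * 64 + B0 \<le> W" "r2 * 64 + B0 + 1 \<le> W" "(r2 * 64 + B0 + 1) * np \<le> W" "r2 * 32 * (tmax + 1) \<le> W"
  "(r2 * 64 + B0 + 1) * np + r2 * 32 * (tmax + 1) \<le> W" "M2 * (n + 1) \<le> W"
proof -
  note P = pos
  show 1: "k * k * k \<le> W" using W_ge unfolding k3_def by simp
  show "k * k \<le> W" by (rule le_by_factor[OF 1]) (use k_pos in simp)
  show "q * 2 \<le> W" using W_ge(19) unfolding m_def by simp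
  show "m2 * k3 \<le> W" using W_ge(7) unfolding s_def by (rule le_by_factor) simp
  show 2: "s * s * k3 \<le> W" using W_ge(8) unfolding r_def by (rule le_by_factor) simp
  show "s * s \<le> W" using 2 by (rule le_by_factor) (use P in simp)
  show 3: "m2 * k * 10 \<le> W" using W_ge(18) unfolding d_def by simp
  show "m2 * k \<le> W" using 3 by (rule le_by_factor) simp
  show "r2 * 32 \<le> W" using W_ge(9) unfolding u1_def by simp
  show "k3 * NN \<le> W" using W_ge(11) unfolding M2_def by (rule le_by_factor) simp
  show 4: "r2 * r2 * s \<le> W" using W_ge(12) unfolding B0_def by (rule le_by_factor) simp
  show "r2 * r2 \<le> W" using 4 by (rule le_by_factor) (use P in simp)
  show 5: "(l * 2 + 6) * 32 * r2 \<le> W" using W_ge(13) unfolding tmax_def by simp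
  show 6: "(l * 2 + 6) * 32 \<le> W" using 5 by (rule le_by_factor) (use P in simp)
  show "l * 2 + 6 \<le> W" using 6 by (rule le_by_factor) simp
  then show "l * 2 \<le> W" by simp
  show 7: "(r2 * 64 + B0 + 1) * np + r2 * 32 * (tmax + 1) \<le> W"
    using W_ge(15) unfolding cap_def by (rule le_by_factor) simp
  then show "(r2 * 64 + B0 + 1) * np \<le> W" "r2 * 32 * (tmax + 1) \<le> W" by (auto dest: add_leD1 add_leD2)
  have "r2 * 64 + 1 \<le> B0" 
  proof -
    have "r2 * 1 * 1 \<le> r2 * r2 * s" using P by (intro mult_le_mono) auto
    then show ?thesis using P(6) unfolding B0_def by linarith
  qed
  moreover have "B0 * 32 \<le> r2 * 32 * (tmax + 1)"
  proof -
    have "1 * B0 \<le> r2 * (tmax + 1)" using P by (intro mult_le_mono) (auto simp: tmax_def)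
    then show ?thesis by simp
  qed
  ultimately show "r2 * 64 + B0 + 1 \<le> W" using \<open>r2 * 32 * (tmax + 1) \<le> W\<close> by linarith
  then show "r2 * 64 + B0 \<le> W" "r2 * 64 \<le> W" by auto
  show "M2 * (n + 1) \<le> W" using W_ge(29) unfolding L_def by (rule le_by_factor) simp
qed

text \<open>The left-hand sides are the polynomials that symbolic execution of the blocks for
  \<open>tmax\<close>, \<open>np\<close>, \<open>cap\<close> and \<open>L\<close> arrives at after
  normalisation.\<close>

lemma alt_forms:
  "B0 + (64 * l + 192) * r2 = tmax" "n + (n + n * n) = np"
  "np * 20 + (r2 * 64 + B0) * np * 20 + (640 * r2 + 640 * (r2 * tmax)) = cap"
  "M2 + M2 * n + (M2 + M2 * n) * d = L"
proof -
  show "B0 + (64 * l + 192) * r2 = tmax" unfolding tmax_def by (simp add: algebra_simps)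
  show "n + (n + n * n) = np" unfolding np_def w_def by (simp add: algebra_simps)
  show "np * 20 + (r2 * 64 + B0) * np * 20 + (640 * r2 + 640 * (r2 * tmax)) = cap"
    unfolding cap_def by (simp add: algebra_simps)
  show "M2 + M2 * n + (M2 + M2 * n) * d = L" unfolding L_def by (simp add: algebra_simps)
qed

lemma extra_le_W:
  "Suc n \<le> W" "m * m \<le> W" "d \<le> W" "Suc (r2 * 32) \<le> W" "64 + M * w \<le> W" "64 + M \<le> W"
  using W_ge(20,21,18,9,16,17) by (simp_all add: m2_def u1_def)

lemmas le_W = W_ge mid_le_W small_le_W extra_le_W alt_forms W_ge[simplified] mid_le_W[simplified]

lemma comp_m_wp:
  assumes "ok W D st" "frame st" "regs [(1,1),(2,2),(3,k),(4,q),(6,l),(8,n+1)] st"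
  shows "wp \<omega> W D comp_m 30 (\<lambda>st. frame st \<and> regs [(1,1),(2,2),(3,k),(6,l),(8,n+1),(9,m),(41,k3),(42,m2)] st) st"
  unfolding comp_m_def
  by (rule wp_block) (use assms in \<open>simp_all add: le_W frame_def m_def[symmetric] k3_def m2_def\<close>)

lemma comp_s_wp:
  assumes "ok W D st" "frame st" "regs [(1,1),(2,2),(3,k),(6,l),(8,n+1),(9,m),(41,k3),(42,m2)] st"
  shows "wp \<omega> W D comp_s 30 (\<lambda>st. frame st \<and> regs [(1,1),(2,2),(3,k),(6,l),(8,n+1),(41,k3),(42,m2),(10,s)] st) st"
  unfolding comp_s_def
  by (rule wp_block) (use assms in \<open>simp_all add: le_W frame_def s_def[symmetric]\<close>)

lemma comp_r_wp:
  assumes "ok W D st" "frame st" "regs [(1,1),(2,2),(3,k),(6,l),(8,n+1),(41,k3),(42,m2),(10,s)] st"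
  shows "wp \<omega> W D comp_r 30 (\<lambda>st. frame st \<and> regs [(1,1),(2,2),(3,k),(6,l),(8,n+1),(41,k3),(42,m2),(10,s),(11,r)] st) st"
  unfolding comp_r_def
  by (rule wp_block) (use assms in \<open>simp_all add: le_W frame_def r_def[symmetric]\<close>)

lemma comp_r2_wp:
  assumes "ok W D st" "frame st" "regs [(1,1),(2,2),(3,k),(6,l),(8,n+1),(41,k3),(42,m2),(10,s),(11,r)] st"
  shows "wp \<omega> W D comp_r2 30 (\<lambda>st. frame st \<and> regs [(1,1),(2,2),(6,l),(8,n+1),(41,k3),(10,s),(11,r),
    (12,r2),(13,d),(14,u1),(15,1),(16,0)] st) st"
  unfolding comp_r2_def
  by (rule wp_block) (use assms in \<open>simp_all add: le_W frame_def r2_def[symmetric] d_def[symmetric] u1_def\<close>)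

lemma comp_N_wp:
  assumes "ok W D st" "frame st" "regs [(1,1),(2,2),(6,l),(8,n+1),(41,k3),(10,s),(11,r),
    (12,r2),(13,d),(14,u1),(15,1),(16,0)] st"
  shows "wp \<omega> W D comp_N (d * 18 + 2) (\<lambda>st. frame st \<and> regs [(1,1),(2,2),(6,l),(8,n+1),(41,k3),(10,s),(11,r),
    (12,r2),(13,d),(15,NN)] st) st"
proof -
  define I where "I i st \<longleftrightarrow> frame st \<and> regs [(1,1),(2,2),(6,l),(8,n+1),(41,k3),(10,s),(11,r),
    (12,r2),(13,d),(14,u1),(15,u1 ^ i),(16,i)] st" for i st
  have "wp \<omega> W D (While (NLess 16 13) (block [NMul 15 15 14, NAdd 16 16 1])) (d * (15 + 3) + 2) (I d) st"
  proof (rule wp_While[where I = I, OF _ _ assms(1)])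
    fix i st assume i: "i < d" "ok W D st" "I i st"
    have "u1 ^ Suc i \<le> u1 ^ d" using i pos by (intro power_increasing) auto
    then have "u1 ^ i * u1 \<le> W" using W_ge by (simp add: NN_def mult.commute)
    then have "wp \<omega> W D (block [NMul 15 15 14, NAdd 16 16 1]) 15 (I (Suc i)) st"
      by (intro wp_block) (use i W_ge(18) in \<open>simp_all add: I_def frame_def\<close>)
    then show "holds (NLess 16 13) st \<and> wp \<omega> W D (block [NMul 15 15 14, NAdd 16 16 1]) 15 (I (Suc i)) st"
      using i by (simp add: I_def)
  qed (use assms in \<open>simp_all add: I_def\<close>)
  then show ?thesis unfolding comp_N_def
    by (rule wp_mono) (auto simp: I_def NN_def)
qed

lemma comp_M2_wp:
  assumes "ok W D st" "frame st" "regs [(1,1),(2,2),(6,l),(8,n+1),(41,k3),(10,s),(11,r),(12,r2),(13,d),(15,NN)] st"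
  shows "wp \<omega> W D comp_M2 30 (\<lambda>st. frame st \<and> regs [(1,1),(2,2),(6,l),(8,n+1),(11,r),(12,r2),(13,d),(17,M2),(18,B0)] st) st"
  unfolding comp_M2_def
  by (rule wp_block) (use assms in \<open>simp_all add: le_W frame_def M2_def[symmetric] B0_def[symmetric]\<close>)

lemma comp_tmax_wp:
  assumes "ok W D st" "frame st" "regs [(1,1),(2,2),(6,l),(8,n+1),(11,r),(12,r2),(13,d),(17,M2),(18,B0)] st"
  shows "wp \<omega> W D comp_tmax 30 (\<lambda>st. frame st \<and> regs [(1,1),(8,n+1),(11,r),(12,r2),(13,d),(17,M2),(18,B0),
    (19,tmax),(22,w),(26,np)] st) st"
  unfolding comp_tmax_def
  by (rule wp_block) (use assms in \<open>simp_all add: le_W frame_def w_def\<close>)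

lemma comp_cap_wp:
  assumes "ok W D st" "frame st" "regs [(1,1),(8,n+1),(11,r),(12,r2),(13,d),(17,M2),(18,B0),(19,tmax),(22,w),(26,np)] st"
  shows "wp \<omega> W D comp_cap 40 (\<lambda>st. frame st \<and> regs [(1,1),(8,n+1),(11,r),(13,d),(17,M2),(18,B0),
    (19,tmax),(20,cap),(22,w),(26,np)] st) st"
  unfolding comp_cap_def
  by (rule wp_block) (use assms in \<open>simp_all add: le_W frame_def\<close>)

definition base :: "state \<Rightarrow> bool" where
  "base st \<longleftrightarrow> regs [(0,n),(1,1),(8,n+1),(17,M2),(18,B0),(19,tmax),(20,cap),(21,M),(22,w),(23,M*w),(24,64+M*w),(25,64),
     (26,np),(27,d+1),(29,64+M),(30,L),(31,0)] st \<and> rmem st 7 = 2 * real r"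

lemma comp_M_wp:
  assumes "ok W D st" "frame st" "regs [(1,1),(8,n+1),(11,r),(13,d),(17,M2),(18,B0),(19,tmax),(20,cap),(22,w),(26,np)] st"
  shows "wp \<omega> W D comp_M 60 (\<lambda>st. frame st \<and> base st \<and> regs [(32,0),(37,0),(38,0),(39,0)] st \<and> rmem st 6 = 0) st"
  unfolding comp_M_def
  by (rule wp_block) (use assms in \<open>simp_all add: le_W frame_def base_def M_def[symmetric]\<close>)

lemma comp_params_wp:
  assumes "ok W D st" "frame st" "rmem st 0 = \<epsilon>"
  shows "wp \<omega> W D comp_params (k * 20 + q * 20 + l * 20 + d * 18 + 500)
    (\<lambda>st. frame st \<and> base st \<and> regs [(32,0),(37,0),(38,0),(39,0)] st \<and> rmem st 6 = 0) st"
  unfolding comp_params_def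
  apply (rule wp_mono[OF wp_Seq[OF find_k_wp[OF assms] wp_Seq[OF find_q_wp wp_Seq[OF find_l_wp
    wp_Seq[OF comp_m_wp wp_Seq[OF comp_s_wp wp_Seq[OF comp_r_wp wp_Seq[OF comp_r2_wp wp_Seq[OF comp_N_wp
    wp_Seq[OF comp_M2_wp wp_Seq[OF comp_tmax_wp wp_Seq[OF comp_cap_wp comp_M_wp]]]]]]]]]]]])
  by (simp_all del: regs_simps)

end

section \<open>Programs that draw the sample, run the tests and evaluate the hypothesis\<close>

definition draw_body :: com where
  "draw_body = Seq (block [NDiv 33 32 22, NMul 34 33 22, NSub 34 32 34])
    (Seq (If (NLess 34 1) (block [Draw, ReadLabel 5, NAdd 35 25 33, RStore 35 5]) Skip)
    (Seq (block [ReadBit 36 34])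
    (Seq (If (NLess 0 34) (block [NConst 36 1]) Skip)
      (block [NAdd 35 25 32, NStore 35 36, NAdd 32 32 1]))))"

definition draw_examples :: com where
  "draw_examples = While (NLess 32 23) draw_body"

text \<open>Equality of two bits is decided arithmetically: the two truncated differences have a
  positive sum exactly if the bits differ. In that case the label is added to the running sum,
  otherwise subtracted.\<close>

definition test_step :: com where
  "test_step = Seq (block [NDiv 41 37 22, NMul 42 41 22, NSub 42 37 42, NMul 43 38 22, NAdd 43 43 25,
      NAdd 44 43 41, NAdd 45 43 42, NLoad 46 44, NLoad 47 45, NAdd 48 25 38, RLoad 10 48,
      NSub 49 46 47, NSub 50 47 46, NAdd 49 49 50, NAdd 38 38 1])
    (If (NLess 31 49) (block [RAdd 6 6 10]) (block [RSub 6 6 10]))"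

definition test_stop :: com where
  "test_stop = Seq (If (NLess 38 19) Skip (block [NDiv 41 37 22, NAdd 42 24 41, NStore 42 1]))
    (block [NConst 38 0, ROfN 6 31, NAdd 37 37 1])"

text \<open>Cell 40 holds the decision whether the current test goes on. Counter 39 advances in
  every branch, also when all tests are over, so that the loop makes exactly \<open>cap\<close>
  rounds on every path.\<close>

definition find_body :: com where
  "find_body = Seq (If (NLess 37 26)
     (Seq (block [NConst 40 0, ROfN 8 38, RMul 9 6 7])
     (Seq (If (NLess 38 19) (If (NLess 38 18) (block [NConst 40 1]) (If (RLess 9 8) Skip (block [NConst 40 1]))) Skip)
       (If (NLess 31 40) test_step test_stop))) Skip)
    (block [NAdd 39 39 1])"

definition find_variables :: com where
  "find_variables = While (NLess 39 20) find_body"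

definition learner :: com where
  "learner = Seq comp_params (Seq draw_examples find_variables)"

text \<open>The table is indexed by triples of example \<open>t\<close>, number of variables
  \<open>i\<close> and degree \<open>e\<close> at \<open>(t * (n + 1) + i) * (d + 1) + e\<close>.
  The two predecessors in the recursion of the elementary symmetric polynomials are therefore
  \<open>d + 1\<close> and \<open>d + 2\<close> cells back.\<close>

definition kernel_step :: com where
  "kernel_step = Seq (block [NSub 57 56 27, RLoad 11 57])
    (If (NLess 31 53)
      (Seq (block [NSub 58 55 1, NAdd 59 24 58, NLoad 60 59])
        (If (NLess 31 60)
          (Seq (block [ReadBit 61 58, NAdd 62 19 54, NMul 62 62 22, NAdd 62 62 58, NAdd 62 62 25, NLoad 62 62,
             NSub 57 57 1, RLoad 12 57, NSub 58 61 62, NSub 59 62 61, NAdd 58 58 59])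
           (If (NLess 31 58) (block [RSub 11 11 12]) (block [RAdd 11 11 12]))) Skip)) Skip)"

definition eval_body :: com where
  "eval_body = Seq (block [NDiv 52 51 27, NMul 53 52 27, NSub 53 51 53, NDiv 54 52 8, NMul 55 54 8, NSub 55 52 55,
      NAdd 56 29 51])
    (Seq (If (NLess 31 55) kernel_step
      (If (NLess 31 53) (block [ROfN 11 31]) (block [ROfN 11 1])))
    (Seq (block [RStore 56 11])
    (Seq (If (NLess 55 0) Skip (block [NAdd 57 25 19, NAdd 57 57 54, RLoad 12 57, RMul 12 12 11, RAdd 13 13 12]))
      (block [NAdd 51 51 1]))))"

definition evaluator :: com where
  "evaluator = Seq (block [NConst 51 0, ROfN 13 31]) (Seq (While (NLess 51 30) eval_body)
    (block [ROfN 12 17, RDiv 0 13 12]))"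

lemma flip_free_learner: "flip_free learner"
  by (simp add: learner_def comp_params_def find_k_def find_q_def find_l_def comp_m_def comp_s_def comp_r_def comp_r2_def
      comp_N_def comp_M2_def comp_tmax_def comp_cap_def comp_M_def draw_examples_def draw_body_def find_variables_def
      find_body_def test_step_def test_stop_def)

lemma oracle_free_evaluator: "oracle_free evaluator"
  by (simp add: evaluator_def eval_body_def kernel_step_def)

lemma vc_mono: "vc \<omega> W D c Q s \<Longrightarrow> (\<And>s'. Q s' \<Longrightarrow> Q' s') \<Longrightarrow> vc \<omega> W D c Q' s"
proof (induction c arbitrary: Q Q' s)
  case (Seq c d)
  show ?case
    using Seq.IH(1)[of "vc \<omega> W D d Q" s "vc \<omega> W D d Q'"] Seq.IH(2)[of Q _ Q'] Seq.prems by simp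
qed (auto split: if_splits)

lemma vc_Seq_eq: "vc \<omega> W D (Seq c d) Q = vc \<omega> W D c (vc \<omega> W D d Q)"
  by (rule ext) simp

lemma vc_Seq: "vc \<omega> W D c R s \<Longrightarrow> (\<And>s'. R s' \<Longrightarrow> vc \<omega> W D d Q s') \<Longrightarrow> vc \<omega> W D (Seq c d) Q s"
  unfolding vc.simps by (rule vc_mono)

context learner_params
begin

text \<open>
  Each stored example has two extra columns, \<open>n\<close> with the constant bit 0 and \<open>n + 1\<close> with the constant bit 1.
  Comparing column \<open>i\<close> with column \<open>j < n\<close> tests minus the coefficient of \<open>{i, j}\<close>, which is nonnegative by submodularity; comparing it
  with the extra columns tests the coefficient of \<open>{i}\<close> with both signs.  A test \<open>p\<close> encodes the pair \<open>(p div w, p mod w)\<close>.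
\<close>

definition bitv :: "nat set \<Rightarrow> nat \<Rightarrow> nat" where
  "bitv x i = (if i \<in> x \<or> n < i then 1 else 0)"

lemma base_upd_n [simp]: "32 \<le> a \<Longrightarrow> base (set_n a v st) \<longleftrightarrow> base st"
  unfolding base_def by simp

lemma base_upd_r [simp]: "a \<noteq> 7 \<Longrightarrow> base (set_r a v st) \<longleftrightarrow> base st"
  unfolding base_def by simp

lemma base_regs:
  assumes "base st"
  shows "nmem st 0 = n" "nmem st (Suc 0) = 1" "nmem st 8 = n + 1" "nmem st 17 = M2" "nmem st 18 = B0" "nmem st 19 = tmax"
    "nmem st 20 = cap" "nmem st 21 = M" "nmem st 22 = w" "nmem st 23 = M * w" "nmem st 24 = 64 + M * w" "nmem st 25 = 64"
    "nmem st 26 = np" "nmem st 27 = d + 1" "nmem st 29 = 64 + M" "nmem st 30 = L" "nmem st 31 = 0" "rmem st 7 = 2 * real r"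
  using assms by (simp_all add: base_def)

definition data :: "(nat \<Rightarrow> nat set \<times> real) \<Rightarrow> state \<Rightarrow> bool" where
  "data \<omega> st \<longleftrightarrow> (\<forall>p<M * w. nmem st (64 + p) = bitv (fst (\<omega> (p div w))) (p mod w))
    \<and> (\<forall>t<M. rmem st (64 + t) = snd (\<omega> t))"

text \<open>A row counts as drawn as soon as it has been started, hence the case distinction for
  \<open>draws\<close>. The last conjunct provides an empty indicator of found variables behind the
  examples.\<close>

definition draw_inv :: "(nat \<Rightarrow> nat set \<times> real) \<Rightarrow> nat \<Rightarrow> state \<Rightarrow> bool" where
  "draw_inv \<omega> c st \<longleftrightarrow> base st \<and> regs [(32,c),(37,0),(38,0),(39,0)] st \<and> rmem st 6 = 0
    \<and> draws st = (if c mod w = 0 then c div w else Suc (c div w))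
    \<and> (c mod w \<noteq> 0 \<longrightarrow> point st = fst (\<omega> (c div w)))
    \<and> (\<forall>p<c. nmem st (64 + p) = bitv (fst (\<omega> (p div w))) (p mod w))
    \<and> (\<forall>t. t * w < c \<longrightarrow> rmem st (64 + t) = snd (\<omega> t))
    \<and> (\<forall>a\<ge>64 + c. nmem st a = 0)"

lemma draw_body_vc:
  assumes c: "c < M * w" and inv: "draw_inv \<omega> c st"
  shows "vc \<omega> W M draw_body (draw_inv \<omega> (Suc c)) st"
proof -
  define t i where "t = c div w" and "i = c mod w"
  have w0: "0 < w" by (rule pos)
  have ti: "c = t * w + i" "i < w" using w0 by (simp_all add: t_def i_def)
  have tM: "t < M" using c w0 by (simp add: t_def less_mult_imp_div_less)
  have tw: "t * w \<le> W" "64 + t \<le> W" "64 + c \<le> W" "Suc c \<le> W" "1 \<le> W"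
    using ti c W_ge(16,17,30,28) tM by linarith+
  have sub: "c - t * w = i" using ti by simp
  have inv': "base st" "nmem st 32 = c" "nmem st 37 = 0" "nmem st 38 = 0" "nmem st 39 = 0" "rmem st 6 = 0"
    "draws st = (if i = 0 then t else Suc t)" "i \<noteq> 0 \<Longrightarrow> point st = fst (\<omega> t)"
    "\<And>p. p < c \<Longrightarrow> nmem st (64 + p) = bitv (fst (\<omega> (p div w))) (p mod w)"
    "\<And>t'. t' * w < c \<Longrightarrow> rmem st (64 + t') = snd (\<omega> t')"
    "\<And>a. 64 + c \<le> a \<Longrightarrow> nmem st a = 0"
    using inv by (simp_all add: draw_inv_def t_def i_def)
  note br = base_regs[OF inv'(1)]
  define R where "R st' \<longleftrightarrow> base st' \<and> regs [(32,c),(34,i),(37,0),(38,0),(39,0)] st' \<and> rmem st' 6 = 0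
      \<and> draws st' = Suc t \<and> point st' = fst (\<omega> t)
      \<and> (\<forall>p<c. nmem st' (64 + p) = bitv (fst (\<omega> (p div w))) (p mod w))
      \<and> (\<forall>t'. t' * w < Suc c \<longrightarrow> rmem st' (64 + t') = snd (\<omega> t'))
      \<and> (\<forall>a\<ge>64 + c. nmem st' a = 0)" for st'
  have lab: "t' * w < c \<or> (i = 0 \<and> t' = t)" if "t' * w < Suc c" for t'
  proof (cases "t' * w < c")
    case False
    then have e: "t' * w = t * w + i" using that ti by simp
    then have "(t' * w) mod w = i" using ti by simp
    then have "i = 0" by simp
    then show ?thesis using e w0 by simp
  qed simp
  have 1: "vc \<omega> W M (Seq (block [NDiv 33 32 22, NMul 34 33 22, NSub 34 32 34])
      (If (NLess 34 1) (block [Draw, ReadLabel 5, NAdd 35 25 33, RStore 35 5]) Skip)) R st"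
  proof (cases "i = 0")
    case True
    have "rmem st (64 + t') = snd (\<omega> t')" if "t' * w < Suc c" "t' \<noteq> t" for t'
      using lab[OF that(1)] that inv' by auto
    moreover have "base (st\<lparr>point := x, label := y, draws := z, nmem := nm, rmem := rm\<rparr>) = base (st\<lparr>nmem := nm, rmem := rm\<rparr>)" for x y z nm rm
      by (simp add: base_def regs_def)
    ultimately show ?thesis
      using True tM tw inv' ti
      by (simp add: br sub t_def[symmetric] R_def) (auto simp: base_def set_n_def set_r_def)
  next
    case False
    then have "rmem st (64 + t') = snd (\<omega> t')" if "t' * w < Suc c" for t'
      using lab[OF that] inv' by auto
    then show ?thesis
      using False tw inv' by (simp add: br sub t_def[symmetric] R_def)
  qed
  have 2: "vc \<omega> W M (Seq (block [ReadBit 36 34])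
    (Seq (If (NLess 0 34) (block [NConst 36 1]) Skip)
      (block [NAdd 35 25 32, NStore 35 36, NAdd 32 32 1]))) (draw_inv \<omega> (Suc c)) st'"
    if R: "R st'" for st'
  proof -
    have R': "base st'" "nmem st' 32 = c" "nmem st' 34 = i" "nmem st' 37 = 0" "nmem st' 38 = 0" "nmem st' 39 = 0" "rmem st' 6 = 0"
      "draws st' = Suc t" "point st' = fst (\<omega> t)"
      "\<And>p. p < c \<Longrightarrow> nmem st' (64 + p) = bitv (fst (\<omega> (p div w))) (p mod w)"
      "\<And>t'. t' * w < Suc c \<Longrightarrow> rmem st' (64 + t') = snd (\<omega> t')"
      "\<And>a. 64 + c \<le> a \<Longrightarrow> nmem st' a = 0"
      using R by (simp_all add: R_def)
    note br' = base_regs[OF R'(1)]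
    have dr: "Suc t = (if Suc c mod w = 0 then Suc c div w else Suc (Suc c div w))"
      and pt: "Suc c mod w \<noteq> 0 \<Longrightarrow> Suc c div w = t"
      using w0 by (auto simp: t_def mod_Suc div_Suc split: if_splits)
    have fin: "draw_inv \<omega> (Suc c) st''"
      if "base st''" "nmem st'' 32 = Suc c" "nmem st'' 37 = 0" "nmem st'' 38 = 0" "nmem st'' 39 = 0" "rmem st'' = rmem st'"
        "draws st'' = Suc t" "point st'' = fst (\<omega> t)" "\<And>a. 64 \<le> a \<Longrightarrow> nmem st'' a = (if a = 64 + c then bitv (fst (\<omega> t)) i else nmem st' a)"
      for st''
      unfolding draw_inv_def using that R' dr pt less_Suc_eq t_def i_def by auto
    show ?thesis
    proof (cases "n < i")
      case True
      then show ?thesis using tw by (simp add: R' br') (intro conjI impI; rule fin; simp add: R' br' bitv_def)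
    next
      case False
      then show ?thesis using tw by (simp add: R' br') (intro conjI impI; rule fin; simp add: R' br' bitv_def)
    qed
  qed
  have "vc \<omega> W M (Seq (Seq (block [NDiv 33 32 22, NMul 34 33 22, NSub 34 32 34])
      (If (NLess 34 1) (block [Draw, ReadLabel 5, NAdd 35 25 33, RStore 35 5]) Skip))
      (Seq (block [ReadBit 36 34])
    (Seq (If (NLess 0 34) (block [NConst 36 1]) Skip)
      (block [NAdd 35 25 32, NStore 35 36, NAdd 32 32 1])))) (draw_inv \<omega> (Suc c)) st"
    by (rule vc_Seq[OF 1 2])
  then show ?thesis by (simp only: draw_body_def vc_Seq_eq)
qed

lemma draw_examples_wp:
  assumes "ok W M st" "draw_inv \<omega> 0 st"
  shows "wp \<omega> W M draw_examples (M * w * (tm draw_body + 3) + 2) (draw_inv \<omega> (M * w)) st"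
  unfolding draw_examples_def
proof (rule wp_While[where I = "draw_inv \<omega>", OF _ _ assms])
  fix i st assume i: "i < M * w" "ok W M st" "draw_inv \<omega> i st"
  then show "holds (NLess 32 23) st \<and> wp \<omega> W M draw_body (tm draw_body) (draw_inv \<omega> (Suc i)) st"
    using vc_wp[OF i(2) draw_body_vc[OF i(1,3)]] by (simp add: draw_inv_def base_regs)
next
  fix st assume "draw_inv \<omega> (M * w) st"
  then show "\<not> holds (NLess 32 23) st" by (simp add: draw_inv_def base_regs)
qed

section \<open>Sequential tests of the coefficients of degrees one and two\<close>

definition stat :: "(nat \<Rightarrow> nat set \<times> real) \<Rightarrow> nat \<Rightarrow> nat \<Rightarrow> real" where
  "stat \<omega> p t = (if bitv (fst (\<omega> t)) (p div w) \<noteq> bitv (fst (\<omega> t)) (p mod w) then snd (\<omega> t) else - snd (\<omega> t))"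

definition stat_sum :: "(nat \<Rightarrow> nat set \<times> real) \<Rightarrow> nat \<Rightarrow> nat \<Rightarrow> real" where
  "stat_sum \<omega> p t = (\<Sum>t'<t. stat \<omega> p t')"

text \<open>The running mean is compared with \<open>1 / (2 * r)\<close>, half the detection
  threshold, so that means above \<open>1 / r\<close> survive and means below
  \<open>1 / (4 * r)\<close> are soon rejected. The first \<open>B0\<close> rounds are exempt
  because short sums deviate too easily.\<close>

definition continues :: "(nat \<Rightarrow> nat set \<times> real) \<Rightarrow> nat \<Rightarrow> nat \<Rightarrow> bool" where
  "continues \<omega> p t \<longleftrightarrow> t < tmax \<and> (t < B0 \<or> real t \<le> stat_sum \<omega> p t * (2 * real r))"

text \<open>
  One round of the search.  The loop over the tests and the loop over the examples are merged into one, so that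
  cutting it off after \<open>cap\<close> rounds bounds the running time on every path.
\<close>

fun micro :: "(nat \<Rightarrow> nat set \<times> real) \<Rightarrow> nat \<times> nat \<times> nat set \<Rightarrow> nat \<times> nat \<times> nat set" where
  "micro \<omega> (p, t, J) =
    (if p < np then
       (if continues \<omega> p t then (p, Suc t, J)
        else (Suc p, 0, if t < tmax then J else insert (p div w) J))
     else (p, t, J))"

text \<open>Ties the machine to the iterates of the pure function \<open>micro\<close>, so that the
  probabilistic analysis never has to mention states.\<close>

definition find_inv :: "(nat \<Rightarrow> nat set \<times> real) \<Rightarrow> nat \<Rightarrow> state \<Rightarrow> bool" where
  "find_inv \<omega> c st \<longleftrightarrow> (case (micro \<omega> ^^ c) (0, 0, {}) of (p, t, J) \<Rightarrow>
     base st \<and> regs [(37,p),(38,t),(39,c)] st \<and> rmem st 6 = stat_sum \<omega> p t \<and> data \<omega> st \<and> draws st = M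
     \<and> p \<le> np \<and> t \<le> tmax \<and> (\<forall>i<n. nmem st (64 + M * w + i) = (if i \<in> J then 1 else 0)))"

lemma less_mult_add: "(a::nat) < m' \<Longrightarrow> b < v \<Longrightarrow> a * v + b < m' * v"
proof -
  assume "a < m'" "b < v"
  then have "a * v + b < Suc a * v" by simp
  also have "\<dots> \<le> m' * v" using \<open>a < m'\<close> by (intro mult_right_mono) auto
  finally show ?thesis .
qed

lemma find_body_vc:
  assumes c: "c < cap" and inv: "find_inv \<omega> c st"
  shows "vc \<omega> W M find_body (find_inv \<omega> (Suc c)) st"
proof -
  obtain p t J where m: "(micro \<omega> ^^ c) (0, 0, {}) = (p, t, J)" by (metis prod_cases3)
  then have m': "(micro \<omega> ^^ Suc c) (0, 0, {}) = micro \<omega> (p, t, J)" by simp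
  have I: "base st" "nmem st 37 = p" "nmem st 38 = t" "nmem st 39 = c" "rmem st 6 = stat_sum \<omega> p t" "data \<omega> st" "draws st = M"
     "p \<le> np" "t \<le> tmax" "\<And>i. i < n \<Longrightarrow> nmem st (64 + M * w + i) = (if i \<in> J then 1 else 0)"
    using inv by (simp_all add: find_inv_def m)
  note br = base_regs[OF I(1)]
  have cW: "Suc c \<le> W" "1 \<le> W" "Suc p \<le> W" using c W_ge(31,30,33) I(8) by linarith+
  have w0: "0 < w" by (rule pos)
  have data_upd: "data \<omega> (set_n a v s') = data \<omega> s'" if "a < 64 \<or> 64 + M * w \<le> a" for a v s'
    using that by (auto simp: data_def)
  have data_updr: "data \<omega> (set_r a v s') = data \<omega> s'" if "a < 64" for a v s'
    using that by (auto simp: data_def)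
  show ?thesis
  proof (cases "p < np")
    case False
    then show ?thesis
      using I cW unfolding find_inv_def m' by (simp add: find_body_def br data_upd)
  next
    case True
    define i j where "i = p div w" and "j = p mod w"
    have ij: "i < n" "j < w" "p - i * w = j"
      using True w0 by (simp_all add: i_def j_def np_def less_mult_imp_div_less minus_div_mult_eq_mod)
    have tM: "tmax \<le> M" by (simp add: M_def)
    have iw: "i < w" using ij by (simp add: w_def)
    show ?thesis
    proof (cases "continues \<omega> p t")
      case cont: True
      then have t: "t < tmax" by (simp add: continues_def)
      have addr: "t * w + i < M * w" "t * w + j < M * w"
        using t tM ij iw by (auto intro!: less_mult_add)
      have bits: "nmem st (64 + (t * w + i)) = bitv (fst (\<omega> t)) i" "nmem st (64 + (t * w + j)) = bitv (fst (\<omega> t)) j"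
        "rmem st (64 + t) = snd (\<omega> t)"
        using I(6) addr ij iw t tM by (auto simp: data_def)
      have le: "i * w \<le> W" "t * w \<le> W" "t * w + 64 \<le> W" "t * w + 64 + i \<le> W" "t * w + 64 + j \<le> W" "64 + t \<le> W" "Suc t \<le> W"
        "bitv (fst (\<omega> t)) i \<le> 1" "bitv (fst (\<omega> t)) j \<le> 1"
      proof -
        have "i * w \<le> p" by (simp add: i_def)
        then show "i * w \<le> W" using I(8) W_ge(14) by linarith
        show "t * w \<le> W" "t * w + 64 \<le> W" "t * w + 64 + i \<le> W" "t * w + 64 + j \<le> W" "64 + t \<le> W" "Suc t \<le> W"
          using addr W_ge(16,17,34) t tM by linarith+
      qed (simp_all add: bitv_def)
      define R where "R st' \<longleftrightarrow> base st' \<and> nmem st' 37 = p \<and> nmem st' 38 = t \<and> nmem st' 39 = c \<and> nmem st' 40 = 1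
        \<and> rmem st' 6 = stat_sum \<omega> p t \<and> draws st' = M \<and> (\<forall>a\<ge>64. nmem st' a = nmem st a) \<and> (\<forall>a\<ge>64. rmem st' a = rmem st a)" for st'
      have 1: "vc \<omega> W M (Seq (block [NConst 40 0, ROfN 8 38, RMul 9 6 7])
         (If (NLess 38 19) (If (NLess 38 18) (block [NConst 40 1]) (If (RLess 9 8) Skip (block [NConst 40 1]))) Skip)) R st"
        using cont t cW I by (auto simp: br R_def continues_def)
      have 2: "vc \<omega> W M (Seq (If (NLess 31 40) test_step test_stop) (block [NAdd 39 39 1])) (find_inv \<omega> (Suc c)) st'"
        if R: "R st'" for st'
      proof -
        have R': "base st'" "nmem st' 37 = p" "nmem st' 38 = t" "nmem st' 39 = c" "nmem st' 40 = 1"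
          "rmem st' 6 = stat_sum \<omega> p t" "draws st' = M" "\<And>a. 64 \<le> a \<Longrightarrow> nmem st' a = nmem st a" "\<And>a. 64 \<le> a \<Longrightarrow> rmem st' a = rmem st a"
          using R by (simp_all add: R_def)
        note br' = base_regs[OF R'(1)]
        have b': "nmem st' (t * w + 64 + i) = bitv (fst (\<omega> t)) i" "nmem st' (t * w + 64 + j) = bitv (fst (\<omega> t)) j"
          "rmem st' (64 + t) = snd (\<omega> t)"
        proof -
          have a: "t * w + 64 + i = 64 + (t * w + i)" "t * w + 64 + j = 64 + (t * w + j)" by simp_all
          show "nmem st' (t * w + 64 + i) = bitv (fst (\<omega> t)) i" "nmem st' (t * w + 64 + j) = bitv (fst (\<omega> t)) j"
            "rmem st' (64 + t) = snd (\<omega> t)"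
            unfolding a using bits R' by simp_all
        qed
        have fin: "find_inv \<omega> (Suc c) st''"
          if "base st''" "nmem st'' 37 = p" "nmem st'' 38 = Suc t" "nmem st'' 39 = Suc c"
            "rmem st'' 6 = stat_sum \<omega> p t + stat \<omega> p t" "draws st'' = M"
            "\<And>a. 64 \<le> a \<Longrightarrow> nmem st'' a = nmem st' a" "\<And>a. 64 \<le> a \<Longrightarrow> rmem st'' a = rmem st' a" for st''
          using that I R' True cont t by (simp add: find_inv_def m' data_def stat_sum_def del: funpow.simps)
        have st: "stat \<omega> p t = (if bitv (fst (\<omega> t)) i \<noteq> bitv (fst (\<omega> t)) j then snd (\<omega> t) else - snd (\<omega> t))"
          by (simp add: stat_def i_def j_def)
        have diff: "0 < bitv (fst (\<omega> t)) i - bitv (fst (\<omega> t)) j + (bitv (fst (\<omega> t)) j - bitv (fst (\<omega> t)) i)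
            \<longleftrightarrow> bitv (fst (\<omega> t)) i \<noteq> bitv (fst (\<omega> t)) j"
          by auto
        have dW: "bitv (fst (\<omega> t)) i - bitv (fst (\<omega> t)) j + (bitv (fst (\<omega> t)) j - bitv (fst (\<omega> t)) i) \<le> W"
          using le(8,9) cW(2) by linarith
        have "vc \<omega> W M (Seq test_step (block [NAdd 39 39 1])) (find_inv \<omega> (Suc c)) st'"
          unfolding test_step_def
          using le cW dW
          by (simp add: R' br' b' i_def[symmetric] ij diff del: add_gr_0 zero_less_diff)
             (intro conjI impI; rule fin; simp add: R' br' st)
        then show ?thesis by (simp add: br' R')
      qed
      show ?thesis
        using vc_Seq[OF 1 2] True
        by (simp only: find_body_def vc_Seq_eq vc.simps(4) holds.simps br I(2) if_True)
    next
      case stop: False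
      define J' where "J' = (if t < tmax then J else insert i J)"
      define R where "R st' \<longleftrightarrow> base st' \<and> nmem st' 37 = p \<and> nmem st' 38 = t \<and> nmem st' 39 = c \<and> nmem st' 40 = 0
        \<and> draws st' = M \<and> (\<forall>a\<ge>64. nmem st' a = nmem st a) \<and> (\<forall>a\<ge>64. rmem st' a = rmem st a)" for st'
      have 1: "vc \<omega> W M (Seq (block [NConst 40 0, ROfN 8 38, RMul 9 6 7])
         (If (NLess 38 19) (If (NLess 38 18) (block [NConst 40 1]) (If (RLess 9 8) Skip (block [NConst 40 1]))) Skip)) R st"
        using stop cW I by (auto simp: br R_def continues_def)
      have 2: "vc \<omega> W M (Seq (If (NLess 31 40) test_step test_stop) (block [NAdd 39 39 1])) (find_inv \<omega> (Suc c)) st'"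
        if R: "R st'" for st'
      proof -
        have R': "base st'" "nmem st' 37 = p" "nmem st' 38 = t" "nmem st' 39 = c" "nmem st' 40 = 0"
          "draws st' = M" "\<And>a. 64 \<le> a \<Longrightarrow> nmem st' a = nmem st a" "\<And>a. 64 \<le> a \<Longrightarrow> rmem st' a = rmem st a"
          using R by (simp_all add: R_def)
        note br' = base_regs[OF R'(1)]
        have fin: "find_inv \<omega> (Suc c) st''"
          if "base st''" "nmem st'' 37 = Suc p" "nmem st'' 38 = 0" "nmem st'' 39 = Suc c"
            "rmem st'' 6 = 0" "draws st'' = M"
            "\<And>a. 64 \<le> a \<Longrightarrow> a < 64 + M * w \<Longrightarrow> nmem st'' a = nmem st' a" "\<And>a. 64 \<le> a \<Longrightarrow> rmem st'' a = rmem st' a"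
            "\<And>i'. i' < n \<Longrightarrow> nmem st'' (64 + M * w + i') = (if i' \<in> J' then 1 else 0)" for st''
          using that I R' True stop by (simp add: find_inv_def m' data_def stat_sum_def J'_def i_def del: funpow.simps)
        have mW: "64 + M * w + i \<le> W" using W_ge(16) ij by linarith
        have "vc \<omega> W M (Seq test_stop (block [NAdd 39 39 1])) (find_inv \<omega> (Suc c)) st'"
        proof (cases "t < tmax")
          case True
          then show ?thesis
            unfolding test_stop_def using cW
            by (simp add: R' br') (rule fin; simp add: R' br' J'_def I(10))
        next
          case False
          then show ?thesis
            unfolding test_stop_def using cW mW
            by (simp add: R' br' i_def[symmetric]) (rule fin; simp add: R' br' J'_def I(10))
        qed
        then show ?thesis by (simp add: br' R')
      qed
      show ?thesis
        using vc_Seq[OF 1 2] True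
        by (simp only: find_body_def vc_Seq_eq vc.simps(4) holds.simps br I(2) if_True)
    qed
  qed
qed

lemma find_variables_wp:
  assumes "ok W M st" "find_inv \<omega> 0 st"
  shows "wp \<omega> W M find_variables (cap * (tm find_body + 3) + 2) (find_inv \<omega> cap) st"
  unfolding find_variables_def
proof (rule wp_While[where I = "find_inv \<omega>", OF _ _ assms])
  fix i st assume i: "i < cap" "ok W M st" "find_inv \<omega> i st"
  then show "holds (NLess 39 20) st \<and> wp \<omega> W M find_body (tm find_body) (find_inv \<omega> (Suc i)) st"
    using vc_wp[OF i(2) find_body_vc[OF i(1,3)]] by (auto simp: find_inv_def base_regs split: prod.splits)
next
  fix st assume "find_inv \<omega> cap st"
  then show "\<not> holds (NLess 39 20) st" by (auto simp: find_inv_def base_regs split: prod.splits)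
qed

lemma draw_inv_imp_find_inv:
  assumes "draw_inv \<omega> (M * w) st"
  shows "find_inv \<omega> 0 st"
proof -
  have "t * w < M * w" if "t < M" for t using that pos(13) by simp
  moreover have "nmem st (64 + M * w + i) = 0" for i using assms by (simp add: draw_inv_def)
  ultimately show ?thesis
    using assms pos(13) by (auto simp: find_inv_def draw_inv_def data_def stat_sum_def)
qed

definition learner_time :: nat where
  "learner_time = (k * 20 + q * 20 + l * 20 + d * 18 + 500) + ((M * w * (tm draw_body + 3) + 2) +
     (cap * (tm find_body + 3) + 2) + 1) + 1"

lemma learner_wp:
  assumes "ok W M st" "frame st" "rmem st 0 = \<epsilon>"
  shows "wp \<omega> W M learner learner_time (find_inv \<omega> cap) st"
  unfolding learner_def learner_time_def
proof (rule wp_Seq[OF comp_params_wp[OF assms]])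
  fix s' assume ok': "ok W M s'"
    and s': "frame s' \<and> base s' \<and> regs [(32,0),(37,0),(38,0),(39,0)] s' \<and> rmem s' 6 = 0"
  have "draw_inv \<omega> 0 s'"
    using s' by (simp add: draw_inv_def frame_def)
  show "wp \<omega> W M (Seq draw_examples find_variables)
     ((M * w * (tm draw_body + 3) + 2) + (cap * (tm find_body + 3) + 2) + 1) (find_inv \<omega> cap) s'"
    by (rule wp_Seq[OF draw_examples_wp[OF ok' \<open>draw_inv \<omega> 0 s'\<close>] find_variables_wp[OF _ draw_inv_imp_find_inv]])
qed

text \<open>
  The sum of \<open>chi S x * chi S x\<^sub>t\<close> over the sets \<open>S\<close> of size \<open>e\<close> is the \<open>e\<close>-th elementary symmetric
  polynomial of the products of the signs of \<open>x\<close> and \<open>x\<^sub>t\<close>, which has a recursion over the variables.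
\<close>

fun elem_sum :: "(nat \<Rightarrow> real) \<Rightarrow> nat set \<Rightarrow> nat \<Rightarrow> nat \<Rightarrow> real" where
  "elem_sum \<sigma> J 0 e = (if e = 0 then 1 else 0)"
| "elem_sum \<sigma> J (Suc i) e = elem_sum \<sigma> J i e + (if i \<in> J \<and> 0 < e then \<sigma> i * elem_sum \<sigma> J i (e - 1) else 0)"

definition agree :: "(nat \<Rightarrow> nat set \<times> real) \<Rightarrow> nat set \<Rightarrow> nat \<Rightarrow> nat \<Rightarrow> real" where
  "agree \<omega> x t i = (if bitv (fst (\<omega> (tmax + t))) i = (if i \<in> x then 1 else 0) then 1 else -1)"

definition table :: "(nat \<Rightarrow> nat set \<times> real) \<Rightarrow> nat set \<Rightarrow> nat set \<Rightarrow> nat \<Rightarrow> real" where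
  "table \<omega> J x c = elem_sum (agree \<omega> x (c div (d + 1) div (n + 1))) J (c div (d + 1) mod (n + 1)) (c mod (d + 1))"

text \<open>Only in the column \<open>i = n\<close> has the recursion seen all variables. The
  accumulator picks up those entries, times the label of their example.\<close>

definition contribution :: "(nat \<Rightarrow> nat set \<times> real) \<Rightarrow> nat set \<Rightarrow> nat set \<Rightarrow> nat \<Rightarrow> real" where
  "contribution \<omega> J x c = (if c div (d + 1) mod (n + 1) = n
     then snd (\<omega> (tmax + c div (d + 1) div (n + 1))) * table \<omega> J x c else 0)"

definition eval_inv :: "(nat \<Rightarrow> nat set \<times> real) \<Rightarrow> nat set \<Rightarrow> nat set \<Rightarrow> nat \<Rightarrow> state \<Rightarrow> bool" where
  "eval_inv \<omega> J x c st \<longleftrightarrow> base st \<and> data \<omega> st \<and> point st = x \<and> nmem st 51 = c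
     \<and> (\<forall>i<n. nmem st (64 + M * w + i) = (if i \<in> J then 1 else 0))
     \<and> (\<forall>c'<c. rmem st (64 + M + c') = table \<omega> J x c')
     \<and> rmem st 13 = (\<Sum>c'<c. contribution \<omega> J x c')"

lemma table_coords:
  assumes "e < d + 1" "i < n + 1"
  shows "table \<omega> J x ((t * (n + 1) + i) * (d + 1) + e) = elem_sum (agree \<omega> x t) J i e"
    "contribution \<omega> J x ((t * (n + 1) + i) * (d + 1) + e)
      = (if i = n then snd (\<omega> (tmax + t)) * elem_sum (agree \<omega> x t) J i e else 0)"
proof -
  have a: "((t * (n + 1) + i) * (d + 1) + e) div (d + 1) = t * (n + 1) + i"
    "((t * (n + 1) + i) * (d + 1) + e) mod (d + 1) = e"
    using assms(1) by (simp_all only: div_mult_self3 mod_mult_self3 div_less mod_less)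
  have b: "(t * (n + 1) + i) div (n + 1) = t" "(t * (n + 1) + i) mod (n + 1) = i"
    using assms(2) by (simp_all only: div_mult_self3 mod_mult_self3 div_less mod_less)
  show 1: "table \<omega> J x ((t * (n + 1) + i) * (d + 1) + e) = elem_sum (agree \<omega> x t) J i e"
    unfolding table_def a b ..
  show "contribution \<omega> J x ((t * (n + 1) + i) * (d + 1) + e)
      = (if i = n then snd (\<omega> (tmax + t)) * elem_sum (agree \<omega> x t) J i e else 0)"
    unfolding contribution_def 1 a b ..
qed

lemma eval_body_vc:
  assumes c: "c < L" and inv: "eval_inv \<omega> J x c st"
  shows "vc \<omega> W D eval_body (eval_inv \<omega> J x (Suc c)) st"
proof -
  define b e t i where "b = c div (d + 1)" and "e = c mod (d + 1)" and "t = b div (n + 1)" and "i = b mod (n + 1)"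
  have bt: "b = t * (n + 1) + i" "i < n + 1"
    unfolding t_def i_def by (rule div_mult_mod_eq[symmetric]) simp
  have cb: "c = b * (d + 1) + e" "e < d + 1"
    unfolding b_def e_def by (rule div_mult_mod_eq[symmetric]) simp
  have sub: "c - b * (d + 1) = e" "b - t * (n + 1) = i" using bt cb by simp_all
  have bd: "c div (d + 1) = b" "b div (n + 1) = t" by (simp_all add: b_def t_def)
  have tM: "t < M2"
    using c unfolding t_def b_def L_def by (simp only: less_mult_imp_div_less)
  have I: "base st" "data \<omega> st" "point st = x" "nmem st 51 = c"
    "\<And>i. i < n \<Longrightarrow> nmem st (64 + M * w + i) = (if i \<in> J then 1 else 0)"
    "\<And>c'. c' < c \<Longrightarrow> rmem st (64 + M + c') = table \<omega> J x c'"
    "rmem st 13 = (\<Sum>c'<c. contribution \<omega> J x c')"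
    using inv by (simp_all add: eval_inv_def)
  note br = base_regs[OF I(1)]
  have cW: "Suc c \<le> W" "1 \<le> W" "64 + M + c \<le> W" "b * (d + 1) \<le> W" "t * (n + 1) \<le> W"
  proof -
    show "Suc c \<le> W" "1 \<le> W" "64 + M + c \<le> W" using c W_ge(17,30) by linarith+
    then show "b * (d + 1) \<le> W" using cb by linarith
    have "b \<le> c" by (simp add: b_def)
    then show "t * (n + 1) \<le> W" using bt \<open>Suc c \<le> W\<close> by linarith
  qed
  define v where "v = elem_sum (agree \<omega> x t) J i e"
  have tab: "table \<omega> J x c = v" "contribution \<omega> J x c = (if i = n then snd (\<omega> (tmax + t)) * v else 0)"
    using table_coords[OF cb(2) bt(2)] unfolding v_def cb(1) bt(1) by blast+
  define R1 where "R1 st' \<longleftrightarrow> base st' \<and> point st' = x \<and> nmem st' 51 = c \<and> nmem st' 53 = e \<and> nmem st' 54 = t \<and> nmem st' 55 = i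
    \<and> nmem st' 56 = 64 + M + c \<and> rmem st' 13 = rmem st 13 \<and> (\<forall>a\<ge>64. nmem st' a = nmem st a) \<and> (\<forall>a\<ge>64. rmem st' a = rmem st a)" for st'
  define R2 where "R2 st' \<longleftrightarrow> base st' \<and> point st' = x \<and> nmem st' 51 = c \<and> nmem st' 54 = t \<and> nmem st' 55 = i
    \<and> nmem st' 56 = 64 + M + c \<and> rmem st' 11 = v \<and> rmem st' 13 = rmem st 13
    \<and> (\<forall>a\<ge>64. nmem st' a = nmem st a) \<and> (\<forall>a\<ge>64. rmem st' a = rmem st a)" for st'
  have 1: "vc \<omega> W D (block [NDiv 52 51 27, NMul 53 52 27, NSub 53 51 53, NDiv 54 52 8, NMul 55 54 8, NSub 55 52 55,
      NAdd 56 29 51]) R1 st"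
    using cW I sub bd unfolding R1_def by (simp add: br)
  have 2: "vc \<omega> W D (If (NLess 31 55) kernel_step
      (If (NLess 31 53) (block [ROfN 11 31]) (block [ROfN 11 1]))) R2 s1" if "R1 s1" for s1
  proof -
    have R: "base s1" "point s1 = x" "nmem s1 51 = c" "nmem s1 53 = e" "nmem s1 54 = t" "nmem s1 55 = i"
      "nmem s1 56 = 64 + M + c" "rmem s1 13 = rmem st 13" "\<And>a. 64 \<le> a \<Longrightarrow> nmem s1 a = nmem st a" "\<And>a. 64 \<le> a \<Longrightarrow> rmem s1 a = rmem st a"
      using that by (simp_all add: R1_def)
    note br1 = base_regs[OF R(1)]
    show ?thesis
    proof (cases i)
      case 0
      then show ?thesis using R by (simp add: br1 R2_def v_def)
    next
      case (Suc i')
      have i': "i' < n" using bt Suc by simp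
      define c' where "c' = (t * (n + 1) + i') * (d + 1) + e"
      have cc: "c = c' + (d + 1)" unfolding c'_def cb(1) bt(1) Suc by simp
      have prev: "64 + M + c - (d + 1) = 64 + M + c'" using cc by simp
      have r1: "rmem st (64 + M + c') = elem_sum (agree \<omega> x t) J i' e"
        using I(6)[of c'] cc table_coords(1)[OF cb(2), of i'] i' by (simp add: c'_def)
      have mark: "nmem st (64 + M * w + i') = (if i' \<in> J then 1 else 0)" by (rule I(5)[OF i'])
      have mW: "64 + M * w + i' \<le> W" using W_ge(16) i' by linarith
      show ?thesis
      proof (cases "0 < e \<and> i' \<in> J")
        case False
        then have "v = elem_sum (agree \<omega> x t) J i' e" by (auto simp: v_def Suc)
        then show ?thesis
          using R Suc False mW mark r1
          by (auto simp: kernel_step_def br1 R2_def prev[simplified])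
      next
        case True
        have v: "v = elem_sum (agree \<omega> x t) J i' e + agree \<omega> x t i' * elem_sum (agree \<omega> x t) J i' (e - 1)"
          using True by (simp add: v_def Suc)
        \<comment> \<open>As \<open>e\<close> is positive, the entry of degree \<open>e - 1\<close>
          in the same column is the cell directly before \<open>c'\<close>.\<close>
        have "c' = (t * (n + 1) + i') * (d + 1) + (e - 1) + 1" using True by (simp add: c'_def)
        then obtain c'' where pp: "c' = Suc c''" "c'' = (t * (n + 1) + i') * (d + 1) + (e - 1)" "c'' < c"
          using cc by simp
        have r2': "rmem st (64 + M + c'') = elem_sum (agree \<omega> x t) J i' (e - 1)"
          using I(6)[OF pp(3)] table_coords(1)[of "e - 1" i'] i' cb(2) unfolding pp(2) by simp
        have ad: "(tmax + t) * w + i' < M * w"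
          using tM i' by (intro less_mult_add) (simp_all add: M_def w_def)
        have iw: "i' < w" using i' by (simp add: w_def)
        have bit: "nmem st (64 + ((tmax + t) * w + i')) = bitv (fst (\<omega> (tmax + t))) i'"
          using I(2) ad iw by (simp add: data_def)
        have adW: "tmax + t \<le> W" "(tmax + t) * w \<le> W" "(tmax + t) * w + i' \<le> W" "(tmax + t) * w + i' + 64 \<le> W"
          using ad W_ge(16,27) tM by (simp_all add: M_def)
        have bv: "bitv (fst (\<omega> (tmax + t))) i' = 0 \<or> bitv (fst (\<omega> (tmax + t))) i' = 1" by (simp add: bitv_def)
        have addr: "(tmax + t) * w + i' + 64 = 64 + ((tmax + t) * w + i')" by simp
        have rm: "rmem s1 (64 + M + c') = elem_sum (agree \<omega> x t) J i' e" using R r1 by simp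
        have lo: "vc \<omega> W D (block [NSub 57 56 27, RLoad 11 57])
          (\<lambda>s2. R1 s2 \<and> nmem s2 57 = 64 + M + c' \<and> rmem s2 11 = elem_sum (agree \<omega> x t) J i' e) s1"
          using R rm prev by (simp add: br1 R1_def del: add_Suc_right)
        have add: "vc \<omega> W D (Seq (block [NSub 58 55 1, NAdd 59 24 58, NLoad 60 59])
            (If (NLess 31 60)
              (Seq (block [ReadBit 61 58, NAdd 62 19 54, NMul 62 62 22, NAdd 62 62 58, NAdd 62 62 25, NLoad 62 62,
                 NSub 57 57 1, RLoad 12 57, NSub 58 61 62, NSub 59 62 61, NAdd 58 58 59])
               (If (NLess 31 58) (block [RSub 11 11 12]) (block [RAdd 11 11 12]))) Skip)) R2 s2"
          if "R1 s2 \<and> nmem s2 57 = 64 + M + c' \<and> rmem s2 11 = elem_sum (agree \<omega> x t) J i' e" for s2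
        proof -
          have S: "base s2" "point s2 = x" "nmem s2 51 = c" "nmem s2 53 = e" "nmem s2 54 = t" "nmem s2 55 = Suc i'"
            "nmem s2 56 = 64 + M + c" "rmem s2 13 = rmem st 13" "\<And>a. 64 \<le> a \<Longrightarrow> nmem s2 a = nmem st a"
            "\<And>a. 64 \<le> a \<Longrightarrow> rmem s2 a = rmem st a" "nmem s2 57 = 64 + M + c'" "rmem s2 11 = elem_sum (agree \<omega> x t) J i' e"
            using that Suc by (simp_all add: R1_def)
          note br2 = base_regs[OF S(1)]
          have nm: "nmem s2 ((tmax + t) * w + i' + 64) = bitv (fst (\<omega> (tmax + t))) i'"
            unfolding addr using S bit by simp
          have nm': "nmem s2 (64 + M * w + i') = 1" using S mark True by simp
          have rm: "rmem s2 (64 + M + c'') = elem_sum (agree \<omega> x t) J i' (e - 1)" using S r2' by simp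
          have ag: "agree \<omega> x t i' = (if bitv (fst (\<omega> (tmax + t))) i' = (if i' \<in> x then 1 else 0) then 1 else -1)"
            by (simp add: agree_def)
          have goal: "R2 s3" if "base s3" "point s3 = x" "nmem s3 51 = c" "nmem s3 54 = t" "nmem s3 55 = Suc i'"
            "nmem s3 56 = 64 + M + c" "rmem s3 13 = rmem s2 13" "\<And>a. 64 \<le> a \<Longrightarrow> nmem s3 a = nmem s2 a"
            "\<And>a. 64 \<le> a \<Longrightarrow> rmem s3 a = rmem s2 a"
            "rmem s3 11 = elem_sum (agree \<omega> x t) J i' e + agree \<omega> x t i' * elem_sum (agree \<omega> x t) J i' (e - 1)" for s3
            using that S Suc by (simp add: R2_def v)
          have e0: "0 < e" using True by simp
          show ?thesis
          proof -
            consider "i' \<in> x" "bitv (fst (\<omega> (tmax + t))) i' = 0" | "i' \<in> x" "bitv (fst (\<omega> (tmax + t))) i' = 1"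
              | "i' \<notin> x" "bitv (fst (\<omega> (tmax + t))) i' = 0" | "i' \<notin> x" "bitv (fst (\<omega> (tmax + t))) i' = 1"
              using bv by metis
            then show ?thesis
            proof cases
              case 1
              then show ?thesis
                using mW adW cW(2)
                by (simp add: S(1-8,11,12) e0 br2 nm nm' pp(1) rm) (rule goal; simp add: S(1-8,11,12) br2 ag rm[unfolded add.assoc])
            next
              case 2
              then show ?thesis
                using mW adW cW(2)
                by (simp add: S(1-8,11,12) e0 br2 nm nm' pp(1) rm) (rule goal; simp add: S(1-8,11,12) br2 ag rm[unfolded add.assoc])
            next
              case 3
              then show ?thesis
                using mW adW cW(2)
                by (simp add: S(1-8,11,12) e0 br2 nm nm' pp(1) rm) (rule goal; simp add: S(1-8,11,12) br2 ag rm[unfolded add.assoc])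
            next
              case 4
              then show ?thesis
                using mW adW cW(2)
                by (simp add: S(1-8,11,12) e0 br2 nm nm' pp(1) rm) (rule goal; simp add: S(1-8,11,12) br2 ag rm[unfolded add.assoc])
            qed
          qed
        qed
        have "vc \<omega> W D (If (NLess 31 53) (Seq (block [NSub 58 55 1, NAdd 59 24 58, NLoad 60 59])
            (If (NLess 31 60)
              (Seq (block [ReadBit 61 58, NAdd 62 19 54, NMul 62 62 22, NAdd 62 62 58, NAdd 62 62 25, NLoad 62 62,
                 NSub 57 57 1, RLoad 12 57, NSub 58 61 62, NSub 59 62 61, NAdd 58 58 59])
               (If (NLess 31 58) (block [RSub 11 11 12]) (block [RAdd 11 11 12]))) Skip)) Skip) R2 s2"
          if asm: "R1 s2 \<and> nmem s2 57 = 64 + M + c' \<and> rmem s2 11 = elem_sum (agree \<omega> x t) J i' e" for s2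
        proof -
          have "base s2" "nmem s2 53 = e" using asm by (simp_all add: R1_def)
          then show ?thesis
            using add[OF asm] conjunct1[OF True] by (simp only: vc.simps(4) holds.simps base_regs if_True)
        qed
        then have "vc \<omega> W D kernel_step R2 s1"
          unfolding kernel_step_def by (rule vc_Seq[OF lo])
        then show ?thesis
          using Suc by (simp only: vc.simps(4) holds.simps R(6) br1 zero_less_Suc if_True)
      qed
    qed
  qed
  have 3: "vc \<omega> W D (Seq (block [RStore 56 11])
    (Seq (If (NLess 55 0) Skip (block [NAdd 57 25 19, NAdd 57 57 54, RLoad 12 57, RMul 12 12 11, RAdd 13 13 12]))
      (block [NAdd 51 51 1]))) (eval_inv \<omega> J x (Suc c)) s2" if "R2 s2" for s2
  proof -
    have R: "base s2" "point s2 = x" "nmem s2 51 = c" "nmem s2 54 = t" "nmem s2 55 = i"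
      "nmem s2 56 = 64 + M + c" "rmem s2 11 = v" "rmem s2 13 = rmem st 13" "\<And>a. 64 \<le> a \<Longrightarrow> nmem s2 a = nmem st a" "\<And>a. 64 \<le> a \<Longrightarrow> rmem s2 a = rmem st a"
      using that by (simp_all add: R2_def)
    note br2 = base_regs[OF R(1)]
    have fin: "eval_inv \<omega> J x (Suc c) s3"
      if "base s3" "point s3 = x" "nmem s3 51 = Suc c" "\<And>a. 64 \<le> a \<Longrightarrow> nmem s3 a = nmem st a"
        "\<And>a. 64 \<le> a \<Longrightarrow> rmem s3 a = (if a = 64 + M + c then v else rmem st a)"
        "rmem s3 13 = rmem st 13 + (if i = n then snd (\<omega> (tmax + t)) * v else 0)" for s3
      using that I tab by (auto simp: eval_inv_def data_def less_Suc_eq)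
    have tmM: "tmax + t < M" using tM by (simp add: M_def)
    have lab: "rmem st (64 + tmax + t) = snd (\<omega> (tmax + t))"
      using I(2) tmM by (simp add: data_def add.assoc)
    have tW: "64 + tmax \<le> W" "64 + tmax + t \<le> W" using tmM W_ge(17) by linarith+
    have ne: "64 + tmax + t \<noteq> 64 + M + c" using tmM by simp
    show ?thesis
    proof (cases "i < n")
      case True
      then show ?thesis using cW by (simp add: R br2) (rule fin; simp add: R br2)
    next
      case False
      then have "i = n" using bt by simp
      then show ?thesis using cW tW ne lab by (simp add: R br2) (rule fin; simp add: R br2)
    qed
  qed
  show ?thesis
    unfolding eval_body_def by (rule vc_Seq[OF 1 vc_Seq[OF 2 3]])
qed

text \<open>The kernel form of a low-degree polynomial. Instead of one estimate for each of up to
  \<open>NN\<close> sets, whose listing would need a further enumeration, the sum over all sets is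
  taken inside each example, where the elementary symmetric polynomials compute it in time
  polynomial in \<open>n\<close> and \<open>d\<close>.\<close>

definition eval_result :: "(nat \<Rightarrow> nat set \<times> real) \<Rightarrow> nat set \<Rightarrow> nat set \<Rightarrow> real" where
  "eval_result \<omega> J x = (\<Sum>t<M2. snd (\<omega> (tmax + t)) * (\<Sum>e\<le>d. elem_sum (agree \<omega> x t) J n e)) / real M2"

lemma sum_contribution: "(\<Sum>c<L. contribution \<omega> J x c)
  = (\<Sum>t<M2. snd (\<omega> (tmax + t)) * (\<Sum>e\<le>d. elem_sum (agree \<omega> x t) J n e))"
proof -
  have grp: "(\<Sum>c<a * v. g c) = (\<Sum>i<a. \<Sum>j<v. g (i * v + j))" for a v :: nat and g :: "nat \<Rightarrow> real"
  proof (induction a)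
    case (Suc a)
    have "(\<Sum>c<Suc a * v. g c) = (\<Sum>c<a * v. g c) + (\<Sum>c = a * v..<Suc a * v. g c)"
      by (subst sum.atLeastLessThan_concat[of 0 "a * v" "Suc a * v", symmetric, unfolded atLeast0LessThan]) auto
    also have "(\<Sum>c = a * v..<Suc a * v. g c) = (\<Sum>j<v. g (a * v + j))"
      using sum.shift_bounds_nat_ivl[of g 0 "a * v" v] by (simp add: atLeast0LessThan add.commute)
    finally show ?case using Suc by simp
  qed simp
  have "(\<Sum>c<L. contribution \<omega> J x c)
      = (\<Sum>t<M2. \<Sum>i<n + 1. \<Sum>e<d + 1. contribution \<omega> J x ((t * (n + 1) + i) * (d + 1) + e))"
    unfolding L_def grp ..
  also have "\<dots> = (\<Sum>t<M2. \<Sum>i<n + 1. if i = n then \<Sum>e<d + 1. snd (\<omega> (tmax + t)) * elem_sum (agree \<omega> x t) J i e else 0)"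
  proof (intro sum.cong refl)
    fix t i assume "i \<in> {..<n + 1}"
    then have "(\<Sum>e<d + 1. contribution \<omega> J x ((t * (n + 1) + i) * (d + 1) + e))
        = (\<Sum>e<d + 1. if i = n then snd (\<omega> (tmax + t)) * elem_sum (agree \<omega> x t) J i e else 0)"
      by (intro sum.cong refl table_coords(2)) auto
    then show "(\<Sum>e<d + 1. contribution \<omega> J x ((t * (n + 1) + i) * (d + 1) + e))
        = (if i = n then \<Sum>e<d + 1. snd (\<omega> (tmax + t)) * elem_sum (agree \<omega> x t) J i e else 0)"
      by (simp split: if_splits)
  qed
  also have "\<dots> = (\<Sum>t<M2. snd (\<omega> (tmax + t)) * (\<Sum>e\<le>d. elem_sum (agree \<omega> x t) J n e))"
    by (simp add: sum_distrib_left lessThan_Suc_atMost)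
  finally show ?thesis .
qed

definition evaluator_time :: nat where
  "evaluator_time = 10 + ((L * (tm eval_body + 3) + 2) + 10 + 1) + 1"

lemma evaluator_wp:
  assumes "ok W D st" "find_inv \<omega> c st" "snd (snd ((micro \<omega> ^^ c) (0, 0, {}))) = J"
  shows "wp \<omega>' W D evaluator evaluator_time (\<lambda>s'. rmem s' 0 = eval_result \<omega> J x) (st\<lparr>point := x, label := 0\<rparr>)"
proof -
  let ?st = "st\<lparr>point := x, label := 0\<rparr>"
  have I: "base st" "data \<omega> st" "\<forall>i<n. nmem st (64 + M * w + i) = (if i \<in> J then 1 else 0)"
    using assms(2,3) by (auto simp: find_inv_def split: prod.splits)
  then have I': "base ?st" "data \<omega> ?st" by (simp_all add: base_def data_def regs_def)
  have ok': "ok W D ?st" using assms(1) by (simp add: ok_def)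
  \<comment> \<open>An oracle-free program reads nothing from its stream. So
    \<open>eval_body_vc\<close>, where \<omega> is the training sample left in memory, holds for
    execution on any stream \<open>\<omega>'\<close>.\<close>
  have vc\<omega>: "vc \<omega>' W D c Q s = vc \<omega> W D c Q s" if "oracle_free c" for c Q s
    using that
  proof (induction c arbitrary: Q s)
    case (Instr i)
    then show ?case by (cases i) auto
  next
    case (Seq c d)
    then have "vc \<omega>' W D d Q = vc \<omega> W D d Q" by auto
    then show ?case using Seq by auto
  qed auto
  have init: "wp \<omega>' W D (block [NConst 51 0, ROfN 13 31]) 10 (eval_inv \<omega> J x 0) ?st"
    by (rule wp_block[OF ok']) (use I I' in \<open>auto simp: eval_inv_def base_regs[OF I(1)] data_def\<close>)
  have loop: "wp \<omega>' W D (While (NLess 51 30) eval_body) (L * (tm eval_body + 3) + 2) (eval_inv \<omega> J x L) s1"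
    if "ok W D s1" "eval_inv \<omega> J x 0 s1" for s1
  proof (rule wp_While[where I = "eval_inv \<omega> J x", OF _ _ that])
    fix i st assume i: "i < L" "ok W D st" "eval_inv \<omega> J x i st"
    have of: "oracle_free eval_body" by (simp add: eval_body_def kernel_step_def)
    show "holds (NLess 51 30) st \<and> wp \<omega>' W D eval_body (tm eval_body) (eval_inv \<omega> J x (Suc i)) st"
      using vc_wp[OF i(2), of \<omega>' eval_body] eval_body_vc[OF i(1,3)] i by (auto simp: vc\<omega>[OF of] eval_inv_def base_regs)
  qed (auto simp: eval_inv_def base_regs)
  have final: "wp \<omega>' W D (block [ROfN 12 17, RDiv 0 13 12]) 10 (\<lambda>s'. rmem s' 0 = eval_result \<omega> J x) s2"
    if "ok W D s2" "eval_inv \<omega> J x L s2" for s2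
    by (rule wp_block[OF that(1)]) (use that in \<open>auto simp: eval_inv_def base_regs eval_result_def sum_contribution\<close>)
  show ?thesis
    unfolding evaluator_def evaluator_time_def by (rule wp_Seq[OF init wp_Seq[OF loop final]])
qed

end

section \<open>Concentration for independent samples\<close>

context
  fixes D :: "'a pmf" and A :: "nat set" and \<phi> :: "'a \<Rightarrow> real" and dflt :: 'a
  assumes finD: "finite (set_pmf D)" and finA: "finite A"
begin

abbreviation \<Omega> :: "(nat \<Rightarrow> 'a) pmf" where "\<Omega> \<equiv> Pi_pmf A dflt (\<lambda>_. D)"

lemma finite_set_Omega: "finite (set_pmf \<Omega>)"
  using finD finA by (simp add: set_Pi_pmf finite_PiE_dflt)

lemma integrable_Omega: "integrable \<Omega> (g :: (nat \<Rightarrow> 'a) \<Rightarrow> real)"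
  by (rule integrable_measure_pmf_finite[OF finite_set_Omega])

lemma expectation_affine:
  "measure_pmf.expectation \<Omega> (\<lambda>\<omega>. g \<omega> / c - e * h \<omega> + b)
    = measure_pmf.expectation \<Omega> g / c - e * measure_pmf.expectation \<Omega> h + (b :: real)"
  by (simp add: integrable_Omega)

lemma component_in_support: "\<omega> \<in> set_pmf \<Omega> \<Longrightarrow> i \<in> A \<Longrightarrow> \<omega> i \<in> set_pmf D"
  using finA by (auto simp: set_Pi_pmf PiE_dflt_def)

lemma expectation_component:
  assumes "i \<in> A"
  shows "measure_pmf.expectation \<Omega> (\<lambda>\<omega>. g (\<omega> i)) = measure_pmf.expectation D (g :: 'a \<Rightarrow> real)"
proof -
  have "measure_pmf.expectation D g = measure_pmf.expectation (map_pmf (\<lambda>\<omega>. \<omega> i) \<Omega>) g"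
    using assms by (simp add: Pi_pmf_component[OF finA])
  then show ?thesis by simp
qed

lemma indep_components:
  assumes "T \<subseteq> A"
  shows "prob_space.indep_vars \<Omega> (\<lambda>_. borel) (\<lambda>i \<omega>. \<phi> (\<omega> i)) T"
proof -
  have "prob_space.indep_vars \<Omega> (\<lambda>_. borel) (\<lambda>i \<omega>. \<phi> (\<omega> i)) A"
    by (rule prob_space.indep_vars_compose2[OF measure_pmf.prob_space_axioms indep_vars_Pi_pmf[OF finA]]) simp
  then show ?thesis
    by (rule prob_space.indep_vars_subset[OF measure_pmf.prob_space_axioms]) (rule assms)
qed

lemma hoeffding_samples:
  assumes "T \<subseteq> A" "T \<noteq> {}" "\<And>z. z \<in> set_pmf D \<Longrightarrow> \<bar>\<phi> z\<bar> \<le> 1" "0 \<le> \<delta>"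
  defines "ave \<equiv> measure_pmf.expectation D \<phi>"
  shows "measure_pmf.prob \<Omega> {\<omega>. real (card T) * ave + \<delta> \<le> (\<Sum>i\<in>T. \<phi> (\<omega> i))} \<le> exp (- \<delta>\<^sup>2 / (2 * real (card T)))"
    and "measure_pmf.prob \<Omega> {\<omega>. (\<Sum>i\<in>T. \<phi> (\<omega> i)) \<le> real (card T) * ave - \<delta>} \<le> exp (- \<delta>\<^sup>2 / (2 * real (card T)))"
proof -
  have finT: "finite T" using assms(1) finA finite_subset by blast
  interpret Hoeffding_ineq \<Omega> T "\<lambda>i \<omega>. \<phi> (\<omega> i)" "\<lambda>_. -1" "\<lambda>_. 1" "\<Sum>i\<in>T. measure_pmf.expectation \<Omega> (\<lambda>\<omega>. \<phi> (\<omega> i))"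
  proof (unfold_locales, goal_cases)
    case 1 show ?case by (rule finT)
  next
    case 2 show ?case by (rule indep_components[OF assms(1)])
  next
    case (3 i)
    then show ?case
      using assms(1,3) component_in_support by (intro AE_pmfI) (auto simp: abs_le_iff)
  qed simp
  have ave: "(\<Sum>i\<in>T. measure_pmf.expectation \<Omega> (\<lambda>\<omega>. \<phi> (\<omega> i))) = real (card T) * ave"
    using assms(1) expectation_component[of _ \<phi>] by (simp add: ave_def subset_iff)
  have ws: "(\<Sum>i\<in>T. (1 - (-1))\<^sup>2 :: real) = 4 * card T" by simp
  have pos: "0 < card T" using finT assms(2) by (simp add: card_gt_0_iff)
  have e: "- 2 * \<delta>\<^sup>2 / (4 * real (card T)) = - \<delta>\<^sup>2 / (2 * real (card T))" by (simp add: field_simps)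
  show "measure_pmf.prob \<Omega> {\<omega>. real (card T) * ave + \<delta> \<le> (\<Sum>i\<in>T. \<phi> (\<omega> i))} \<le> exp (- \<delta>\<^sup>2 / (2 * real (card T)))"
    using Hoeffding_ineq_ge[OF assms(4)] pos unfolding ave ws e by simp
  show "measure_pmf.prob \<Omega> {\<omega>. (\<Sum>i\<in>T. \<phi> (\<omega> i)) \<le> real (card T) * ave - \<delta>} \<le> exp (- \<delta>\<^sup>2 / (2 * real (card T)))"
    using Hoeffding_ineq_le[OF assms(4)] pos unfolding ave ws e by simp
qed

text \<open>Distinct terms are uncorrelated, so only the diagonal contributes to the variance. A
  second moment suffices for the hypothesis: the squared errors of its coefficients are summed and
  handled by one Markov inequality, without a union bound over the sets.\<close>

lemma mean_square_deviation:
  assumes "T \<subseteq> A" "T \<noteq> {}" "\<And>z. z \<in> set_pmf D \<Longrightarrow> \<bar>\<phi> z\<bar> \<le> 1"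
  defines "\<mu> \<equiv> measure_pmf.expectation D \<phi>"
  shows "measure_pmf.expectation \<Omega> (\<lambda>\<omega>. ((\<Sum>i\<in>T. \<phi> (\<omega> i)) / card T - \<mu>)\<^sup>2) \<le> 1 / card T"
proof -
  have finT: "finite T" using assms(1) finA finite_subset by blast
  have pos: "0 < card T" using finT assms(2) by (simp add: card_gt_0_iff)
  have Phi: "measure_pmf.expectation \<Omega> (\<lambda>\<omega>. \<phi> (\<omega> i)) = \<mu>" if "i \<in> T" for i
    using that assms(1) expectation_component[of i \<phi>] by (auto simp: \<mu>_def)
  have cross: "measure_pmf.expectation \<Omega> (\<lambda>\<omega>. \<phi> (\<omega> i) * \<phi> (\<omega> j)) = \<mu> * \<mu>" if "i \<in> T" "j \<in> T" "i \<noteq> j" for i j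
  proof -
    have "measure_pmf.expectation \<Omega> (\<lambda>\<omega>. \<Prod>l\<in>{i, j}. \<phi> (\<omega> l)) = (\<Prod>l\<in>{i, j}. measure_pmf.expectation \<Omega> (\<lambda>\<omega>. \<phi> (\<omega> l)))"
      by (intro prob_space.indep_vars_lebesgue_integral[OF measure_pmf.prob_space_axioms] indep_components) (use that assms(1) in \<open>auto simp: integrable_Omega\<close>)
    then show ?thesis using that Phi by simp
  qed
  have diag: "measure_pmf.expectation \<Omega> (\<lambda>\<omega>. \<phi> (\<omega> i) * \<phi> (\<omega> i)) \<le> 1" if "i \<in> T" for i
  proof -
    have "measure_pmf.expectation \<Omega> (\<lambda>\<omega>. \<phi> (\<omega> i) * \<phi> (\<omega> i)) \<le> measure_pmf.expectation \<Omega> (\<lambda>_. 1)"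
    proof (rule integral_mono_AE)
      show "AE \<omega> in \<Omega>. \<phi> (\<omega> i) * \<phi> (\<omega> i) \<le> 1"
      proof (rule AE_pmfI)
        fix \<omega> assume "\<omega> \<in> set_pmf \<Omega>"
        then have "\<bar>\<phi> (\<omega> i)\<bar> \<le> 1" using that assms(1,3) component_in_support by blast
        then have "\<bar>\<phi> (\<omega> i)\<bar> * \<bar>\<phi> (\<omega> i)\<bar> \<le> 1 * 1" by (intro mult_mono) auto
        then show "\<phi> (\<omega> i) * \<phi> (\<omega> i) \<le> 1" by simp
      qed
    qed (simp_all add: integrable_Omega)
    then show ?thesis by simp
  qed
  let ?S = "\<lambda>\<omega>. \<Sum>i\<in>T. \<phi> (\<omega> i)"
  have S: "measure_pmf.expectation \<Omega> ?S = card T * \<mu>"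
    by (subst Bochner_Integration.integral_sum) (simp_all add: integrable_Omega Phi)
  have "measure_pmf.expectation \<Omega> (\<lambda>\<omega>. (?S \<omega>)\<^sup>2) = measure_pmf.expectation \<Omega> (\<lambda>\<omega>. \<Sum>i\<in>T. \<Sum>j\<in>T. \<phi> (\<omega> i) * \<phi> (\<omega> j))"
    by (simp add: power2_eq_square sum_product)
  also have "\<dots> = (\<Sum>i\<in>T. \<Sum>j\<in>T. measure_pmf.expectation \<Omega> (\<lambda>\<omega>. \<phi> (\<omega> i) * \<phi> (\<omega> j)))"
    by (simp add: integrable_Omega)
  also have "\<dots> \<le> (\<Sum>i\<in>T. \<Sum>j\<in>T. \<mu> * \<mu> + (if i = j then 1 else 0))"
  proof (intro sum_mono)
    fix i j assume ij: "i \<in> T" "j \<in> T"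
    show "measure_pmf.expectation \<Omega> (\<lambda>\<omega>. \<phi> (\<omega> i) * \<phi> (\<omega> j)) \<le> \<mu> * \<mu> + (if i = j then 1 else 0)"
    proof (cases "i = j")
      case True
      then have "measure_pmf.expectation \<Omega> (\<lambda>\<omega>. \<phi> (\<omega> i) * \<phi> (\<omega> j)) \<le> 1" using diag[OF ij(1)] by simp
      moreover have "0 \<le> \<mu> * \<mu>" by simp
      ultimately have "measure_pmf.expectation \<Omega> (\<lambda>\<omega>. \<phi> (\<omega> i) * \<phi> (\<omega> j)) \<le> \<mu> * \<mu> + 1" by linarith
      then show ?thesis by (simp only: True if_True simp_thms)
    qed (simp add: cross[OF ij])
  qed
  also have "\<dots> = (card T * \<mu>)\<^sup>2 + card T"
    using finT by (simp add: sum.distrib power2_eq_square algebra_simps)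
  finally have sq: "measure_pmf.expectation \<Omega> (\<lambda>\<omega>. (?S \<omega>)\<^sup>2) \<le> (card T * \<mu>)\<^sup>2 + card T" .
  have "measure_pmf.expectation \<Omega> (\<lambda>\<omega>. (?S \<omega> / card T - \<mu>)\<^sup>2)
      = measure_pmf.expectation \<Omega> (\<lambda>\<omega>. (?S \<omega>)\<^sup>2 / (card T)\<^sup>2 - 2 * \<mu> / card T * ?S \<omega> + \<mu>\<^sup>2)"
    by (intro Bochner_Integration.integral_cong refl) (simp add: power2_diff power_divide)
  also have "\<dots> = measure_pmf.expectation \<Omega> (\<lambda>\<omega>. (?S \<omega>)\<^sup>2) / (card T)\<^sup>2 - 2 * \<mu> / card T * (card T * \<mu>) + \<mu>\<^sup>2"
    unfolding expectation_affine S ..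
  also have "\<dots> \<le> ((card T * \<mu>)\<^sup>2 + card T) / (card T)\<^sup>2 - 2 * \<mu> / card T * (card T * \<mu>) + \<mu>\<^sup>2"
    using sq by (intro add_right_mono diff_right_mono divide_right_mono) auto
  also have "\<dots> = 1 / card T"
  proof -
    have "((c * e)\<^sup>2 + c) / c\<^sup>2 - 2 * e / c * (c * e) + e\<^sup>2 = 1 / c" if "0 < c" for c e :: real
      using that by (simp add: power2_eq_square field_simps)
    then show ?thesis using pos by simp
  qed
  finally show ?thesis .
qed

end

lemma markov_pmf:
  assumes "finite (set_pmf P)" "\<And>x. x \<in> set_pmf P \<Longrightarrow> 0 \<le> X x" "0 < c" "measure_pmf.expectation P X \<le> c * b"
  shows "measure_pmf.prob P {x. c \<le> X x} \<le> (b::real)"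
proof -
  have "measure_pmf.prob P {x\<in>space P. c \<le> X x} \<le> measure_pmf.expectation P X / c"
    by (rule integral_Markov_inequality_measure[where A = "{}"])
       (use assms in \<open>auto simp: integrable_measure_pmf_finite intro: AE_pmfI\<close>)
  also have "\<dots> \<le> b" using assms by (simp add: field_simps)
  finally show ?thesis by simp
qed

text \<open>A bound conditional on the first component integrates to the same bound. It is meant for
  a sample in two halves, where the first half selects the variables and the second estimates
  coefficients on them.\<close>

lemma prob_pair_le:
  assumes "\<And>a. a \<in> set_pmf p \<Longrightarrow> measure_pmf.prob q {b. R a b} \<le> c" "0 \<le> c"
  shows "measure_pmf.prob (pair_pmf p q) {(a, b). R a b} \<le> (c::real)"
proof -
  have "pair_pmf p q = bind_pmf p (\<lambda>a. map_pmf (Pair a) q)"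
    by (simp add: pair_pmf_def map_pmf_def)
  then have "emeasure (pair_pmf p q) {(a, b). R a b}
      = (\<integral>\<^sup>+ a. emeasure (map_pmf (Pair a) q) {(a, b). R a b} \<partial>p)"
    by (simp only: emeasure_bind_pmf)
  also have "\<dots> = (\<integral>\<^sup>+ a. emeasure q {b. R a b} \<partial>p)"
    by (simp add: emeasure_map_pmf vimage_def)
  also have "\<dots> \<le> (\<integral>\<^sup>+ a. ennreal c \<partial>p)"
    by (intro nn_integral_mono_AE AE_pmfI) (use assms in \<open>simp add: measure_pmf.emeasure_eq_measure\<close>)
  also have "\<dots> = ennreal c" by simp
  finally show ?thesis using assms(2) by (simp add: measure_pmf.emeasure_eq_measure)
qed

text \<open>From \<open>exp c \<ge> 1 + c\<close> the ratio \<open>x = exp (- c)\<close> satisfies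
  \<open>1 / (1 - x) \<le> 1 + 1 / c\<close>. The bound does not depend on the upper end
  \<open>b\<close>.\<close>

lemma geometric_tail:
  fixes c :: real
  assumes "0 < c"
  shows "(\<Sum>t = a..<b. exp (- (c * real t))) \<le> exp (- (c * real a)) * (1 + 1 / c)"
proof -
  define x where "x = exp (- c)"
  have x: "0 < x" "x < 1" using assms by (simp_all add: x_def)
  have pw: "exp (- (c * real t)) = x ^ t" for t
    by (simp add: x_def exp_of_nat_mult[symmetric] algebra_simps)
  have sum: "(1 - x) * (\<Sum>t = a..<b. x ^ t) \<le> x ^ a"
  proof (cases "a \<le> b")
    case True
    then have "(1 - x) * (\<Sum>t = a..<b. x ^ t) = x ^ a - x ^ b"
    proof (induction b rule: dec_induct)
      case (step b)
      have "(\<Sum>t = a..<Suc b. x ^ t) = (\<Sum>t = a..<b. x ^ t) + x ^ b"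
        by (rule sum.atLeastLessThan_Suc[OF step(1)])
      then have "(1 - x) * (\<Sum>t = a..<Suc b. x ^ t) = (1 - x) * (\<Sum>t = a..<b. x ^ t) + (1 - x) * x ^ b"
        by (simp only: distrib_left)
      also have "\<dots> = x ^ a - x ^ Suc b"
        unfolding step.IH by (simp add: left_diff_distrib)
      finally show ?case .
    qed simp
    moreover have "0 \<le> x ^ b" using x by simp
    ultimately show ?thesis by linarith
  qed (use x in simp)
  have "x * (1 + c) \<le> 1"
    using exp_ge_add_one_self[of c] unfolding x_def exp_minus by (simp add: field_simps)
  then have "1 \<le> (1 - x) * (1 + 1 / c)"
    using assms by (simp add: field_simps)
  then have "x ^ a * 1 \<le> x ^ a * ((1 - x) * (1 + 1 / c))"
    using x by (intro mult_left_mono) auto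
  then have "(1 - x) * (\<Sum>t = a..<b. x ^ t) \<le> (1 - x) * (x ^ a * (1 + 1 / c))"
    using sum by (simp only: mult.left_commute mult_1_right order_trans)
  then have "(\<Sum>t = a..<b. x ^ t) \<le> x ^ a * (1 + 1 / c)"
    by (rule mult_left_le_imp_le) (use x in simp)
  then show ?thesis by (simp only: pw)
qed

section \<open>Correctness with high probability\<close>

lemma finite_set_examples: "finite (set_pmf (examples n f))"
proof -
  have "set_pmf (pmf_of_set (Pow {..<n})) = Pow {..<n}" by (rule set_pmf_of_set) auto
  then show ?thesis by (simp add: examples_def cube_def)
qed

lemma set_examples: "z \<in> set_pmf (examples n f) \<Longrightarrow> fst z \<subseteq> {..<n} \<and> snd z = f (fst z)"
proof -
  have "set_pmf (pmf_of_set (Pow {..<n})) = Pow {..<n}" by (rule set_pmf_of_set) auto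
  then show "z \<in> set_pmf (examples n f) \<Longrightarrow> fst z \<subseteq> {..<n} \<and> snd z = f (fst z)"
    by (auto simp: examples_def cube_def)
qed

lemma expectation_examples: "measure_pmf.expectation (examples n f) g = uE {..<n} (\<lambda>x. g (x, f x))"
  unfolding examples_def cube_def integral_map_pmf
  by (subst integral_pmf_of_set) (auto simp: uE_eq_average card_Pow)

text \<open>\<open>Z\<close> is the length of the stream. It must cover the \<open>M\<close>
  examples but may be longer, since \<open>run_eq_map_stream\<close> reserves one position per
  machine step. \<open>dflt\<close> is the value of the stream outside these positions.\<close>

locale learning = learner_params n \<epsilon> k q l + unit_submodular "{..<n}" f
  for n \<epsilon> k q l f +
  fixes Z :: nat and dflt :: "nat set \<times> real"
  assumes Z: "learner_params.M k q l \<le> Z"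
begin

abbreviation V :: "nat set" where "V \<equiv> {..<n}"
abbreviation S\<Omega> :: "(nat \<Rightarrow> nat set \<times> real) pmf" where "S\<Omega> \<equiv> Pi_pmf {..<Z} dflt (\<lambda>_. examples n f)"

definition phi :: "nat \<Rightarrow> nat set \<times> real \<Rightarrow> real" where
  "phi p z = (if bitv (fst z) (p div w) \<noteq> bitv (fst z) (p mod w) then snd z else - snd z)"

definition mean :: "nat \<Rightarrow> real" where
  "mean p = measure_pmf.expectation (examples n f) (phi p)"

lemma stat_phi: "stat \<omega> p t = phi p (\<omega> t)"
  by (simp add: stat_def phi_def)

lemma abs_phi_le: "z \<in> set_pmf (examples n f) \<Longrightarrow> \<bar>phi p z\<bar> \<le> 1"
  using set_examples[of z] f_nonneg[of "fst z"] f_le_1[of "fst z"] by (auto simp: phi_def)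

lemma bitv_V: "A \<subseteq> V \<Longrightarrow> i \<le> n \<Longrightarrow> bitv A i = (if i \<in> A then 1 else 0)"
  by (simp add: bitv_def)

lemma coords: "j < w \<Longrightarrow> (i * w + j) div w = i" "j < w \<Longrightarrow> (i * w + j) mod w = j"
  by simp_all

lemma mean_pair:
  assumes "i < n" "j < n" "i \<noteq> j"
  shows "mean (i * w + j) = - fc V f {i, j}"
proof -
  have jw: "j < w" using assms by (simp add: w_def)
  have "phi (i * w + j) (x, f x) = - (f x * chi {i, j} x)" if "x \<subseteq> V" for x
    using assms bitv_V[OF that, of i] bitv_V[OF that, of j]
    by (simp add: phi_def coords[OF jw] jw chi_def Int_insert_left)
  then show ?thesis
    unfolding mean_def expectation_examples fc_def bE_minus[symmetric] by (rule bE_cong)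
qed

text \<open>A test that compares a column with itself always sees \<open>- f x\<close>. Its mean is
  never large, so the loop over all pairs can include the diagonal.\<close>

lemma mean_diag:
  assumes "i < n"
  shows "mean (i * w + i) \<le> 0"
proof -
  have iw: "i < w" using assms by (simp add: w_def)
  have "mean (i * w + i) = uE V (\<lambda>x. - f x)"
    unfolding mean_def expectation_examples by (rule bE_cong) (simp add: phi_def coords[OF iw] iw)
  also have "\<dots> \<le> uE V (\<lambda>_. 0)" using f_nonneg by (intro bE_mono) auto
  finally show ?thesis by (simp add: bE_const)
qed

lemma mean_single:
  assumes "i < n"
  shows "mean (i * w + n) = - fc V f {i}" "mean (i * w + Suc n) = fc V f {i}"
proof -
  have nw: "n < w" "Suc n < w" by (simp_all add: w_def)
  have "phi (i * w + n) (x, f x) = - (f x * chi {i} x)" "phi (i * w + Suc n) (x, f x) = f x * chi {i} x" if "x \<subseteq> V" for x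
    using assms that
    by (auto simp: phi_def coords[OF nw(1)] coords[OF nw(2)] nw chi_def Int_insert_left bitv_def simp del: add_Suc_right)
  then show "mean (i * w + n) = - fc V f {i}" "mean (i * w + Suc n) = fc V f {i}"
    unfolding mean_def expectation_examples fc_def bE_minus[symmetric] by (auto intro!: bE_cong)
qed

lemma less_np: "i < n \<Longrightarrow> j < w \<Longrightarrow> i * w + j < np"
  unfolding np_def by (rule less_mult_add)

lemma detectable:
  assumes "i < n" "\<tau> < \<bar>fc V f {i}\<bar> \<or> (\<exists>j\<in>V - {i}. \<tau> < \<bar>fc V f {i, j}\<bar>)"
  obtains p where "p < np" "p div w = i" "\<tau> < mean p"
proof -
  have w2: "n < w" "Suc n < w" by (simp_all add: w_def)
  consider (single) "\<tau> < \<bar>fc V f {i}\<bar>" | (pair) j where "j < n" "j \<noteq> i" "\<tau> < \<bar>fc V f {i, j}\<bar>"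
    using assms(2) by auto
  then show thesis
  proof cases
    case single
    show ?thesis
    proof (cases "0 \<le> fc V f {i}")
      case True
      then show ?thesis
        using single assms(1) w2 by (intro that[of "i * w + Suc n"]) (simp_all add: less_np mean_single coords del: add_Suc_right)
    next
      case False
      then show ?thesis
        using single assms(1) w2 by (intro that[of "i * w + n"]) (simp_all add: less_np mean_single coords)
    qed
  next
    case (pair j)
    then have "\<tau> < - fc V f {i, j}" "j < w" using fc_pair_nonpos[of i j] assms(1) by (auto simp: w_def)
    then show ?thesis
      using pair assms(1) by (intro that[of "i * w + j"]) (simp_all add: less_np mean_pair coords)
  qed
qed

text \<open>The tests that may run to the end. Between \<open>1 / (4 * r)\<close> and
  \<open>1 / r\<close> either outcome is harmless: an accepted test only enlarges a set for which
  \<open>structure_bound\<close> permits any superset of \<open>Q\<close>, and the tests vouching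
  for \<open>Q\<close> have means above \<open>1 / r\<close>.\<close>

definition large :: "nat set" where
  "large = {p. p < np \<and> 1 / (4 * real r) \<le> mean p}"

text \<open>By Parseval at most \<open>16 * r2\<close> coefficients are as large as
  \<open>1 / (4 * r)\<close>, and each one is examined by at most two tests: a pair in its two
  orders, a single variable with its two signs.\<close>

lemma card_large: "card large \<le> 32 * r2"
proof -
  define X where "X = {T \<in> Pow V. 1 / (4 * real r) \<le> \<bar>fc V f T\<bar>}"
  \<comment> \<open>The boolean records the order of the pair or the sign of the single test, which
    makes the map injective.\<close>
  define g where "g p = (if p mod w < n then ({p div w, p mod w}, p div w < p mod w) else ({p div w}, p mod w = n))" for p
  have r0: "0 < real r" using pos by simp
  have finX: "finite X" by (simp add: X_def)
  have form: "p div w < n" "p mod w < w" "p = (p div w) * w + p mod w" if "p \<in> large" for p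
    using that pos(13) by (simp_all add: large_def np_def less_mult_imp_div_less)
  have range: "p mod w < n \<or> p mod w = n \<or> p mod w = Suc n" if "p \<in> large" for p
    using form(2)[OF that] w_def by linarith
  have pos4: "0 < 1 / (4 * real r)" using r0 by simp
  have ne: "p mod w \<noteq> p div w" if p: "p \<in> large" for p
  proof
    assume e: "p mod w = p div w"
    have "mean p \<le> 0" using mean_diag[OF form(1)[OF p]] form(3)[OF p] e by simp
    then show False using p pos4 by (simp add: large_def)
  qed
  have "g ` large \<subseteq> X \<times> UNIV"
  proof
    fix y assume "y \<in> g ` large"
    then obtain p where p: "p \<in> large" "y = g p" by auto
    note F = form[OF p(1)]
    have mu: "1 / (4 * real r) \<le> mean ((p div w) * w + p mod w)" using p(1) F(3) by (simp add: large_def)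
    consider "p mod w < n" | "p mod w = n" | "p mod w = Suc n" using range[OF p(1)] by metis
    then show "y \<in> X \<times> UNIV"
    proof cases
      case 1
      then show ?thesis using mu mean_pair[OF F(1) 1] ne[OF p(1)] F p(2) by (auto simp: g_def X_def)
    next
      case 2
      then show ?thesis using mu mean_single(1)[OF F(1)] F p(2) by (auto simp: g_def X_def)
    next
      case 3
      then show ?thesis using mu mean_single(2)[OF F(1)] F p(2) by (auto simp: g_def X_def)
    qed
  qed
  moreover have "inj_on g large"
  proof (rule inj_onI)
    fix p p' assume p: "p \<in> large" and p': "p' \<in> large" and e: "g p = g p'"
    have "p div w = p' div w \<and> p mod w = p' mod w"
      using e ne[OF p] ne[OF p'] range[OF p] range[OF p']
      by (auto simp: g_def doubleton_eq_iff split: if_splits)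
    then show "p = p'" using form(3)[OF p] form(3)[OF p'] by metis
  qed
  ultimately have "card large \<le> card (X \<times> (UNIV :: bool set))"
    using finX by (intro card_inj_on_le) auto
  then have c: "card large \<le> 2 * card X" by (simp add: card_cartesian_product)
  have "real (card X) * (1 / (4 * real r))\<^sup>2 = (\<Sum>T\<in>X. (1 / (4 * real r))\<^sup>2)" by simp
  also have "\<dots> \<le> (\<Sum>T\<in>X. (fc V f T)\<^sup>2)"
  proof (rule sum_mono)
    fix T assume "T \<in> X"
    then have "(1 / (4 * real r))\<^sup>2 \<le> \<bar>fc V f T\<bar>\<^sup>2" using r0 by (intro power_mono) (auto simp: X_def)
    then show "(1 / (4 * real r))\<^sup>2 \<le> (fc V f T)\<^sup>2" by simp
  qed
  also have "\<dots> \<le> (\<Sum>T\<in>Pow V. (fc V f T)\<^sup>2)" by (rule sum_mono2) (auto simp: X_def)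
  also have "\<dots> = uE V (\<lambda>A. (f A)\<^sup>2)" by (rule parseval) simp
  also have "\<dots> \<le> uE V (\<lambda>_. 1)" using f_nonneg f_le_1 by (intro bE_mono) (auto simp: power_le_one)
  finally have "real (card X) \<le> 16 * real r2"
    using r0 by (simp add: bE_const r2_def power2_eq_square field_simps)
  then have "card X \<le> 16 * r2" by linarith
  then show ?thesis using c by linarith
qed

definition stop :: "(nat \<Rightarrow> nat set \<times> real) \<Rightarrow> nat \<Rightarrow> nat" where
  "stop \<omega> p = (LEAST t. \<not> continues \<omega> p t)"

lemma stop: "\<not> continues \<omega> p (stop \<omega> p)" "t < stop \<omega> p \<Longrightarrow> continues \<omega> p t" "stop \<omega> p \<le> tmax"
proof -
  have t: "\<not> continues \<omega> p tmax" by (simp add: continues_def)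
  then show "\<not> continues \<omega> p (stop \<omega> p)" "stop \<omega> p \<le> tmax"
    unfolding stop_def by (rule LeastI, rule Least_le)
  show "t < stop \<omega> p \<Longrightarrow> continues \<omega> p t" unfolding stop_def using not_less_Least by blast
qed

definition found :: "(nat \<Rightarrow> nat set \<times> real) \<Rightarrow> nat set" where
  "found \<omega> = {p div w |p. p < np \<and> stop \<omega> p = tmax}"

text \<open>The summand 1 is the round in which a test ends and the next one is set up.\<close>

lemma micro_run:
  "p \<le> np \<Longrightarrow> (micro \<omega> ^^ (\<Sum>p'<p. stop \<omega> p' + 1)) (0, 0, {}) = (p, 0, {p' div w |p'. p' < p \<and> stop \<omega> p' = tmax})"
proof (induction p)
  case (Suc p)
  let ?J = "{p' div w |p'. p' < p \<and> stop \<omega> p' = tmax}"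
  have inner: "t \<le> stop \<omega> p \<Longrightarrow> (micro \<omega> ^^ t) (p, 0, ?J) = (p, t, ?J)" for t
    using Suc.prems stop(2)[of _ \<omega> p] by (induction t) auto
  have split: "(\<Sum>p'<Suc p. stop \<omega> p' + 1) = Suc (stop \<omega> p + (\<Sum>p'<p. stop \<omega> p' + 1))" by simp
  have "(micro \<omega> ^^ (\<Sum>p'<Suc p. stop \<omega> p' + 1)) (0, 0, {})
      = micro \<omega> ((micro \<omega> ^^ stop \<omega> p) ((micro \<omega> ^^ (\<Sum>p'<p. stop \<omega> p' + 1)) (0, 0, {})))"
    by (simp only: split funpow.simps(2) funpow_add o_apply)
  also have "\<dots> = micro \<omega> (p, stop \<omega> p, ?J)"
    using Suc inner[of "stop \<omega> p"] by simp
  also have "\<dots> = (Suc p, 0, {p' div w |p'. p' < Suc p \<and> stop \<omega> p' = tmax})"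
    using Suc.prems stop(1,3)[of \<omega> p] by (auto simp: less_Suc_eq)
  finally show ?case .
qed simp

lemma micro_final:
  assumes "(\<Sum>p<np. stop \<omega> p + 1) \<le> cap"
  shows "snd (snd ((micro \<omega> ^^ cap) (0, 0, {}))) = found \<omega>"
proof -
  have fix': "(micro \<omega> ^^ t) (np, 0, J) = (np, 0, J)" for t J by (induction t) auto
  obtain t where t: "cap = t + (\<Sum>p<np. stop \<omega> p + 1)" using assms by (metis le_add_diff_inverse2)
  have "(micro \<omega> ^^ cap) (0, 0, {}) = (micro \<omega> ^^ t) ((micro \<omega> ^^ (\<Sum>p<np. stop \<omega> p + 1)) (0, 0, {}))"
    by (simp only: t funpow_add o_apply)
  also have "\<dots> = (np, 0, found \<omega>)" unfolding micro_run[OF order_refl] found_def by (rule fix')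
  finally show ?thesis by simp
qed

lemma found_V: "found \<omega> \<subseteq> V"
  by (auto simp: found_def np_def less_mult_imp_div_less)

lemma stat_sum_phi: "stat_sum \<omega> p t = (\<Sum>i<t. phi p (\<omega> i))"
  by (simp add: stat_sum_def stat_phi)

lemma tmax_le_Z: "tmax \<le> Z" "M \<le> Z"
  using Z by (simp_all add: M_def)

lemma r_pos: "0 < real r"
  using pos by simp

lemma r2_real: "real r2 = (real r)\<^sup>2"
  by (simp add: r2_def power2_eq_square)

lemma prob_large_stops:
  assumes "1 / real r < mean p" "0 < t" "t < tmax"
  shows "measure_pmf.prob S\<Omega> {\<omega>. stat_sum \<omega> p t * (2 * real r) < real t} \<le> exp (- (1 / (8 * real r2) * real t))"
proof -
  have "measure_pmf.prob S\<Omega> {\<omega>. stat_sum \<omega> p t * (2 * real r) < real t}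
      \<le> measure_pmf.prob S\<Omega> {\<omega>. (\<Sum>i\<in>{..<t}. phi p (\<omega> i)) \<le> real (card {..<t}) * measure_pmf.expectation (examples n f) (phi p) - real t / (2 * real r)}"
  proof (rule measure_pmf.finite_measure_mono)
    have "real t / (2 * real r) \<le> real t * mean p - real t / (2 * real r)"
      using mult_left_mono[of "1 / real r" "mean p" "real t"] assms(1) by (simp add: field_simps)
    then show "{\<omega>. stat_sum \<omega> p t * (2 * real r) < real t} \<subseteq> {\<omega>. (\<Sum>i\<in>{..<t}. phi p (\<omega> i)) \<le> real (card {..<t}) * measure_pmf.expectation (examples n f) (phi p) - real t / (2 * real r)}"
      using r_pos by (auto simp: stat_sum_phi mean_def field_simps)
  qed simp
  also have "\<dots> \<le> exp (- (real t / (2 * real r))\<^sup>2 / (2 * real (card {..<t})))"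
    using assms tmax_le_Z r_pos abs_phi_le by (intro hoeffding_samples(2) finite_set_examples) auto
  also have "- (real t / (2 * real r))\<^sup>2 / (2 * real (card {..<t})) = - (1 / (8 * real r2) * real t)"
    using assms r_pos by (simp add: r2_real power2_eq_square field_simps)
  finally show ?thesis .
qed

lemma prob_small_continues:
  assumes "mean p < 1 / (4 * real r)" "0 < t" "t < tmax" "B0 \<le> t"
  shows "measure_pmf.prob S\<Omega> {\<omega>. continues \<omega> p t} \<le> exp (- (1 / (32 * real r2) * real t))"
proof -
  have "measure_pmf.prob S\<Omega> {\<omega>. continues \<omega> p t}
      \<le> measure_pmf.prob S\<Omega> {\<omega>. real (card {..<t}) * measure_pmf.expectation (examples n f) (phi p) + real t / (4 * real r) \<le> (\<Sum>i\<in>{..<t}. phi p (\<omega> i))}"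
  proof (rule measure_pmf.finite_measure_mono)
    have "real t * mean p + real t / (4 * real r) \<le> real t / (2 * real r)"
      using mult_left_mono[of "mean p" "1 / (4 * real r)" "real t"] assms(1) by (simp add: field_simps)
    then show "{\<omega>. continues \<omega> p t} \<subseteq> {\<omega>. real (card {..<t}) * measure_pmf.expectation (examples n f) (phi p) + real t / (4 * real r) \<le> (\<Sum>i\<in>{..<t}. phi p (\<omega> i))}"
    proof safe
      fix \<omega> assume "continues \<omega> p t"
      then have "real t / (2 * real r) \<le> (\<Sum>i<t. phi p (\<omega> i))"
        using r_pos assms(4) by (simp add: continues_def stat_sum_phi divide_le_eq)
      then show "real (card {..<t}) * measure_pmf.expectation (examples n f) (phi p) + real t / (4 * real r) \<le> (\<Sum>i\<in>{..<t}. phi p (\<omega> i))"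
        using \<open>real t * mean p + real t / (4 * real r) \<le> real t / (2 * real r)\<close> by (simp add: mean_def)
    qed
  qed simp
  also have "\<dots> \<le> exp (- (real t / (4 * real r))\<^sup>2 / (2 * real (card {..<t})))"
    using assms tmax_le_Z r_pos abs_phi_le by (intro hoeffding_samples(1) finite_set_examples) auto
  also have "- (real t / (4 * real r))\<^sup>2 / (2 * real (card {..<t})) = - (1 / (32 * real r2) * real t)"
    using assms r_pos by (simp add: r2_real power2_eq_square field_simps)
  finally show ?thesis .
qed

lemma exp_minus_le_inverse: "0 < x \<Longrightarrow> exp (- x) \<le> 1 / (x :: real)"
proof -
  assume "0 < x"
  moreover have "x \<le> exp x" using exp_ge_add_one_self[of x] by linarith
  ultimately show ?thesis by (simp add: exp_minus field_simps)
qed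

text \<open>The geometric tail from \<open>B0\<close> on is independent of \<open>tmax\<close>,
  hence of \<open>n\<close>. \<open>B0\<close> is chosen so that the bound is of order
  \<open>1 / s\<close>, small enough for a union over at most \<open>s\<close> relevant
  variables.\<close>

lemma prob_rejects_large:
  assumes "1 / real r < mean p"
  shows "measure_pmf.prob S\<Omega> {\<omega>. stop \<omega> p < tmax} \<le> 9 / (320 * real s)"
proof -
  let ?c = "1 / (8 * real r2)"
  have r2: "1 \<le> real r2" using pos by (simp add: Suc_le_eq)
  have s0: "0 < real s" using pos by simp
  have "{\<omega>. stop \<omega> p < tmax} \<subseteq> (\<Union>t\<in>{B0..<tmax}. {\<omega>. stat_sum \<omega> p t * (2 * real r) < real t})"
  proof
    fix \<omega> assume "\<omega> \<in> {\<omega>. stop \<omega> p < tmax}"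
    then have "B0 \<le> stop \<omega> p" "stat_sum \<omega> p (stop \<omega> p) * (2 * real r) < real (stop \<omega> p)" "stop \<omega> p < tmax"
      using stop(1)[of \<omega> p] by (auto simp: continues_def)
    then show "\<omega> \<in> (\<Union>t\<in>{B0..<tmax}. {\<omega>. stat_sum \<omega> p t * (2 * real r) < real t})" by auto
  qed
  then have "measure_pmf.prob S\<Omega> {\<omega>. stop \<omega> p < tmax}
      \<le> measure_pmf.prob S\<Omega> (\<Union>t\<in>{B0..<tmax}. {\<omega>. stat_sum \<omega> p t * (2 * real r) < real t})"
    by (intro measure_pmf.finite_measure_mono) auto
  also have "\<dots> \<le> (\<Sum>t = B0..<tmax. measure_pmf.prob S\<Omega> {\<omega>. stat_sum \<omega> p t * (2 * real r) < real t})"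
    by (intro measure_pmf.finite_measure_subadditive_finite) auto
  also have "\<dots> \<le> (\<Sum>t = B0..<tmax. exp (- (?c * real t)))"
    using pos(11) by (intro sum_mono prob_large_stops[OF assms]) auto
  also have "\<dots> \<le> exp (- (?c * real B0)) * (1 + 1 / ?c)"
    using r2 by (intro geometric_tail) simp
  also have "?c * real B0 = 320 * (real s * real r2)"
    using r2 by (simp add: B0_def field_simps)
  also have "exp (- (320 * (real s * real r2))) * (1 + 1 / ?c) \<le> 1 / (320 * (real s * real r2)) * (9 * real r2)"
    using r2 s0 by (intro mult_mono exp_minus_le_inverse) auto
  also have "\<dots> = 9 / (320 * real s)" using r2 by simp
  finally show ?thesis .
qed

text \<open>The expected length of a small test does not involve \<open>n\<close>. This is what
  keeps a factor log n out of the running time, although \<open>tmax\<close> contains it.\<close>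

lemma expected_stop_small:
  assumes "mean p < 1 / (4 * real r)"
  shows "measure_pmf.expectation S\<Omega> (\<lambda>\<omega>. real (stop \<omega> p + 1)) \<le> real (r2 * 64 + B0 + 1)"
proof -
  let ?c = "1 / (32 * real r2)"
  have r2: "1 \<le> real r2" using pos by (simp add: Suc_le_eq)
  note int = integrable_Omega[OF finite_set_examples finite_lessThan]
  have le: "real (stop \<omega> p + 1) \<le> real (B0 + 1) + (\<Sum>t = B0..<tmax. indicator {\<omega>. continues \<omega> p t} \<omega>)" for \<omega>
  proof -
    have "{..<stop \<omega> p} \<subseteq> {..<B0} \<union> {t\<in>{B0..<tmax}. continues \<omega> p t}"
    proof
      fix t assume t: "t \<in> {..<stop \<omega> p}"
      then have "continues \<omega> p t" using stop(2) by simp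
      then show "t \<in> {..<B0} \<union> {t\<in>{B0..<tmax}. continues \<omega> p t}" by (auto simp: continues_def)
    qed
    then have "card {..<stop \<omega> p} \<le> card ({..<B0} \<union> {t\<in>{B0..<tmax}. continues \<omega> p t})"
      by (intro card_mono) auto
    also have "\<dots> \<le> card {..<B0} + card {t\<in>{B0..<tmax}. continues \<omega> p t}" by (rule card_Un_le)
    finally have "stop \<omega> p \<le> B0 + card {t\<in>{B0..<tmax}. continues \<omega> p t}" by simp
    moreover have "(\<Sum>t = B0..<tmax. indicator {\<omega>. continues \<omega> p t} \<omega>) = real (card {t\<in>{B0..<tmax}. continues \<omega> p t})"
      by (simp add: indicator_def sum.If_cases Int_def)
    ultimately show ?thesis by simp
  qed
  have "measure_pmf.expectation S\<Omega> (\<lambda>\<omega>. real (stop \<omega> p + 1))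
      \<le> measure_pmf.expectation S\<Omega> (\<lambda>\<omega>. real (B0 + 1) + (\<Sum>t = B0..<tmax. indicator {\<omega>. continues \<omega> p t} \<omega>))"
    by (rule integral_mono[OF int int le])
  also have "\<dots> = real (B0 + 1) + (\<Sum>t = B0..<tmax. measure_pmf.prob S\<Omega> {\<omega>. continues \<omega> p t})"
    by (simp add: int)
  also have "\<dots> \<le> real (B0 + 1) + (\<Sum>t = B0..<tmax. exp (- (?c * real t)))"
    using pos(11) by (intro add_left_mono sum_mono prob_small_continues[OF assms]) auto
  also have "\<dots> \<le> real (B0 + 1) + exp (- (?c * real B0)) * (1 + 1 / ?c)"
    using r2 by (intro add_left_mono geometric_tail) simp
  also have "\<dots> \<le> real (B0 + 1) + 1 * (1 + 1 / ?c)"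
    by (intro add_left_mono mult_right_mono) auto
  also have "\<dots> \<le> real (r2 * 64 + B0 + 1)" using r2 by simp
  finally show ?thesis .
qed

text \<open>Here all \<open>np\<close> tests enter a union bound, which is why \<open>tmax\<close>
  grows with \<open>l\<close>. The last round a surviving test must pass is \<open>tmax - 1\<close>,
  where it fails to stop with probability at most \<open>exp (- (2 * l + 6))\<close>, while
  \<open>np\<close> is at most \<open>4 ^ l\<close>.\<close>

lemma prob_accepts_small:
  "measure_pmf.prob S\<Omega> {\<omega>. \<exists>p<np. p \<notin> large \<and> stop \<omega> p = tmax} \<le> 1 / 20"
proof -
  have r2: "1 \<le> real r2" using pos by (simp add: Suc_le_eq)
  have "B0 < tmax" using pos(6) by (simp add: tmax_def)
  then have B: "B0 \<le> tmax - 1" "0 < tmax - 1" "tmax - 1 < tmax" using pos(11) by linarith+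
  have "{\<omega>. \<exists>p<np. p \<notin> large \<and> stop \<omega> p = tmax} \<subseteq> (\<Union>p\<in>{..<np} - large. {\<omega>. continues \<omega> p (tmax - 1)})"
  proof
    fix \<omega> assume "\<omega> \<in> {\<omega>. \<exists>p<np. p \<notin> large \<and> stop \<omega> p = tmax}"
    then obtain p where "p < np" "p \<notin> large" "stop \<omega> p = tmax" by auto
    moreover from this have "continues \<omega> p (tmax - 1)" using B(3) by (intro stop(2)) simp
    ultimately show "\<omega> \<in> (\<Union>p\<in>{..<np} - large. {\<omega>. continues \<omega> p (tmax - 1)})" by auto
  qed
  then have "measure_pmf.prob S\<Omega> {\<omega>. \<exists>p<np. p \<notin> large \<and> stop \<omega> p = tmax}
      \<le> measure_pmf.prob S\<Omega> (\<Union>p\<in>{..<np} - large. {\<omega>. continues \<omega> p (tmax - 1)})"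
    by (intro measure_pmf.finite_measure_mono) auto
  also have "\<dots> \<le> (\<Sum>p\<in>{..<np} - large. measure_pmf.prob S\<Omega> {\<omega>. continues \<omega> p (tmax - 1)})"
    by (intro measure_pmf.finite_measure_subadditive_finite) auto
  also have "\<dots> \<le> (\<Sum>p\<in>{..<np} - large. exp (- (1 / (32 * real r2) * real (tmax - 1))))"
    using B by (intro sum_mono prob_small_continues) (auto simp: large_def)
  also have "\<dots> \<le> real np * exp (- (1 / (32 * real r2) * real (tmax - 1)))"
  proof -
    have "card ({..<np} - large) \<le> card {..<np}" by (intro card_mono) auto
    then show ?thesis by (simp add: mult_right_mono)
  qed
  also have "\<dots> \<le> real np * exp (- real (2 * l + 6))"
  proof -
    have "(2 * l + 6) * 32 * r2 \<le> tmax - 1" using pos(11) by (simp add: tmax_def mult.commute)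
    then have "real ((2 * l + 6) * 32 * r2) \<le> real (tmax - 1)" by (simp only: of_nat_le_iff)
    then have "real (2 * l + 6) * (32 * real r2) \<le> real (tmax - 1)"
      by (simp only: of_nat_mult of_nat_numeral mult.assoc)
    then have "real (2 * l + 6) \<le> real (tmax - 1) / (32 * real r2)"
      using r2 by (subst le_divide_eq) auto
    then have "exp (- (1 / (32 * real r2) * real (tmax - 1))) \<le> exp (- real (2 * l + 6))"
      by (simp only: exp_le_cancel_iff neg_le_iff_le times_divide_eq_left mult_1_left)
    then show ?thesis by (rule mult_left_mono) simp
  qed
  also have "\<dots> \<le> 1 / 20"
  proof -
    have two: "2 \<le> exp (1::real)" using exp_ge_add_one_self[of 1] by simp
    have "(2::real) ^ (2 * l + 6) \<le> exp 1 ^ (2 * l + 6)" using two by (intro power_mono) auto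
    also have "\<dots> = exp (real (2 * l + 6))" by (simp only: exp_of_nat_mult[symmetric] mult.right_neutral)
    finally have e: "(2::real) ^ (2 * l + 6) \<le> exp (real (2 * l + 6))" .
    have "n + 1 \<le> 2 ^ l" using l_large by simp
    then have "(n + 1) * (n + 1) \<le> 2 ^ l * 2 ^ l" by (rule mult_le_mono) fact
    moreover have "np \<le> (n + 1) * (n + 1)" by (simp add: np_def w_def)
    ultimately have "real np \<le> real (2 ^ l * 2 ^ l)" by linarith
    also have "\<dots> = 2 ^ (2 * l + 6) / 64"
    proof -
      have "2 * l + 6 = l + l + 6" by simp
      then have "(2::real) ^ (2 * l + 6) = 2 ^ l * 2 ^ l * 2 ^ 6" by (simp only: power_add)
      then show ?thesis by simp
    qed
    also have "\<dots> \<le> exp (real (2 * l + 6)) / 64" by (rule divide_right_mono[OF e]) simp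
    finally have "real np * exp (- real (2 * l + 6)) \<le> exp (real (2 * l + 6)) / 64 * exp (- real (2 * l + 6))"
      by (rule mult_right_mono) simp
    also have "\<dots> = 1 / 64" unfolding exp_minus by (simp del: of_nat_add of_nat_mult)
    finally show ?thesis by simp
  qed
  finally show ?thesis .
qed

text \<open>The few large tests are charged \<open>tmax + 1\<close> rounds each with certainty, the
  others their expectation with Markov at twenty times the mean; \<open>cap\<close> covers both.
  Dependence between tests is harmless for the expectation of a sum.\<close>

lemma prob_budget_exceeded:
  "measure_pmf.prob S\<Omega> {\<omega>. cap < (\<Sum>p<np. stop \<omega> p + 1)} \<le> 1 / 20"
proof (cases "n = 0")
  case True
  have "np = 0" unfolding np_def using True by simp
  then show ?thesis by simp
next
  case False
  then have np0: "0 < np" by (simp add: np_def w_def)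
  note int = integrable_Omega[OF finite_set_examples finite_lessThan]
  let ?X = "\<lambda>\<omega>. \<Sum>p\<in>{..<np} - large. real (stop \<omega> p + 1)"
  define a where "a = real ((r2 * 64 + B0 + 1) * np)"
  have a0: "0 < a" unfolding a_def of_nat_0_less_iff using np0 by simp
  have sub: "{\<omega>. cap < (\<Sum>p<np. stop \<omega> p + 1)} \<subseteq> {\<omega>. 20 * a \<le> ?X \<omega>}"
  proof
    fix \<omega> assume "\<omega> \<in> {\<omega>. cap < (\<Sum>p<np. stop \<omega> p + 1)}"
    then have c: "cap < (\<Sum>p<np. stop \<omega> p + 1)" by simp
    have "(\<Sum>p<np. stop \<omega> p + 1) = (\<Sum>p\<in>{..<np} - large. stop \<omega> p + 1) + (\<Sum>p\<in>large. stop \<omega> p + 1)"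
      by (rule sum.subset_diff) (auto simp: large_def)
    also have "(\<Sum>p\<in>large. stop \<omega> p + 1) \<le> (\<Sum>p\<in>large. tmax + 1)"
      using stop(3) by (intro sum_mono) simp
    also have "\<dots> = card large * (tmax + 1)" by simp
    also have "\<dots> \<le> 32 * r2 * (tmax + 1)" by (intro mult_right_mono card_large) simp
    finally have "cap < (\<Sum>p\<in>{..<np} - large. stop \<omega> p + 1) + 32 * r2 * (tmax + 1)" using c by linarith
    then have "(r2 * 64 + B0 + 1) * np * 20 \<le> (\<Sum>p\<in>{..<np} - large. stop \<omega> p + 1)"
      unfolding cap_def by (simp add: distrib_right)
    then have "real ((r2 * 64 + B0 + 1) * np * 20) \<le> real (\<Sum>p\<in>{..<np} - large. stop \<omega> p + 1)"
      by (simp only: of_nat_le_iff)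
    then show "\<omega> \<in> {\<omega>. 20 * a \<le> ?X \<omega>}" by (simp add: a_def mult.commute)
  qed
  have "measure_pmf.expectation S\<Omega> ?X = (\<Sum>p\<in>{..<np} - large. measure_pmf.expectation S\<Omega> (\<lambda>\<omega>. real (stop \<omega> p + 1)))"
    by (rule Bochner_Integration.integral_sum) (rule int)
  also have "\<dots> \<le> (\<Sum>p\<in>{..<np} - large. real (r2 * 64 + B0 + 1))"
    by (intro sum_mono expected_stop_small) (auto simp: large_def)
  also have "\<dots> \<le> (\<Sum>p<np. real (r2 * 64 + B0 + 1))" by (intro sum_mono2) auto
  also have "\<dots> = a" by (simp only: a_def sum_constant card_lessThan of_nat_mult mult.commute)
  also have "\<dots> = 20 * a * (1 / 20)" by simp
  finally have E: "measure_pmf.expectation S\<Omega> ?X \<le> 20 * a * (1 / 20)" .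
  have "measure_pmf.prob S\<Omega> {\<omega>. cap < (\<Sum>p<np. stop \<omega> p + 1)} \<le> measure_pmf.prob S\<Omega> {\<omega>. 20 * a \<le> ?X \<omega>}"
    by (intro measure_pmf.finite_measure_mono sub) simp
  also have "\<dots> \<le> 1 / 20"
    using a0 by (intro markov_pmf finite_set_Omega finite_set_examples finite_lessThan E) (auto intro: sum_nonneg)
  finally show ?thesis .
qed

end

section \<open>Estimation of the low-degree coefficients\<close>

context learner_params
begin

lemma elem_sum_eq:
  "elem_sum \<sigma> J i e = (\<Sum>S | S \<subseteq> J \<inter> {..<i} \<and> card S = e. \<Prod>j\<in>S. \<sigma> j)"
proof (induction i arbitrary: e)
  case 0
  have "{S. S \<subseteq> J \<inter> {..<0} \<and> card S = e} = (if e = 0 then {{}} else {})" by auto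
  then show ?case by simp
next
  case (Suc i)
  let ?P = "\<lambda>i e. {S. S \<subseteq> J \<inter> {..<i} \<and> card S = e}"
  have fin: "finite (?P i e)" for i e by (rule finite_subset[of _ "Pow {..<i}"]) auto
  have finS: "finite S" if "S \<in> ?P i e" for S i e using that by (auto intro: finite_subset)
  show ?case
  proof (cases "i \<in> J \<and> 0 < e")
    case False
    have "?P (Suc i) e = ?P i e"
    proof -
      have "S \<subseteq> J \<inter> {..<i}" if "S \<subseteq> J \<inter> {..<Suc i}" "card S = e" for S
      proof -
        have "finite S" using that by (auto intro: finite_subset)
        then have "i \<notin> S" using False that by (auto simp: card_eq_0_iff)
        then show ?thesis using that by (auto simp: less_Suc_eq)
      qed
      then show ?thesis by auto
    qed
    then show ?thesis using False Suc.IH[of e] by auto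
  next
    case True
    have split: "?P (Suc i) e = ?P i e \<union> insert i ` ?P i (e - 1)"
    proof (intro equalityI subsetI)
      fix S assume S: "S \<in> ?P (Suc i) e"
      show "S \<in> ?P i e \<union> insert i ` ?P i (e - 1)"
      proof (cases "i \<in> S")
        case True
        then have "S - {i} \<in> ?P i (e - 1)" "S = insert i (S - {i})"
          using S finS[OF S] by (auto simp: less_Suc_eq)
        then show ?thesis by blast
      next
        case False
        then show ?thesis using S by (auto simp: less_Suc_eq)
      qed
    next
      fix S assume "S \<in> ?P i e \<union> insert i ` ?P i (e - 1)"
      then show "S \<in> ?P (Suc i) e"
      proof
        assume "S \<in> insert i ` ?P i (e - 1)"
        then obtain T where T: "T \<in> ?P i (e - 1)" "S = insert i T" by auto
        then have "i \<notin> T" by auto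
        then show ?thesis using T finS[OF T(1)] True by (auto simp: less_Suc_eq)
      qed (auto simp: less_Suc_eq)
    qed
    have inj: "inj_on (insert i) (?P i (e - 1))"
    proof (rule inj_onI)
      fix T T' assume "T \<in> ?P i (e - 1)" "T' \<in> ?P i (e - 1)" "insert i T = insert i T'"
      moreover from this have "i \<notin> T" "i \<notin> T'" by auto
      ultimately show "T = T'" by (metis insert_ident)
    qed
    have "(\<Sum>S\<in>insert i ` ?P i (e - 1). prod \<sigma> S) = (\<Sum>T\<in>?P i (e - 1). prod \<sigma> (insert i T))"
      by (simp only: sum.reindex[OF inj] o_def)
    also have "\<dots> = (\<Sum>T\<in>?P i (e - 1). \<sigma> i * prod \<sigma> T)"
    proof (rule sum.cong[OF refl])
      fix T assume T: "T \<in> ?P i (e - 1)"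
      then have "i \<notin> T" by auto
      then show "prod \<sigma> (insert i T) = \<sigma> i * prod \<sigma> T" using finS[OF T] by simp
    qed
    finally have "(\<Sum>S\<in>insert i ` ?P i (e - 1). prod \<sigma> S) = \<sigma> i * elem_sum \<sigma> J i (e - 1)"
      by (simp add: sum_distrib_left[symmetric] Suc.IH)
    moreover have "(\<Sum>S\<in>?P (Suc i) e. prod \<sigma> S) = (\<Sum>S\<in>?P i e. prod \<sigma> S) + (\<Sum>S\<in>insert i ` ?P i (e - 1). prod \<sigma> S)"
      unfolding split by (rule sum.union_disjoint) (auto simp: fin)
    ultimately show ?thesis using True Suc.IH[of e] by simp
  qed
qed

end

lemma chi_prod_left:
  assumes "finite S"
  shows "chi S x = (\<Prod>j\<in>S. if j \<in> x then -1 else 1)"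
proof -
  have "(\<Prod>j\<in>S. if j \<in> x then -1 else (1::real)) = (\<Prod>j\<in>S \<inter> x. -1)"
    using assms by (intro prod.mono_neutral_cong_right) auto
  then show ?thesis by (simp add: chi_def)
qed

text \<open>Pad an enumeration of the set with \<open>None\<close> to a list of length
  \<open>d\<close>; the set is recovered from the \<open>Some\<close> entries.\<close>

lemma card_small_subsets:
  assumes "finite J"
  shows "card {S. S \<subseteq> J \<and> card S \<le> d} \<le> (card J + 1) ^ d"
proof -
  let ?A = "insert None (Some ` J)"
  have "{S. S \<subseteq> J \<and> card S \<le> d} \<subseteq> (\<lambda>xs. {a. Some a \<in> set xs}) ` {xs. set xs \<subseteq> ?A \<and> length xs = d}"
  proof
    fix S assume S: "S \<in> {S. S \<subseteq> J \<and> card S \<le> d}"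
    then have "finite S" using assms finite_subset by blast
    then obtain ys where ys: "set ys = S" "distinct ys" using finite_distinct_list by blast
    let ?xs = "map Some ys @ replicate (d - length ys) None"
    have "length ys \<le> d" using ys S distinct_card by fastforce
    then have "set ?xs \<subseteq> ?A" "length ?xs = d" "S = {a. Some a \<in> set ?xs}"
      using ys S by auto
    then show "S \<in> (\<lambda>xs. {a. Some a \<in> set xs}) ` {xs. set xs \<subseteq> ?A \<and> length xs = d}" by blast
  qed
  then have "card {S. S \<subseteq> J \<and> card S \<le> d} \<le> card ((\<lambda>xs. {a. Some a \<in> set xs}) ` {xs. set xs \<subseteq> ?A \<and> length xs = d})"
    using assms by (intro card_mono finite_imageI finite_lists_length_eq) auto
  also have "\<dots> \<le> card {xs. set xs \<subseteq> ?A \<and> length xs = d}"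
    using assms by (intro card_image_le finite_lists_length_eq) auto
  also have "\<dots> = card ?A ^ d" using assms by (intro card_lists_length_eq) auto
  also have "card ?A = card J + 1" using assms by (simp add: card_image)
  finally show ?thesis .
qed

lemma fc_combination:
  assumes "finite V" "F \<subseteq> Pow V" "T \<subseteq> V"
  shows "fc V (\<lambda>x. f x - (\<Sum>S\<in>F. c S * chi S x)) T = fc V f T - (if T \<in> F then c T else 0)"
proof -
  have finF: "finite F" using assms finite_subset by blast
  have "fc V (\<lambda>x. f x - (\<Sum>S\<in>F. c S * chi S x)) T
      = uE V (\<lambda>x. f x * chi T x - (\<Sum>S\<in>F. c S * (chi S x * chi T x)))"
    unfolding fc_def by (rule bE_cong) (simp add: left_diff_distrib sum_distrib_right mult.assoc)
  also have "\<dots> = fc V f T - (\<Sum>S\<in>F. c S * (if S = T then 1 else 0))"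
  proof -
    have "uE V (\<lambda>x. chi S x * chi T x) = (if S = T then 1 else 0)" if "S \<in> F" for S
      by (rule uE_chi_chi) (use that assms in auto)
    then show ?thesis unfolding bE_diff bE_sum bE_cmult fc_def by simp
  qed
  also have "(\<Sum>S\<in>F. c S * (if S = T then 1 else 0)) = (if T \<in> F then c T else 0)"
    using finF by (simp add: if_distrib[of "times _"] sum.delta cong: if_cong)
  finally show ?thesis .
qed

text \<open>Parseval for the difference separates the error of the estimated coefficients from the
  weight of the omitted sets, the first being statistical and the second structural.\<close>

lemma square_error_split:
  assumes "finite V" "F \<subseteq> Pow V"
  shows "uE V (\<lambda>x. (f x - (\<Sum>S\<in>F. c S * chi S x))\<^sup>2)
    = (\<Sum>S\<in>F. (c S - fc V f S)\<^sup>2) + (\<Sum>S\<in>Pow V - F. (fc V f S)\<^sup>2)"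
proof -
  have "uE V (\<lambda>x. (f x - (\<Sum>S\<in>F. c S * chi S x))\<^sup>2) = (\<Sum>T\<in>Pow V. (fc V f T - (if T \<in> F then c T else 0))\<^sup>2)"
    unfolding parseval[OF assms(1), symmetric] using assms by (intro sum.cong refl) (simp add: fc_combination)
  also have "\<dots> = (\<Sum>T\<in>Pow V - F. (fc V f T - (if T \<in> F then c T else 0))\<^sup>2) + (\<Sum>T\<in>F. (fc V f T - (if T \<in> F then c T else 0))\<^sup>2)"
    using assms by (intro sum.subset_diff) auto
  also have "(\<Sum>T\<in>Pow V - F. (fc V f T - (if T \<in> F then c T else 0))\<^sup>2) = (\<Sum>S\<in>Pow V - F. (fc V f S)\<^sup>2)"
    by (intro sum.cong) auto
  also have "(\<Sum>T\<in>F. (fc V f T - (if T \<in> F then c T else 0))\<^sup>2) = (\<Sum>S\<in>F. (c S - fc V f S)\<^sup>2)"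
    by (intro sum.cong) (auto simp: power2_commute)
  finally show ?thesis by simp
qed

context learning
begin

definition low :: "nat set \<Rightarrow> nat set set" where
  "low J = {S. S \<subseteq> J \<and> card S \<le> d}"

definition est :: "(nat \<Rightarrow> nat set \<times> real) \<Rightarrow> nat set \<Rightarrow> real" where
  "est \<omega> S = (\<Sum>i\<in>{tmax..<M}. snd (\<omega> i) * chi S (fst (\<omega> i))) / real M2"

text \<open>The product of the agreement signs over \<open>S\<close> is \<open>chi S x\<close> times
  the character at the example, so exchanging the sums turns the kernel into estimated coefficients.
  The assumption on \<omega> makes the stored bits coincide with membership.\<close>

lemma eval_result_fourier:
  assumes J: "J \<subseteq> V" and x: "x \<subseteq> V" and \<omega>: "\<And>t. t < M \<Longrightarrow> fst (\<omega> t) \<subseteq> V"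
  shows "eval_result \<omega> J x = (\<Sum>S\<in>low J. est \<omega> S * chi S x)"
proof -
  have finJ: "finite J" using J finite_subset by blast
  have finlow: "finite (low J)" using finJ by (simp add: low_def)
  have ag: "prod (agree \<omega> x t) S = chi S x * chi S (fst (\<omega> (tmax + t)))" if "S \<subseteq> J" "t < M2" for S t
  proof -
    have finS: "finite S" using that finJ finite_subset by blast
    have "fst (\<omega> (tmax + t)) \<subseteq> V" using \<omega> that by (simp add: M_def)
    then have "agree \<omega> x t j = (if j \<in> x then -1 else 1) * (if j \<in> fst (\<omega> (tmax + t)) then -1 else 1)" if "j \<in> S" for j
      using that \<open>S \<subseteq> J\<close> J bitv_V[of "fst (\<omega> (tmax + t))" j] by (auto simp: agree_def)
    then show ?thesis by (simp add: chi_prod_left[OF finS] prod.distrib[symmetric])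
  qed
  have kernel: "(\<Sum>e\<le>d. elem_sum (agree \<omega> x t) J n e) = (\<Sum>S\<in>low J. chi S x * chi S (fst (\<omega> (tmax + t))))" if t: "t < M2" for t
  proof -
    have JV: "J \<inter> {..<n} = J" using J by auto
    have "(\<Sum>e\<le>d. elem_sum (agree \<omega> x t) J n e) = (\<Sum>e\<le>d. \<Sum>S | S \<in> low J \<and> card S = e. prod (agree \<omega> x t) S)"
      unfolding elem_sum_eq JV by (intro sum.cong) (auto simp: low_def)
    also have "\<dots> = (\<Sum>S\<in>low J. prod (agree \<omega> x t) S)"
      using finlow by (intro sum.group) (auto simp: low_def)
    also have "\<dots> = (\<Sum>S\<in>low J. chi S x * chi S (fst (\<omega> (tmax + t))))"
      using t by (intro sum.cong refl ag) (auto simp: low_def)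
    finally show ?thesis .
  qed
  have est: "est \<omega> S = (\<Sum>t<M2. snd (\<omega> (tmax + t)) * chi S (fst (\<omega> (tmax + t)))) / real M2" for S
    unfolding est_def M_def using sum.shift_bounds_nat_ivl[of "\<lambda>i. snd (\<omega> i) * chi S (fst (\<omega> i))" 0 tmax M2]
    by (simp add: atLeast0LessThan add.commute)
  have "eval_result \<omega> J x = (\<Sum>t<M2. \<Sum>S\<in>low J. snd (\<omega> (tmax + t)) * chi S (fst (\<omega> (tmax + t))) * chi S x) / real M2"
    unfolding eval_result_def by (simp add: kernel sum_distrib_left mult.commute mult.left_commute)
  also have "\<dots> = (\<Sum>S\<in>low J. est \<omega> S * chi S x)"
    unfolding est by (subst sum.swap) (simp add: sum_divide_distrib sum_distrib_right)
  finally show ?thesis .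
qed

definition est_error :: "(nat \<Rightarrow> nat set \<times> real) \<Rightarrow> nat set \<Rightarrow> real" where
  "est_error \<omega> J = (\<Sum>S\<in>low J. (est \<omega> S - fc V f S)\<^sup>2)"

lemma prob_est_error:
  assumes J: "J \<subseteq> V" "card J \<le> 32 * r2" and A: "finite A" "{tmax..<M} \<subseteq> A"
  shows "measure_pmf.prob (Pi_pmf A dflt (\<lambda>_. examples n f)) {\<omega>. 1 / (4 * real k3) \<le> est_error \<omega> J} \<le> 1 / 10"
proof -
  let ?P = "Pi_pmf A dflt (\<lambda>_. examples n f)"
  have finJ: "finite J" using J finite_subset by blast
  have k3: "0 < real k3" "0 < real M2" "0 < real NN" using pos by simp_all
  have cM: "card {tmax..<M} = M2" by (simp add: M_def)
  note int = integrable_Omega[OF finite_set_examples A(1)]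
  have one: "measure_pmf.expectation ?P (\<lambda>\<omega>. (est \<omega> S - fc V f S)\<^sup>2) \<le> 1 / real M2" if "S \<in> low J" for S
  proof -
    have "fc V f S = measure_pmf.expectation (examples n f) (\<lambda>z. snd z * chi S (fst z))"
      by (simp add: expectation_examples fc_def)
    moreover have "measure_pmf.expectation ?P (\<lambda>\<omega>. ((\<Sum>i\<in>{tmax..<M}. snd (\<omega> i) * chi S (fst (\<omega> i))) / real (card {tmax..<M})
        - measure_pmf.expectation (examples n f) (\<lambda>z. snd z * chi S (fst z)))\<^sup>2) \<le> 1 / real (card {tmax..<M})"
    proof (rule mean_square_deviation[OF finite_set_examples A, where \<phi> = "\<lambda>z. snd z * chi S (fst z)"])
      show "{tmax..<M} \<noteq> {}" using pos(10) by (simp add: M_def)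
      fix z assume "z \<in> set_pmf (examples n f)"
      then show "\<bar>snd z * chi S (fst z)\<bar> \<le> 1"
        using set_examples[of z] f_nonneg[of "fst z"] f_le_1[of "fst z"] by (auto simp: abs_mult)
    qed
    ultimately show ?thesis by (simp only: cM est_def)
  qed
  have card: "card (low J) \<le> NN"
  proof -
    have "card (low J) \<le> (card J + 1) ^ d" unfolding low_def by (rule card_small_subsets[OF finJ])
    also have "\<dots> \<le> u1 ^ d" using J(2) by (intro power_mono) (simp_all add: u1_def)
    finally show ?thesis by (simp add: NN_def)
  qed
  have "measure_pmf.expectation ?P (\<lambda>\<omega>. est_error \<omega> J) = (\<Sum>S\<in>low J. measure_pmf.expectation ?P (\<lambda>\<omega>. (est \<omega> S - fc V f S)\<^sup>2))"
    unfolding est_error_def by (rule Bochner_Integration.integral_sum) (rule int)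
  also have "\<dots> \<le> (\<Sum>S\<in>low J. 1 / real M2)" by (intro sum_mono one)
  also have "\<dots> \<le> real NN * (1 / real M2)"
    using card k3 by (simp add: divide_right_mono)
  \<comment> \<open>The factor 40 in \<open>M2\<close> makes the expected error one tenth of the
    threshold, as Markov needs.\<close>
  also have "\<dots> = 1 / (4 * real k3) * (1 / 10)"
    using k3 by (simp add: M2_def field_simps)
  finally show ?thesis
    using k3 by (intro markov_pmf finite_set_Omega finite_set_examples A(1)) (auto simp: est_error_def intro: sum_nonneg)
qed

text \<open>The found set depends on the first \<open>tmax\<close> examples and the estimates on
  later ones. Conditioned on the first block, the set is fixed and \<open>prob_est_error\<close>
  applies; the bound on its size is part of the event because the number of low-degree sets relies
  on it.\<close>

lemma prob_found_est_error:
  "measure_pmf.prob S\<Omega> {\<omega>. card (found \<omega>) \<le> 32 * r2 \<and> 1 / (4 * real k3) \<le> est_error \<omega> (found \<omega>)} \<le> 1 / 10"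
proof -
  let ?A = "{..<tmax}" and ?B = "{tmax..<Z}"
  let ?h = "\<lambda>(f', g') x. if x \<in> ?A then f' x else g' x :: nat set \<times> real"
  have Z: "{..<Z} = ?A \<union> ?B" using tmax_le_Z(1) by auto
  have eq: "S\<Omega> = map_pmf ?h (pair_pmf (Pi_pmf ?A dflt (\<lambda>_. examples n f)) (Pi_pmf ?B dflt (\<lambda>_. examples n f)))"
    unfolding Z by (rule Pi_pmf_union) auto
  have found: "found (?h (a, b)) = found a" for a b
  proof -
    have "stat_sum (?h (a, b)) p t = stat_sum a p t" if "t \<le> tmax" for p t
      using that by (simp add: stat_sum_phi)
    then have "continues (?h (a, b)) p t = continues a p t" for p t
      by (cases "t < tmax") (simp_all add: continues_def)
    then show ?thesis by (simp add: found_def stop_def)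
  qed
  have est: "est_error (?h (a, b)) J = est_error b J" for a b J
    by (simp add: est_error_def est_def)
  have "measure_pmf.prob (pair_pmf (Pi_pmf ?A dflt (\<lambda>_. examples n f)) (Pi_pmf ?B dflt (\<lambda>_. examples n f)))
      {(a, b). card (found a) \<le> 32 * r2 \<and> 1 / (4 * real k3) \<le> est_error b (found a)} \<le> 1 / 10"
  proof (rule prob_pair_le)
    fix a
    show "measure_pmf.prob (Pi_pmf ?B dflt (\<lambda>_. examples n f))
      {b. card (found a) \<le> 32 * r2 \<and> 1 / (4 * real k3) \<le> est_error b (found a)} \<le> 1 / 10"
    proof (cases "card (found a) \<le> 32 * r2")
      case True
      then show ?thesis using prob_est_error[OF found_V True, of ?B] tmax_le_Z(2) by simp
    qed simp
  qed simp
  moreover have "?h -` {\<omega>. card (found \<omega>) \<le> 32 * r2 \<and> 1 / (4 * real k3) \<le> est_error \<omega> (found \<omega>)}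
      = {(a, b). card (found a) \<le> 32 * r2 \<and> 1 / (4 * real k3) \<le> est_error b (found a)}"
    using found est by auto
  ultimately show ?thesis unfolding eq measure_map_pmf by simp
qed

text \<open>The reason for \<open>m = q * 2 + 10\<close>: the truncation error
  \<open>m\<^sup>2 / 2 ^ m\<close> in \<open>degree_tail\<close> must not exceed
  \<open>1 / k\<close>, and \<open>2 ^ q\<close> already absorbs \<open>k\<close>.\<close>

lemma m_power: "m * m * k \<le> 2 ^ m"
proof -
  have "(q * 2 + 10) * (q * 2 + 10) \<le> (2::nat) ^ (q + 10)"
  proof (induction q)
    case (Suc q)
    have "(Suc q * 2 + 10) * (Suc q * 2 + 10) \<le> 2 * ((q * 2 + 10) * (q * 2 + 10))"
      by (simp add: algebra_simps)
    moreover have "(2::nat) ^ (Suc q + 10) = 2 * 2 ^ (q + 10)" by (simp only: add_Suc power_Suc)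
    ultimately show ?case using Suc by linarith
  qed simp
  then have "m * m * k \<le> 2 ^ (q + 10) * 2 ^ q"
    unfolding m_def by (rule mult_le_mono) (rule q_large)
  also have "\<dots> = 2 ^ m" by (simp add: m_def power_add[symmetric] mult_2_right add.commute add.left_commute)
  finally show ?thesis .
qed

lemma structure_bound:
  obtains Q where "Q \<subseteq> V" "card Q \<le> s" "\<And>i. i \<in> Q \<Longrightarrow> \<exists>p<np. p div w = i \<and> 1 / real r < mean p"
    and "\<And>F. Q \<subseteq> F \<Longrightarrow> (\<Sum>S | S \<subseteq> V \<and> \<not> (S \<subseteq> F \<and> card S \<le> d). (fc V f S)\<^sup>2)
      \<le> 3 / 4 * (1 / ((real k)\<^sup>2 * sqrt (real k)))"
proof -
  \<comment> \<open>With these choices \<open>4 * m / \<theta>\<close> is \<open>s\<close> and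
    \<open>5 * m * K\<close> is \<open>d\<close>. The junta term is a quarter of
    \<open>1 / k3\<close>, and the choice of \<open>r\<close> makes the term of undetected variables
    about another quarter. The ratio \<open>32 * m / K\<close> becomes \<open>16 / k\<close>, and
    \<open>m \<ge> 10\<close> brings the degree term below a fifth of k^(-5/2).\<close>
  define \<theta> where "\<theta> = 1 / (8 * real m * real k3)"
  define K where "K = 2 * m * k"
  have km: "1 \<le> real k" "10 \<le> real m" "0 < real m" "0 < real k3" using k_pos pos by (simp_all add: m_def)
  have \<theta>0: "0 < \<theta>" using km by (simp add: \<theta>_def)
  have m2': "2 \<le> m" "2 \<le> K"
  proof -
    show "2 \<le> m" by (simp add: m_def)
    have "2 * 1 * 1 \<le> 2 * m * k" using k_pos pos(1) by (intro mult_le_mono) auto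
    then show "2 \<le> K" by (simp add: K_def)
  qed
  have s: "4 * real m / \<theta> = real s"
    using km by (simp add: \<theta>_def s_def m2_def)
  have d: "5 * m * K = d" by (simp add: K_def d_def m2_def)
  obtain Q where Q: "Q \<subseteq> V" "real (card Q) \<le> 4 * real m / \<theta>"
    "\<And>i. i \<in> Q \<Longrightarrow> 1 / real r < \<bar>fc V f {i}\<bar> \<or> (\<exists>j\<in>V - {i}. 1 / real r < \<bar>fc V f {i, j}\<bar>)"
    "\<And>F. Q \<subseteq> F \<Longrightarrow> (\<Sum>S | S \<subseteq> V \<and> \<not> (S \<subseteq> F \<and> card S \<le> 5 * m * K). (fc V f S)\<^sup>2)
      \<le> 2 * \<theta> * real m + 4 * real m / \<theta> * (1 / real r * (1 / 2 + 4 * real m / \<theta>))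
        + (32 * sqrt (32 * real m / real K) + 512 * (real m)\<^sup>2 / 2 ^ m) / (8 * (real K)\<^sup>2)"
    using learnable_structure[OF m2' \<theta>0, of "1 / real r"] by auto
  define a where "a = (real k)\<^sup>2 * sqrt (real k)"
  have sk: "sqrt (real k) \<le> real k" "0 < sqrt (real k)" "sqrt (real k) * sqrt (real k) = real k"
    using km by (simp_all add: real_le_lsqrt sqrt_le_D real_sqrt_le_iff) (metis km(1) mult_le_cancel_left1 not_le order_trans real_sqrt_ge_one real_sqrt_mult_self zero_le_one abs_of_nonneg)
  have a0: "0 < a" using km sk by (simp add: a_def)
  have k3a: "a \<le> real k3" using sk km by (simp add: a_def k3_def power2_eq_square)
  have ik3: "1 / real k3 \<le> 1 / a" using a0 k3a by (simp add: frac_le)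
  have t1: "2 * \<theta> * real m = 1 / 4 * (1 / real k3)" using km by (simp add: \<theta>_def)
  have s1: "3200 \<le> real s"
  proof -
    have "10 * 10 * 1 \<le> m * m * k3" using pos(2) by (intro mult_le_mono) (simp_all add: m_def)
    then have "3200 \<le> s" unfolding s_def m2_def by linarith
    then show ?thesis by simp
  qed
  have t2: "real s * (1 / real r * (1 / 2 + real s)) \<le> 13 / 50 * (1 / real k3)"
  proof -
    have "real s * (1 / real r * (1 / 2 + real s)) = (1 / 2 + real s) / (4 * real s) * (1 / real k3)"
      using s1 km by (simp add: r_def field_simps)
    also have "\<dots> \<le> 13 / 50 * (1 / real k3)"
      using s1 km by (intro mult_right_mono) (simp_all add: divide_le_eq)
    finally show ?thesis .
  qed
  have t3: "(32 * sqrt (32 * real m / real K) + 512 * (real m)\<^sup>2 / 2 ^ m) / (8 * (real K)\<^sup>2) \<le> 1 / 5 * (1 / a)"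
  proof -
    have e: "32 * real m / real K = 16 / real k" using km by (simp add: K_def)
    have s16: "sqrt (16 / real k) = 4 / sqrt (real k)" using real_sqrt_unique[of 4 16] by (simp add: real_sqrt_divide)
    have "real (m * m * k) \<le> real (2 ^ m)" using m_power by (simp only: of_nat_le_iff)
    then have "(real m)\<^sup>2 * real k \<le> 2 ^ m" by (simp add: power2_eq_square)
    then have "(real m)\<^sup>2 / 2 ^ m \<le> 1 / real k" using km by (simp add: field_simps)
    also have "\<dots> \<le> 1 / sqrt (real k)" using sk by (intro divide_left_mono) auto
    finally have "512 * (real m)\<^sup>2 / 2 ^ m \<le> 512 * (1 / sqrt (real k))" by simp
    then have "32 * sqrt (32 * real m / real K) + 512 * (real m)\<^sup>2 / 2 ^ m \<le> 640 / sqrt (real k)"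
      unfolding e s16 by simp
    then have "(32 * sqrt (32 * real m / real K) + 512 * (real m)\<^sup>2 / 2 ^ m) / (8 * (real K)\<^sup>2) \<le> 640 / sqrt (real k) / (8 * (real K)\<^sup>2)"
      by (rule divide_right_mono) simp
    also have "\<dots> = 20 / (real m)\<^sup>2 * (1 / a)"
      using km sk by (simp add: K_def a_def power_mult_distrib field_simps)
    also have "\<dots> \<le> 1 / 5 * (1 / a)"
    proof (intro mult_right_mono)
      have "10 * 10 \<le> real m * real m" using km by (intro mult_mono) auto
      then show "20 / (real m)\<^sup>2 \<le> 1 / 5" using km by (simp add: power2_eq_square divide_le_eq)
    qed (use a0 in simp)
    finally show ?thesis .
  qed
  show thesis
  proof (rule that[OF Q(1)])
    show "card Q \<le> s" using Q(2) unfolding s by simp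
    show "\<exists>p<np. p div w = i \<and> 1 / real r < mean p" if "i \<in> Q" for i
      using detectable[of i "1 / real r"] Q(3)[OF that] that Q(1) by blast
    fix F assume F: "Q \<subseteq> F"
    have "(\<Sum>S | S \<subseteq> V \<and> \<not> (S \<subseteq> F \<and> card S \<le> d). (fc V f S)\<^sup>2)
        \<le> 1 / 4 * (1 / real k3) + 13 / 50 * (1 / real k3) + 1 / 5 * (1 / a)"
      using Q(4)[OF F] t2 t3 unfolding d s t1 by linarith
    also have "\<dots> \<le> 3 / 4 * (1 / a)"
    proof -
      have "0 < 1 / a" using a0 by simp
      then show ?thesis using ik3 by linarith
    qed
    finally show "(\<Sum>S | S \<subseteq> V \<and> \<not> (S \<subseteq> F \<and> card S \<le> d). (fc V f S)\<^sup>2)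
      \<le> 3 / 4 * (1 / ((real k)\<^sup>2 * sqrt (real k)))" by (simp only: a_def)
  qed
qed

definition success :: "(nat \<Rightarrow> nat set \<times> real) \<Rightarrow> bool" where
  "success \<omega> \<longleftrightarrow> l2_norm n (\<lambda>x. f x - eval_result \<omega> (snd (snd ((micro \<omega> ^^ cap) (0, 0, {})))) x) \<le> \<epsilon>"

lemma l2_norm_uE: "l2_norm n g = sqrt (uE V (\<lambda>x. (g x)\<^sup>2))"
  unfolding l2_norm_def cube_def by (subst integral_pmf_of_set) (auto simp: uE_eq_average card_Pow)

text \<open>Failure has four causes: a relevant variable is rejected, a small test is accepted, the
  budget runs out, or the estimates are off. Their probabilities, at most 9/320, 1/20, 1/20 and
  1/10, add up to less than 1/3.\<close>

theorem success_probability: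
  assumes \<epsilon>: "0 < \<epsilon>"
  shows "2 / 3 \<le> measure_pmf.prob S\<Omega> {\<omega>. success \<omega>}"
proof -
  obtain Q where Q: "Q \<subseteq> V" "card Q \<le> s" "\<And>i. i \<in> Q \<Longrightarrow> \<exists>p<np. p div w = i \<and> 1 / real r < mean p"
    "\<And>F. Q \<subseteq> F \<Longrightarrow> (\<Sum>S | S \<subseteq> V \<and> \<not> (S \<subseteq> F \<and> card S \<le> d). (fc V f S)\<^sup>2)
      \<le> 3 / 4 * (1 / ((real k)\<^sup>2 * sqrt (real k)))"
    using structure_bound by blast
  have finQ: "finite Q" using Q(1) finite_subset by blast
  \<comment> \<open>One detecting test per relevant variable is enough, so the union bound has only
    \<open>card Q\<close> terms.\<close>
  obtain \<pi> where \<pi>: "\<And>i. i \<in> Q \<Longrightarrow> \<pi> i < np \<and> \<pi> i div w = i \<and> 1 / real r < mean (\<pi> i)"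
    using Q(3) by metis
  define E1 where "E1 = {\<omega>. \<exists>i\<in>Q. stop \<omega> (\<pi> i) < tmax}"
  define E2 where "E2 = {\<omega>. \<exists>p<np. p \<notin> large \<and> stop \<omega> p = tmax}"
  define E3 where "E3 = {\<omega>. cap < (\<Sum>p<np. stop \<omega> p + 1)}"
  define E4 where "E4 = {\<omega>. card (found \<omega>) \<le> 32 * r2 \<and> 1 / (4 * real k3) \<le> est_error \<omega> (found \<omega>)}"
  have s0: "0 < real s" using pos by simp
  have "E1 = (\<Union>i\<in>Q. {\<omega>. stop \<omega> (\<pi> i) < tmax})" by (auto simp: E1_def)
  then have "measure_pmf.prob S\<Omega> E1 \<le> (\<Sum>i\<in>Q. measure_pmf.prob S\<Omega> {\<omega>. stop \<omega> (\<pi> i) < tmax})"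
    using finQ by (simp add: measure_pmf.finite_measure_subadditive_finite)
  also have "\<dots> \<le> (\<Sum>i\<in>Q. 9 / (320 * real s))" using \<pi> by (intro sum_mono prob_rejects_large) auto
  also have "\<dots> = real (card Q) * (9 / (320 * real s))" by simp
  also have "\<dots> \<le> real s * (9 / (320 * real s))" using Q(2) by (intro mult_right_mono) auto
  also have "\<dots> = 9 / 320" using s0 by simp
  finally have p1: "measure_pmf.prob S\<Omega> E1 \<le> 9 / 320" .
  have "measure_pmf.prob S\<Omega> (E1 \<union> E2 \<union> E3 \<union> E4)
      \<le> measure_pmf.prob S\<Omega> E1 + measure_pmf.prob S\<Omega> E2 + measure_pmf.prob S\<Omega> E3 + measure_pmf.prob S\<Omega> E4"
    using measure_Un_le[of "E1 \<union> E2 \<union> E3" S\<Omega> E4] measure_Un_le[of "E1 \<union> E2" S\<Omega> E3]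
      measure_Un_le[of E1 S\<Omega> E2] by simp
  also have "\<dots> \<le> 1 / 3"
    using p1 prob_accepts_small prob_budget_exceeded prob_found_est_error unfolding E2_def E3_def E4_def by linarith
  finally have bad: "measure_pmf.prob S\<Omega> (E1 \<union> E2 \<union> E3 \<union> E4) \<le> 1 / 3" .
  have "success \<omega>" if \<omega>: "\<omega> \<in> set_pmf S\<Omega>" "\<omega> \<notin> E1 \<union> E2 \<union> E3 \<union> E4" for \<omega>
  proof -
    let ?J = "found \<omega>"
    have J: "snd (snd ((micro \<omega> ^^ cap) (0, 0, {}))) = ?J"
      using \<omega>(2) by (intro micro_final) (simp add: E3_def)
    have QJ: "Q \<subseteq> ?J"
    proof
      fix i assume i: "i \<in> Q"
      then have "stop \<omega> (\<pi> i) = tmax" using \<omega>(2) stop(3)[of \<omega> "\<pi> i"] by (auto simp: E1_def)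
      then show "i \<in> ?J"
        unfolding found_def by (intro CollectI exI[of _ "\<pi> i"]) (use \<pi>[OF i] in auto)
    qed
    have "?J \<subseteq> (\<lambda>p. p div w) ` large" using \<omega>(2) by (auto simp: found_def E2_def)
    then have "card ?J \<le> card ((\<lambda>p. p div w) ` large)"
      by (intro card_mono finite_imageI) (auto simp: large_def)
    also have "\<dots> \<le> card large" by (rule card_image_le) (simp add: large_def)
    also have "\<dots> \<le> 32 * r2" by (rule card_large)
    finally have err: "est_error \<omega> ?J \<le> 1 / (4 * real k3)" using \<omega>(2) by (simp add: E4_def)
    have sup: "fst (\<omega> t) \<subseteq> V" if "t < M" for t
      using component_in_support[OF finite_set_examples finite_lessThan \<omega>(1), of t] that tmax_le_Z(2) set_examples by auto
    have "uE V (\<lambda>x. (f x - eval_result \<omega> ?J x)\<^sup>2) = uE V (\<lambda>x. (f x - (\<Sum>S\<in>low ?J. est \<omega> S * chi S x))\<^sup>2)"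
      by (rule bE_cong) (simp add: eval_result_fourier[OF found_V _ sup])
    also have "\<dots> = est_error \<omega> ?J + (\<Sum>S\<in>Pow V - low ?J. (fc V f S)\<^sup>2)"
      unfolding est_error_def by (rule square_error_split) (use found_V in \<open>auto simp: low_def\<close>)
    also have "Pow V - low ?J = {S. S \<subseteq> V \<and> \<not> (S \<subseteq> ?J \<and> card S \<le> d)}" by (auto simp: low_def)
    also have "est_error \<omega> ?J + (\<Sum>S\<in>{S. S \<subseteq> V \<and> \<not> (S \<subseteq> ?J \<and> card S \<le> d)}. (fc V f S)\<^sup>2)
        \<le> 1 / (4 * real k3) + 3 / 4 * (1 / ((real k)\<^sup>2 * sqrt (real k)))"
      by (intro add_mono err Q(4) QJ)
    also have "\<dots> \<le> \<epsilon>\<^sup>2"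
    proof -
      define a where "a = (real k)\<^sup>2 * sqrt (real k)"
      have k1: "1 \<le> real k" using k_pos by simp
      have a0: "0 < a" using k1 by (simp add: a_def)
      have "sqrt (real k) \<le> real k" using k1 by (simp add: real_le_lsqrt power2_eq_square)
      then have "a \<le> real k3" using k1 by (simp add: a_def k3_def power2_eq_square)
      then have "1 / (4 * real k3) \<le> 1 / (4 * a)" using a0 by (simp add: frac_le)
      moreover have "1 / (4 * a) + 3 / 4 * (1 / a) = 1 / a" using a0 by (simp add: field_simps)
      ultimately have "1 / (4 * real k3) + 3 / 4 * (1 / a) \<le> 1 / a" by linarith
      \<comment> \<open>As \<open>a\<close> is k^(5/2), the defining property of \<open>k\<close> is
        exactly that the square of \<open>\<epsilon>\<^sup>2 * a\<close> is at least 1.\<close>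
      also have "\<dots> \<le> \<epsilon>\<^sup>2"
      proof -
        have "1 \<le> real k ^ 5 * \<epsilon> ^ 4" by (rule k_large)
        also have "\<dots> = (\<epsilon>\<^sup>2 * a)\<^sup>2" using k1 by (simp add: a_def power_mult_distrib eval_nat_numeral)
        finally have "1\<^sup>2 \<le> (\<epsilon>\<^sup>2 * a)\<^sup>2" by simp
        then have "1 \<le> \<epsilon>\<^sup>2 * a" by (rule power2_le_imp_le) (use a0 in simp)
        then show ?thesis using a0 by (simp add: divide_le_eq)
      qed
      finally show ?thesis by (simp only: a_def)
    qed
    finally have "uE V (\<lambda>x. (f x - eval_result \<omega> ?J x)\<^sup>2) \<le> \<epsilon>\<^sup>2" .
    then show ?thesis
      unfolding success_def J l2_norm_uE using \<epsilon> by (simp add: real_le_lsqrt)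
  qed
  then have "measure_pmf.prob S\<Omega> (- {\<omega>. success \<omega>}) \<le> measure_pmf.prob S\<Omega> (E1 \<union> E2 \<union> E3 \<union> E4)"
    by (intro measure_pmf.finite_measure_mono_AE AE_pmfI) auto
  then have "measure_pmf.prob S\<Omega> (- {\<omega>. success \<omega>}) \<le> 1 / 3" using bad by linarith
  moreover have "measure_pmf.prob S\<Omega> (- {\<omega>. success \<omega>}) = 1 - measure_pmf.prob S\<Omega> {\<omega>. success \<omega>}"
    using measure_pmf.prob_compl[of "{\<omega>. success \<omega>}" S\<Omega>] by (simp add: Compl_eq_Diff_UNIV)
  ultimately show ?thesis by linarith
qed

end

section \<open>Resource bounds\<close>

definition least_k :: "real \<Rightarrow> nat" where
  "least_k \<epsilon> = (LEAST k. 1 \<le> k \<and> 1 \<le> real k ^ 5 * \<epsilon> ^ 4)"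

definition least_exp :: "nat \<Rightarrow> nat" where
  "least_exp k = (LEAST q. k \<le> 2 ^ q)"

lemma least_k:
  assumes "0 < \<epsilon>"
  shows "1 \<le> least_k \<epsilon>" "1 \<le> real (least_k \<epsilon>) ^ 5 * \<epsilon> ^ 4"
    and "1 \<le> k' \<Longrightarrow> k' < least_k \<epsilon> \<Longrightarrow> real k' ^ 5 * \<epsilon> ^ 4 < 1"
    and "1 \<le> k' \<Longrightarrow> 1 \<le> real k' ^ 5 * \<epsilon> ^ 4 \<Longrightarrow> least_k \<epsilon> \<le> k'"
proof -
  have e4: "0 < \<epsilon> ^ 4" using assms by simp
  obtain k0 :: nat where k0: "1 / \<epsilon> ^ 4 < real k0" using reals_Archimedean2 by blast
  then have "0 < real k0" using e4 by (meson less_trans zero_less_divide_1_iff)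
  then have k1: "1 \<le> real k0" by simp
  have "1 \<le> real k0 * \<epsilon> ^ 4" using k0 e4 by (simp add: field_simps)
  also have "\<dots> \<le> real k0 ^ 5 * \<epsilon> ^ 4"
    using k1 e4 self_le_power[of "real k0" 5] by (intro mult_right_mono) auto
  finally have ex: "1 \<le> k0 \<and> 1 \<le> real k0 ^ 5 * \<epsilon> ^ 4" using k1 by simp
  note L = LeastI[of "\<lambda>k. 1 \<le> k \<and> 1 \<le> real k ^ 5 * \<epsilon> ^ 4", OF ex, folded least_k_def]
  show "1 \<le> least_k \<epsilon>" "1 \<le> real (least_k \<epsilon>) ^ 5 * \<epsilon> ^ 4" using L by auto
  show "1 \<le> k' \<Longrightarrow> k' < least_k \<epsilon> \<Longrightarrow> real k' ^ 5 * \<epsilon> ^ 4 < 1"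
    using not_less_Least[of k' "\<lambda>k. 1 \<le> k \<and> 1 \<le> real k ^ 5 * \<epsilon> ^ 4"] by (auto simp: least_k_def)
  show "1 \<le> k' \<Longrightarrow> 1 \<le> real k' ^ 5 * \<epsilon> ^ 4 \<Longrightarrow> least_k \<epsilon> \<le> k'"
    unfolding least_k_def by (rule Least_le) simp
qed

lemma least_exp:
  "k \<le> 2 ^ least_exp k" "q' < least_exp k \<Longrightarrow> 2 ^ q' < k" "least_exp k \<le> k"
proof -
  have k: "k \<le> 2 ^ k" by (rule less_imp_le) (rule less_exp)
  show "k \<le> 2 ^ least_exp k" unfolding least_exp_def by (rule LeastI[of "\<lambda>q. k \<le> 2 ^ q", OF k])
  show "q' < least_exp k \<Longrightarrow> 2 ^ q' < k"
    using not_less_Least[of q' "\<lambda>q. k \<le> 2 ^ q"] by (auto simp: least_exp_def)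
  show "least_exp k \<le> k" unfolding least_exp_def by (rule Least_le) (rule k)
qed

lemma learner_params_least:
  "0 < \<epsilon> \<Longrightarrow> learner_params n \<epsilon> (least_k \<epsilon>) (least_exp (least_k \<epsilon>)) (least_exp (n + 1))"
  by unfold_locales (use least_k(1,2) least_k(3)[of \<epsilon>] least_exp(1)[of "n + 1"] least_exp(1)[of "least_k \<epsilon>"]
    least_exp(2)[where k = "n + 1"] least_exp(2)[where k = "least_k \<epsilon>"] in \<open>auto simp: Suc_le_eq less_Suc_eq_le\<close>)

definition growth :: "nat \<Rightarrow> nat" where
  "growth k = (least_exp k * 2 + 10) ^ 3 * k"

text \<open>Minimality gives \<open>k\<close> at most twice \<epsilon>^(-4/5), and \<open>q\<close>
  is at most four times ln(1/\<epsilon>), so the cube of \<open>m\<close> contributes the third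
  power of the logarithm. On \<epsilon> \<ge> \<delta> only finitely many values occur, because
  \<open>least_k\<close> cannot exceed \<open>least_k \<delta>\<close>.\<close>

lemma growth_soft_O: "(\<lambda>\<epsilon>. real (400 * growth (least_k \<epsilon>))) \<in> soft_O (\<lambda>\<epsilon>. 1 / \<epsilon> powr (4/5))"
proof -
  let ?g = "\<lambda>\<epsilon>. real (400 * growth (least_k \<epsilon>))"
  have "bounded (?g ` {\<delta>..})" if \<delta>: "0 < \<delta>" for \<delta>
  proof (rule finite_imp_bounded, rule finite_subset)
    show "?g ` {\<delta>..} \<subseteq> (\<lambda>k. real (400 * growth k)) ` {..least_k \<delta>}"
    proof
      fix y assume "y \<in> ?g ` {\<delta>..}"
      then obtain \<epsilon> where \<epsilon>: "\<delta> \<le> \<epsilon>" "y = ?g \<epsilon>" by auto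
      have "1 \<le> real (least_k \<delta>) ^ 5 * \<delta> ^ 4" by (rule least_k(2)[OF \<delta>])
      also have "\<dots> \<le> real (least_k \<delta>) ^ 5 * \<epsilon> ^ 4"
        using \<delta> \<epsilon> by (intro mult_left_mono power_mono) auto
      finally have "least_k \<epsilon> \<le> least_k \<delta>"
        using \<delta> \<epsilon> least_k(1)[OF \<delta>] by (intro least_k(4)) auto
      then show "y \<in> (\<lambda>k. real (400 * growth k)) ` {..least_k \<delta>}" using \<epsilon> by auto
    qed
  qed simp
  moreover have "?g \<in> O[at_right 0](\<lambda>\<epsilon>. 1 / \<epsilon> powr (4/5) * ln (1 / \<epsilon>) ^ 3)"
  proof (rule bigoI[where c = "400 * (18 ^ 3 * 2)"])
    have "eventually (\<lambda>\<epsilon>. \<epsilon> \<in> {0<..<1/4}) (at_right (0::real))"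
      by (rule eventually_at_right_real) simp
    then show "eventually (\<lambda>\<epsilon>. norm (?g \<epsilon>) \<le> 400 * (18 ^ 3 * 2) * norm (1 / \<epsilon> powr (4/5) * ln (1 / \<epsilon>) ^ 3)) (at_right 0)"
    proof eventually_elim
      case (elim \<epsilon>)
      then have \<epsilon>: "0 < \<epsilon>" "\<epsilon> < 1/4" by auto
      define x where "x = 1 / \<epsilon> powr (4/5)"
      define Ln where "Ln = ln (1 / \<epsilon>)"
      have x5: "x ^ 5 * \<epsilon> ^ 4 = 1"
      proof -
        have "(\<epsilon> powr (4/5)) ^ 5 = \<epsilon> ^ 4"
          using \<epsilon> by (simp add: powr_power)
        then show ?thesis using \<epsilon> by (simp add: x_def power_divide)
      qed
      have x0: "0 < x" using \<epsilon> by (simp add: x_def)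
      have "\<epsilon> powr (4/5) \<le> 1" using \<epsilon> by (intro powr_le1) auto
      then have x1: "1 \<le> x" using \<epsilon> by (simp add: x_def)
      have "\<epsilon> = \<epsilon> powr 1" using \<epsilon> by simp
      also have "\<dots> \<le> \<epsilon> powr (4/5)" using \<epsilon> by (intro powr_mono') auto
      finally have x_le: "x \<le> 1 / \<epsilon>" using \<epsilon> by (simp add: x_def frac_le)
      let ?k = "least_k \<epsilon>" and ?q = "least_exp (least_k \<epsilon>)"
      have k: "real ?k \<le> 2 * x"
      proof (cases "?k \<le> 1")
        case True
        then show ?thesis using x1 by linarith
      next
        case False
        then have "real (?k - 1) ^ 5 * \<epsilon> ^ 4 < x ^ 5 * \<epsilon> ^ 4"
          unfolding x5 by (intro least_k(3)[OF \<epsilon>(1)]) auto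
        then have "real (?k - 1) ^ 5 < x ^ 5" using \<epsilon> by (simp add: mult_less_cancel_right)
        then have "real (?k - 1) < x" by (rule power_less_imp_less_base) (use x0 in simp)
        then show ?thesis using x1 False by (simp add: of_nat_diff)
      qed
      have Ln1: "1 \<le> Ln"
      proof -
        have "exp 1 \<le> (4::real)" using exp_le by simp
        also have "4 \<le> 1 / \<epsilon>" using \<epsilon> by (simp add: field_simps)
        finally show ?thesis using \<epsilon> by (simp add: Ln_def ln_ge_iff)
      qed
      have q: "real ?q \<le> 4 * Ln"
      proof (cases "?q = 0")
        case True
        then show ?thesis using Ln1 by simp
      next
        case False
        then have "2 ^ (?q - 1) < ?k" by (intro least_exp(2)) simp
        then have "real (2 ^ (?q - 1)) < real ?k" by (simp only: of_nat_less_iff)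
        then have "2 ^ (?q - 1) < real ?k" by (simp only: of_nat_power of_nat_numeral)
        also have "\<dots> \<le> 2 * (1 / \<epsilon>)" using k x_le by linarith
        finally have "2 ^ (?q - 1) < 2 / \<epsilon>" by simp
        then have "ln (2 ^ (?q - 1)) < ln (2 / \<epsilon>)" using \<epsilon> by simp
        then have "real (?q - 1) * ln 2 < ln 2 + Ln"
          using \<epsilon> by (simp add: ln_realpow Ln_def ln_div)
        then have a: "(real ?q - 2) * ln 2 < Ln" using False by (simp add: of_nat_diff algebra_simps)
        have "1/2 \<le> ln (2::real)" using ln_2_less_1 ln2_ge_two_thirds by simp
        then have "real ?q - 2 \<le> 2 * Ln"
        proof (cases "real ?q \<le> 2")
          case False
          then have "(real ?q - 2) * (1/2) \<le> (real ?q - 2) * ln 2"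
            using \<open>1/2 \<le> ln 2\<close> by (intro mult_left_mono) auto
          then have "(real ?q - 2) * (1/2) < Ln" using a by (rule le_less_trans)
          then show ?thesis by simp
        qed (use Ln1 in simp)
        then show ?thesis using Ln1 by linarith
      qed
      have "real (?q * 2 + 10) \<le> 18 * Ln" using q Ln1 by simp
      then have "real (?q * 2 + 10) ^ 3 * real ?k \<le> (18 * Ln) ^ 3 * (2 * x)"
        using k Ln1 by (intro mult_mono power_mono) auto
      then have "?g \<epsilon> \<le> 400 * (18 ^ 3 * 2) * (x * Ln ^ 3)"
        by (simp add: growth_def power_mult_distrib mult.commute)
      then show ?case using x0 Ln1 by (simp add: x_def[symmetric] Ln_def[symmetric] abs_mult)
    qed
  qed
  ultimately show ?thesis unfolding soft_O_def by blast
qed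

section \<open>Bounding all parameters by powers of one quantity\<close>

lemma sum_list_le: "(\<And>x. x \<in> set xs \<Longrightarrow> x \<le> Z) \<Longrightarrow> sum_list xs \<le> length xs * (Z :: nat)"
  by (induction xs) (auto intro: add_mono)

context learner_params
begin

lemma poly_bounds:
  assumes Y: "1024 \<le> Y" "k \<le> Y" "m \<le> Y"
  shows "k3 \<le> Y ^ 3" "m2 \<le> Y ^ 2" "s \<le> Y ^ 6" "r \<le> Y ^ 16" "r2 \<le> Y ^ 32" "d \<le> Y ^ 4" "u1 \<le> Y ^ 33" "B0 \<le> Y ^ 72"
proof -
  have Y1: "1 \<le> Y" using Y by simp
  show 1: "k3 \<le> Y ^ 3" unfolding k3_def power3_eq_cube using Y by (intro mult_le_mono)
  show 2: "m2 \<le> Y ^ 2" unfolding m2_def power2_eq_square using Y by (intro mult_le_mono)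
  have "s \<le> Y ^ 2 * Y ^ 3 * Y ^ 1" unfolding s_def using Y 1 2 by (intro mult_le_mono) auto
  then show 3: "s \<le> Y ^ 6" by (simp only: power_add[symmetric]) simp
  have "r \<le> Y ^ 6 * Y ^ 6 * Y ^ 3 * Y ^ 1" unfolding r_def using Y 1 3 by (intro mult_le_mono) auto
  then show 4: "r \<le> Y ^ 16" by (simp only: power_add[symmetric]) simp
  have "r2 \<le> Y ^ 16 * Y ^ 16" unfolding r2_def using 4 by (intro mult_le_mono) auto
  then show 5: "r2 \<le> Y ^ 32" by (simp only: power_add[symmetric]) simp
  have "d \<le> Y ^ 2 * Y ^ 1 * Y ^ 1" unfolding d_def using Y 2 by (intro mult_le_mono) auto
  then show "d \<le> Y ^ 4" by (simp only: power_add[symmetric]) simp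
  have "u1 \<le> r2 * 33" unfolding u1_def using pos(6) by simp
  also have "\<dots> \<le> Y ^ 32 * Y ^ 1" using Y 5 by (intro mult_le_mono) auto
  finally show "u1 \<le> Y ^ 33" by (simp only: power_add[symmetric]) simp
  have "(2560::nat) \<le> 1024 ^ 2" by simp
  also have "\<dots> \<le> Y ^ 2" using Y by (intro power_mono) auto
  finally have "B0 \<le> Y ^ 32 * Y ^ 32 * Y ^ 6 * Y ^ 2" unfolding B0_def using 3 5 by (intro mult_le_mono)
  then show "B0 \<le> Y ^ 72" by (simp only: power_add[symmetric]) simp
qed

text \<open>The unit is dictated by \<open>NN = u1 ^ d\<close>: the logarithm of \<open>u1\<close>
  is of order \<open>m\<close> and \<open>d\<close> is of order \<open>m\<^sup>2 * k\<close>. The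
  other quantities are at most fixed powers of \<open>X\<close> times a power of \<open>n\<close>,
  and numerical constants are absorbed because \<open>X\<close> is at least 1024.\<close>

definition "X = (2::nat) ^ (m ^ 3 * k)"

lemma m_le_growth: "m \<le> m ^ 3 * k"
proof -
  have "m * 1 \<le> m * (m * m * k)" using pos(1) k_pos by (intro mult_le_mono) (auto simp: Suc_le_eq)
  then show ?thesis by (simp add: power3_eq_cube mult.assoc)
qed

lemma base_le: "2 ^ m \<le> X" "1024 \<le> (2::nat) ^ m" "k \<le> 2 ^ m" "m \<le> 2 ^ m" "q \<le> 2 ^ m" "2 ^ q \<le> (2::nat) ^ m"
proof -
  show "2 ^ m \<le> X" unfolding X_def using m_le_growth by (intro power_increasing) auto
  have "(2::nat) ^ 10 \<le> 2 ^ m" by (intro power_increasing) (auto simp: m_def)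
  then show "1024 \<le> (2::nat) ^ m" by simp
  show q2: "2 ^ q \<le> (2::nat) ^ m" by (intro power_increasing) (auto simp: m_def)
  then show "k \<le> 2 ^ m" using q_large by linarith
  show m: "m \<le> 2 ^ m" using less_exp[of m] by simp
  have "q \<le> m" by (simp add: m_def)
  then show "q \<le> 2 ^ m" using m by linarith
qed

lemma NN_le: "NN \<le> X ^ 330"
proof -
  have "NN \<le> ((2 ^ m) ^ 33) ^ d"
    unfolding NN_def by (intro power_mono poly_bounds(7) base_le) auto
  also have "\<dots> = 2 ^ (m * 33 * d)" by (simp only: power_mult)
  also have "m * 33 * d = m ^ 3 * k * 330" by (simp add: d_def m2_def power3_eq_cube)
  also have "2 ^ (m ^ 3 * k * 330) = X ^ 330" by (simp only: X_def power_mult)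
  finally show ?thesis .
qed

definition "area = (max n 1)\<^sup>2"

lemma X_ge: "1024 \<le> X" "k \<le> X" "m \<le> X" "q \<le> X" "2 ^ q \<le> X"
  using base_le by linarith+

lemma le_X_power: "a \<le> X ^ i * c \<Longrightarrow> i \<le> j \<Longrightarrow> a \<le> X ^ j * c" for a i j c :: nat
proof -
  assume a: "a \<le> X ^ i * c" "i \<le> j"
  have "X ^ i \<le> X ^ j" using a(2) X_ge(1) by (intro power_increasing) auto
  then have "X ^ i * c \<le> X ^ j * c" by (rule mult_le_mono1)
  then show ?thesis using a(1) by linarith
qed

lemma tmax_le: "tmax \<le> X ^ 74 * (l + 1)"
proof -
  note P = poly_bounds[OF X_ge(1-3)]
  have "(l * 2 + 6) * 32 \<le> 1024 * (l + 1)" by simp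
  also have "\<dots> \<le> X ^ 1 * (l + 1)" using X_ge(1) by (intro mult_le_mono) auto
  finally have "(l * 2 + 6) * 32 * r2 \<le> X ^ 1 * (l + 1) * X ^ 32" by (rule mult_le_mono[OF _ P(5)])
  also have "\<dots> = X ^ 1 * X ^ 32 * (l + 1)" by (simp only: mult.assoc mult.commute mult.left_commute)
  also have "\<dots> = X ^ 33 * (l + 1)" by (simp only: power_add[symmetric]) simp
  finally have "(l * 2 + 6) * 32 * r2 \<le> X ^ 73 * (l + 1)" by (rule le_X_power) simp
  moreover have "B0 \<le> X ^ 73 * (l + 1)"
    by (rule le_X_power[of _ 72]) (use P(8) in \<open>auto intro: order_trans\<close>)
  ultimately have "tmax \<le> 2 * (X ^ 73 * (l + 1))" unfolding tmax_def by linarith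
  also have "\<dots> \<le> X * (X ^ 73 * (l + 1))" using X_ge(1) by (intro mult_le_mono) auto
  also have "\<dots> = X ^ 74 * (l + 1)" by (simp only: mult.assoc[symmetric] power_Suc[symmetric]) simp
  finally show ?thesis .
qed

lemma l_le: "l \<le> n" "2 ^ l \<le> 2 * max n 1"
proof -
  show "l \<le> n" using l_least[of n] less_exp[of n] by (meson not_less)
  show "2 ^ l \<le> 2 * max n 1"
  proof (cases l)
    case (Suc l')
    then have "2 ^ l' \<le> n" by (intro l_least) simp
    then show ?thesis by (simp add: Suc)
  qed simp
qed

lemma M2_le: "M2 \<le> X ^ 334"
proof -
  have "M2 \<le> X ^ 3 * X ^ 330 * X ^ 1"
    unfolding M2_def using X_ge(1) by (intro mult_le_mono poly_bounds(1)[OF X_ge(1-3)] NN_le) auto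
  then show ?thesis by (simp only: power_add[symmetric]) simp
qed

lemma area_ge: "1 \<le> area" "max n 1 \<le> area" "n \<le> area" "l \<le> area" "n + 2 \<le> 3 * max n 1"
proof -
  have "max n 1 * 1 \<le> max n 1 * max n 1" by (intro mult_le_mono) auto
  then show a: "max n 1 \<le> area" by (simp only: area_def power2_eq_square mult_1_right)
  show "1 \<le> area" "n \<le> area" using a by linarith+
  then show "l \<le> area" using l_le by linarith
  show "n + 2 \<le> 3 * max n 1" by auto
qed

lemma tmax_le': "tmax \<le> X ^ 75 * max n 1"
proof -
  have "l + 1 \<le> 2 * max n 1" using l_le(1) by auto
  also have "\<dots> \<le> X * max n 1" using X_ge(1) by (intro mult_le_mono) auto
  finally have "X ^ 74 * (l + 1) \<le> X ^ 74 * (X * max n 1)" by (rule mult_le_mono2)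
  then have "tmax \<le> X ^ 74 * (X * max n 1)" using tmax_le by linarith
  also have "X ^ 74 * (X * max n 1) = X ^ 74 * X ^ 1 * max n 1" by (simp only: power_one_right mult.assoc)
  also have "\<dots> = X ^ 75 * max n 1" by (simp only: power_add[symmetric]) simp
  finally show ?thesis .
qed

lemma M_le: "M \<le> X ^ 335 * max n 1"
proof -
  have "tmax \<le> X ^ 334 * max n 1" by (rule le_X_power[OF tmax_le']) simp
  moreover have "M2 \<le> X ^ 334 * max n 1" by (rule order_trans[OF M2_le]) simp
  ultimately have "M \<le> 2 * (X ^ 334 * max n 1)" unfolding M_def by linarith
  also have "\<dots> \<le> X * (X ^ 334 * max n 1)" using X_ge(1) by (intro mult_le_mono) auto
  also have "\<dots> = X ^ 335 * max n 1" by (simp only: mult.assoc[symmetric] power_Suc[symmetric]) simp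
  finally show ?thesis .
qed

lemma X_mult: "X * (X ^ i * c) = X ^ Suc i * c"
  by simp

lemma w_le: "w \<le> X * max n 1"
proof -
  have "w \<le> 3 * max n 1" unfolding w_def by (rule area_ge)
  also have "\<dots> \<le> X * max n 1" using X_ge(1) by (intro mult_le_mono) auto
  finally show ?thesis .
qed

lemma Mw_le: "M * w \<le> X ^ 336 * area"
proof -
  have "M * w \<le> (X ^ 335 * max n 1) * (X * max n 1)" by (intro mult_le_mono M_le w_le)
  also have "\<dots> = X * (X ^ 335 * area)" by (simp only: area_def power2_eq_square mult.assoc mult.commute mult.left_commute)
  finally show ?thesis unfolding X_mult by simp
qed

lemma np_le: "np \<le> X * area"
proof -
  have "np \<le> max n 1 * (X * max n 1)" unfolding np_def by (intro mult_le_mono w_le) auto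
  then show ?thesis by (simp only: area_def power2_eq_square mult.assoc mult.commute mult.left_commute)
qed

lemma L_le: "L \<le> X ^ 341 * area"
proof -
  have d1: "d + 1 \<le> X ^ 5"
  proof -
    have "d + 1 \<le> 2 * X ^ 4" using poly_bounds(6)[OF X_ge(1-3)] X_ge(1) one_le_power[of X 4] by linarith
    also have "\<dots> \<le> X * X ^ 4" using X_ge(1) by (intro mult_le_mono) auto
    also have "\<dots> = X ^ 5" by (simp only: power_Suc[symmetric]) simp
    finally show ?thesis .
  qed
  have "n + 1 \<le> X * max n 1" using w_le by (simp add: w_def)
  then have "n + 1 \<le> X * area" using area_ge(2) by (meson mult_le_mono2 le_trans)
  then have "L \<le> X ^ 334 * (X * area) * X ^ 5"
    unfolding L_def using M2_le d1 by (intro mult_le_mono)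
  also have "\<dots> = X ^ 334 * X ^ 1 * X ^ 5 * area" by (simp only: power_one_right mult.assoc mult.commute mult.left_commute)
  also have "\<dots> = X ^ 340 * area" by (simp only: power_add[symmetric]) simp
  finally show ?thesis by (rule le_X_power) simp
qed

lemma cap_le: "cap \<le> X ^ 112 * area"
proof -
  note P = poly_bounds[OF X_ge(1-3)]
  have p: "1 \<le> X ^ i" for i using X_ge(1) by (intro one_le_power) auto
  have a: "(r2 * 64 + B0 + 1) * np \<le> X ^ 110 * area"
  proof -
    have "r2 \<le> X ^ 72" using P(5) power_increasing[of 32 72 X] X_ge(1) by linarith
    then have "r2 * 64 + B0 + 1 \<le> 66 * X ^ 72" using P(8) p[of 72] by linarith
    also have "\<dots> \<le> X * X ^ 72" using X_ge(1) by (intro mult_le_mono) auto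
    finally have "(r2 * 64 + B0 + 1) * np \<le> X * X ^ 72 * (X * area)" by (intro mult_le_mono np_le)
    also have "\<dots> = X ^ 1 * X ^ 72 * X ^ 1 * area" by (simp only: power_one_right mult.assoc)
    also have "\<dots> = X ^ 74 * area" by (simp only: power_add[symmetric]) simp
    finally show ?thesis by (rule le_X_power) simp
  qed
  have b: "r2 * 32 * (tmax + 1) \<le> X ^ 110 * area"
  proof -
    have "max n 1 \<le> area" by (rule area_ge)
    then have "tmax \<le> X ^ 75 * area" using tmax_le' by (meson mult_le_mono2 le_trans)
    moreover have "1 \<le> X ^ 75 * area" using p[of 75] area_ge(1) by (metis mult_le_mono mult_1)
    ultimately have "tmax + 1 \<le> 2 * (X ^ 75 * area)" by linarith
    also have "\<dots> \<le> X * (X ^ 75 * area)" using X_ge(1) by (intro mult_le_mono) auto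
    finally have "r2 * 32 * (tmax + 1) \<le> X ^ 32 * X * (X * (X ^ 75 * area))"
      using P(5) X_ge(1) by (intro mult_le_mono) auto
    also have "\<dots> = X ^ 32 * X ^ 1 * X ^ 1 * X ^ 75 * area" by (simp only: power_one_right mult.assoc)
    also have "\<dots> = X ^ 109 * area" by (simp only: power_add[symmetric]) simp
    finally show ?thesis by (rule le_X_power) simp
  qed
  have "cap \<le> (X ^ 110 * area + X ^ 110 * area) * 20" unfolding cap_def by (intro mult_le_mono1 add_mono a b)
  also have "\<dots> = 40 * (X ^ 110 * area)" by simp
  also have "\<dots> \<le> X * (X ^ 110 * area)" using X_ge(1) by (intro mult_le_mono) auto
  also have "\<dots> = X ^ 111 * area" unfolding X_mult by simp
  finally show ?thesis by (rule le_X_power) simp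
qed

lemma item_bounds:
  defines "Z \<equiv> X ^ 345 * area"
  shows "1 \<le> Z" "2560 \<le> Z" "k \<le> Z" "2 ^ q * 2 \<le> Z" "q \<le> Z" "2 ^ l * 2 \<le> Z" "l \<le> Z" "s \<le> Z" "r \<le> Z" "u1 \<le> Z" "NN \<le> Z"
    "M2 \<le> Z" "B0 \<le> Z" "tmax + 1 \<le> Z" "np + 1 \<le> Z" "cap + 1 \<le> Z" "64 + M * w + n \<le> Z" "64 + M + L \<le> Z" "d + 1 \<le> Z"
    "m \<le> Z" "m2 \<le> Z" "n + 2 \<le> Z" "1024 * Z \<le> X ^ 346 * area"
proof -
  note P = poly_bounds[OF X_ge(1-3)]
  define Y where "Y = X ^ 341 * area"
  have p: "1 \<le> X ^ i" for i using X_ge(1) by (intro one_le_power) auto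
  have pow: "a \<le> Y" if "a \<le> X ^ i" "i \<le> 341" for a i
    by (rule order_trans[OF le_X_power[of a i 1 341]]) (use that area_ge(1) in \<open>auto simp: Y_def\<close>)
  have YZ: "128 * Y \<le> Z"
  proof -
    have "128 * Y \<le> X * Y" using X_ge(1) by (intro mult_le_mono) auto
    also have "\<dots> = X ^ 342 * area" unfolding Y_def X_mult by simp
    finally show ?thesis unfolding Z_def by (rule le_X_power) simp
  qed
  have sz: "area \<le> Y" unfolding Y_def using p[of 341] by (metis mult_1 mult_le_mono1)
  have sm: "1 \<le> Y" "1024 \<le> Y" "k \<le> Y" "m \<le> Y" "q \<le> Y" "2 ^ q \<le> Y"
    using pow[of _ 1] X_ge p[of 1] by simp_all
  have Ps: "s \<le> Y" "r \<le> Y" "u1 \<le> Y" "NN \<le> Y" "M2 \<le> Y" "B0 \<le> Y" "d \<le> Y" "m2 \<le> Y"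
    using pow[OF P(3)] pow[OF P(4)] pow[OF P(7)] pow[OF NN_le] pow[OF M2_le] pow[OF P(8)] pow[OF P(6)] pow[OF P(2)] by simp_all
  have ln: "l \<le> Y" "n \<le> Y" "2 ^ l \<le> 2 * Y" using area_ge l_le(2) sz by linarith+
  have big: "M * w \<le> Y" "cap \<le> Y" "L \<le> Y"
    unfolding Y_def by (rule le_X_power[OF Mw_le] le_X_power[OF cap_le] le_X_power[OF L_le]; simp)+
  have npY: "np \<le> Y" unfolding Y_def by (rule le_X_power[of _ 1]) (use np_le in simp_all)
  have MY: "M \<le> Y"
  proof -
    have "M * 1 \<le> M * w" using pos(13) by (intro mult_le_mono) auto
    then show ?thesis using big by linarith
  qed
  have tY: "tmax \<le> Y" using MY by (simp add: M_def)
  show "1 \<le> Z" "2560 \<le> Z" "k \<le> Z" "2 ^ q * 2 \<le> Z" "q \<le> Z" "2 ^ l * 2 \<le> Z" "l \<le> Z" "s \<le> Z" "r \<le> Z" "u1 \<le> Z" "NN \<le> Z"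
    "M2 \<le> Z" "B0 \<le> Z" "tmax + 1 \<le> Z" "np + 1 \<le> Z" "cap + 1 \<le> Z" "64 + M * w + n \<le> Z" "64 + M + L \<le> Z" "d + 1 \<le> Z"
    "m \<le> Z" "m2 \<le> Z" "n + 2 \<le> Z"
    using sm Ps ln big npY MY tY YZ by linarith+
  have "1024 * Z \<le> X * Z" using X_ge(1) by (intro mult_le_mono) auto
  then show "1024 * Z \<le> X ^ 346 * area" unfolding Z_def X_mult by simp
qed

lemma W_le: "W \<le> X ^ 346 * area"
proof -
  have "W \<le> length [2560, k, 2 ^ q * 2, q, 2 ^ l * 2, l, s, r, u1, NN, M2, B0, tmax + 1, np + 1, cap + 1,
      64 + M * w + n, 64 + M + L, d + 1, m, m2, n + 2] * (X ^ 345 * area)"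
    unfolding W_def by (rule sum_list_le) (use item_bounds in \<open>auto simp del: One_nat_def add_Suc_right\<close>)
  also have "\<dots> \<le> 1024 * (X ^ 345 * area)" by (intro mult_le_mono1) simp
  also note item_bounds(23)
  finally show ?thesis .
qed

lemma learner_time_le: "learner_time \<le> X ^ 346 * area"
proof -
  have tm: "tm draw_body \<le> 100" "tm find_body \<le> 100"
    by (simp_all add: draw_body_def find_body_def test_step_def test_stop_def)
  have "M * w * (tm draw_body + 3) \<le> M * w * 103" "cap * (tm find_body + 3) \<le> cap * 103"
    using tm by (intro mult_le_mono; simp)+
  then show ?thesis unfolding learner_time_def using item_bounds by linarith
qed

lemma evaluator_time_le: "evaluator_time \<le> X ^ 346 * area"
proof -
  have tm: "tm eval_body \<le> 200" by (simp add: eval_body_def kernel_step_def)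
  have "L * (tm eval_body + 3) \<le> L * 203" using tm by (intro mult_le_mono; simp)
  then show ?thesis unfolding evaluator_time_def using item_bounds by linarith
qed

text \<open>Of the two parts of the sample only \<open>tmax\<close> depends on \<open>n\<close>, and
  it is linear in \<open>l\<close>. Replacing \<open>n\<close> by \<open>max n 2\<close> keeps the
  logarithm at least 1, so that it also covers the part independent of \<open>n\<close>.\<close>

lemma M_le_log: "real M \<le> real (X ^ 346) * log 2 (real (max n 2))"
proof -
  let ?l = "log 2 (real (max n 2))"
  have l1: "1 \<le> ?l" by (simp add: le_log_iff)
  have l2: "real l \<le> 1 + ?l"
  proof (cases l)
    case (Suc l')
    then have "2 ^ l' \<le> n" by (intro l_least) simp
    then have "2 ^ l' \<le> max n 2" by simp
    then have "real (2 ^ l') \<le> real (max n 2)" by (simp only: of_nat_le_iff)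
    then have "real l' \<le> ?l" by (simp add: le_log_iff powr_realpow)
    then show ?thesis using Suc by simp
  qed (use l1 in simp)
  have "real tmax \<le> real (X ^ 74 * (l + 1))" using tmax_le by (simp only: of_nat_le_iff)
  also have "\<dots> = real (X ^ 74) * (real l + 1)" by (simp add: algebra_simps)
  also have "\<dots> \<le> real (X ^ 345) * (3 * ?l)"
  proof (intro mult_mono)
    show "real (X ^ 74) \<le> real (X ^ 345)"
      unfolding of_nat_le_iff using X_ge(1) by (intro power_increasing) auto
    show "real l + 1 \<le> 3 * ?l" using l1 l2 by linarith
  qed auto
  finally have t: "real tmax \<le> 3 * (real (X ^ 345) * ?l)" by simp
  have "real M2 \<le> real (X ^ 345)"
    unfolding of_nat_le_iff using M2_le power_increasing[of 334 345 X] X_ge(1) by linarith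
  also have "\<dots> \<le> real (X ^ 345) * ?l" using l1 by (simp add: mult_le_cancel_left1)
  finally have "real M \<le> 4 * (real (X ^ 345) * ?l)" using t by (simp add: M_def)
  also have "\<dots> \<le> real X * (real (X ^ 345) * ?l)" using X_ge(1) l1 by (intro mult_right_mono) auto
  also have "\<dots> = real (X * X ^ 345) * ?l" by simp
  also have "X * X ^ 345 = X ^ 346" by (simp only: power_Suc[symmetric]) simp
  finally show ?thesis .
qed

end

section \<open>From verified programs and probabilities to the learning guarantee\<close>

context learning
begin

text \<open>The memory left by the learner is itself the description: \<open>find_inv\<close> at the
  end of the search provides the sample and the marked variables. The evaluator draws nothing, so
  \<open>D\<close> is arbitrary.\<close>

lemma describes_eval_result:
  assumes st: "ok W M st" "find_inv \<omega> cap st"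
    and T: "real W \<le> T" "real evaluator_time \<le> T"
  shows "describes D T n evaluator st (eval_result \<omega> (snd (snd ((micro \<omega> ^^ cap) (0, 0, {})))))"
  unfolding describes_def Let_def
proof
  let ?h = "eval_result \<omega> (snd (snd ((micro \<omega> ^^ cap) (0, 0, {}))))"
  fix x assume "x \<in> cube n"
  let ?st = "st\<lparr>point := x, label := 0\<rparr>"
  have E: "\<exists>s'. big \<omega>' W M evaluator ?st evaluator_time s' \<and> rmem s' 0 = ?h x" for \<omega>'
    using evaluator_wp[OF st refl, of \<omega>' x] unfolding wp_def .
  have run: "run D t (evaluator, ?st)
      = map_pmf (\<lambda>\<omega>. (dstep \<omega> ^^ t) (evaluator, ?st)) (Pi_pmf {draws ?st..<draws ?st + t} dflt (\<lambda>_. D))" for t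
    by (rule run_eq_map_stream[OF oracle_free_imp_flip_free[OF oracle_free_evaluator]]) simp
  have "real (nmem (snd ((dstep \<omega>' ^^ t) (evaluator, ?st))) a) \<le> T" for \<omega>' t a
  proof -
    obtain s' where "big \<omega>' W M evaluator ?st evaluator_time s'" using E by blast
    then have "nmem (snd ((dstep \<omega>' ^^ t) (evaluator, ?st))) a \<le> W" using big_funpow(2) by (auto simp: ok_def)
    then show ?thesis using T(1) by linarith
  qed
  then have "word_bounded D T (evaluator, ?st)"
    unfolding word_bounded_def run by (auto simp: case_prod_beta)
  moreover have t: "evaluator_time \<le> nat \<lfloor>T\<rfloor>" using T(2) by (simp add: le_nat_floor)
  have final: "case z of (c', s') \<Rightarrow> c' = Skip \<and> rmem s' 0 = ?h x"
    if z: "z \<in> set_pmf (run D (nat \<lfloor>T\<rfloor>) (evaluator, ?st))" for z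
  proof -
    obtain \<omega>' where \<omega>': "z = (dstep \<omega>' ^^ nat \<lfloor>T\<rfloor>) (evaluator, ?st)" using z unfolding run by auto
    obtain s' where "big \<omega>' W M evaluator ?st evaluator_time s'" "rmem s' 0 = ?h x" using E by blast
    then show ?thesis using big_funpow(1)[OF _ t] by (simp add: \<omega>')
  qed
  ultimately show "runs_in_time D T (evaluator, ?st) \<and>
      (\<forall>(c', s')\<in>set_pmf (run D (nat \<lfloor>T\<rfloor>) (evaluator, ?st)). rmem s' 0 = ?h x)"
    unfolding runs_in_time_def halts_within_def using final by blast
qed

text \<open>Time, word size and number of draws are bounded for every stream, hence on every path;
  only the quality of the hypothesis is probabilistic, and it is transferred along
  \<open>run_eq_map_stream\<close>.\<close>

lemma learner_correct:
  assumes \<epsilon>: "0 < \<epsilon>" and Z_eq: "Z = nat \<lfloor>T\<rfloor>"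
    and T: "real W \<le> T" "real learner_time \<le> T" "real evaluator_time \<le> T" and M_le: "real M \<le> N"
  defines "D \<equiv> examples n f" and "start \<equiv> (learner, init n \<epsilon>)"
  shows "runs_in_time D T start" "uses_examples D N start"
    and "2 / 3 \<le> measure_pmf.prob (run D (nat \<lfloor>T\<rfloor>) start)
      {(c, s). c = Skip \<and> (\<exists>h. describes D T n evaluator s h \<and> l2_norm n (\<lambda>x. f x - h x) \<le> \<epsilon>)}"
proof -
  have "n \<le> W" unfolding W_def by simp
  then have s0: "ok W M (init n \<epsilon>)" "frame (init n \<epsilon>)" "rmem (init n \<epsilon>) 0 = \<epsilon>" "draws (init n \<epsilon>) = 0"
    by (auto simp: ok_def init_def frame_def)
  have E: "\<exists>s'. big \<omega> W M learner (init n \<epsilon>) learner_time s' \<and> find_inv \<omega> cap s'" for \<omega>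
    using learner_wp[OF s0(1-3), of \<omega>] unfolding wp_def .
  have run: "run D t start = map_pmf (\<lambda>\<omega>. (dstep \<omega> ^^ t) start) (Pi_pmf {..<t} dflt (\<lambda>_. D))" for t
    using run_eq_map_stream[OF flip_free_learner, of "init n \<epsilon>" t t D dflt] s0(4)
    by (simp add: start_def atLeast0LessThan)
  have okt: "ok W M (snd ((dstep \<omega> ^^ t) start))" for \<omega> t
    using E[of \<omega>] big_funpow(2) unfolding start_def by blast
  have t: "learner_time \<le> nat \<lfloor>T\<rfloor>" using T(2) by (simp add: le_nat_floor)
  have final: "\<exists>s'. (dstep \<omega> ^^ nat \<lfloor>T\<rfloor>) start = (Skip, s') \<and> ok W M s' \<and> find_inv \<omega> cap s'" for \<omega>
    using E[of \<omega>] big_funpow(1)[OF _ t] big_ok unfolding start_def by blast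
  have "real (nmem (snd ((dstep \<omega> ^^ t) start)) a) \<le> T" for \<omega> t a
    using okt[of t \<omega>] T(1) unfolding ok_def by (meson of_nat_le_iff order_trans)
  then have "word_bounded D T start" unfolding word_bounded_def run by (auto simp: case_prod_beta)
  moreover have "halts_within D T start" unfolding halts_within_def run
  proof
    fix z assume "z \<in> set_pmf (map_pmf (\<lambda>\<omega>. (dstep \<omega> ^^ nat \<lfloor>T\<rfloor>) start) (Pi_pmf {..<nat \<lfloor>T\<rfloor>} dflt (\<lambda>_. D)))"
    then obtain \<omega> where "z = (dstep \<omega> ^^ nat \<lfloor>T\<rfloor>) start" by auto
    then show "case z of (c, s') \<Rightarrow> c = Skip" using final[of \<omega>] by auto
  qed
  ultimately show "runs_in_time D T start" by (simp add: runs_in_time_def)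
  have "real (draws (snd ((dstep \<omega> ^^ t) start))) \<le> N" for \<omega> t
    using okt[of t \<omega>] M_le unfolding ok_def by (meson of_nat_le_iff order_trans)
  then show "uses_examples D N start" unfolding uses_examples_def run by (auto simp: case_prod_beta)
  let ?G = "{(c, s). c = Skip \<and> (\<exists>h. describes D T n evaluator s h \<and> l2_norm n (\<lambda>x. f x - h x) \<le> \<epsilon>)}"
  have sub: "{\<omega>. success \<omega>} \<subseteq> (\<lambda>\<omega>. (dstep \<omega> ^^ nat \<lfloor>T\<rfloor>) start) -` ?G"
  proof
    fix \<omega> assume "\<omega> \<in> {\<omega>. success \<omega>}"
    then have h: "l2_norm n (\<lambda>x. f x - eval_result \<omega> (snd (snd ((micro \<omega> ^^ cap) (0, 0, {})))) x) \<le> \<epsilon>"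
      by (simp add: success_def)
    obtain s' where s': "(dstep \<omega> ^^ nat \<lfloor>T\<rfloor>) start = (Skip, s')" "ok W M s'" "find_inv \<omega> cap s'"
      using final by blast
    show "\<omega> \<in> (\<lambda>\<omega>. (dstep \<omega> ^^ nat \<lfloor>T\<rfloor>) start) -` ?G"
      using describes_eval_result[OF s'(2,3) T(1,3), of D] h by (auto simp: s'(1))
  qed
  have "2 / 3 \<le> measure_pmf.prob S\<Omega> {\<omega>. success \<omega>}" by (rule success_probability[OF \<epsilon>])
  also have "\<dots> \<le> measure_pmf.prob S\<Omega> ((\<lambda>\<omega>. (dstep \<omega> ^^ nat \<lfloor>T\<rfloor>) start) -` ?G)"
    by (rule measure_pmf.finite_measure_mono[OF sub]) simp
  also have "\<dots> = measure_pmf.prob (run D (nat \<lfloor>T\<rfloor>) start) ?G"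
    unfolding run measure_map_pmf by (simp add: Z_eq D_def)
  finally show "2 / 3 \<le> measure_pmf.prob (run D (nat \<lfloor>T\<rfloor>) start) ?G" .
qed

end

theorem theorem1p1:
  "\<exists>(A :: com) (dec :: com) (g\<^sub>1 :: real \<Rightarrow> real) (g\<^sub>2 :: real \<Rightarrow> real).
     oracle_free dec \<and>
     g\<^sub>1 \<in> soft_O (\<lambda>\<epsilon>. 1 / \<epsilon> powr (4/5)) \<and>
     g\<^sub>2 \<in> soft_O (\<lambda>\<epsilon>. 1 / \<epsilon> powr (4/5)) \<and>
     (\<forall>(n :: nat) (f :: nat set \<Rightarrow> real) (\<epsilon> :: real).
        submodular n f \<and> (\<forall>x \<in> cube n. 0 \<le> f x \<and> f x \<le> 1) \<and> \<epsilon> > 0 \<longrightarrow>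
        (let D = examples n f;
             start = (A, init n \<epsilon>);
             T = 2 powr g\<^sub>1 \<epsilon> * (real (max n 1))\<^sup>2;
             M = 2 powr g\<^sub>2 \<epsilon> * log 2 (real (max n 2))
         in runs_in_time D T start \<and>
            uses_examples D M start \<and>
            measure_pmf.prob (run D (nat \<lfloor>T\<rfloor>) start)
              {(c, s). c = Skip \<and>
                 (\<exists>h :: nat set \<Rightarrow> real. describes D T n dec s h \<and>
                    l2_norm n (\<lambda>x. f x - h x) \<le> \<epsilon>)} \<ge> 2/3))"
proof (rule exI[of _ learner], rule exI[of _ evaluator], rule exI[of _ "\<lambda>\<epsilon>. real (400 * growth (least_k \<epsilon>))"],
    rule exI[of _ "\<lambda>\<epsilon>. real (400 * growth (least_k \<epsilon>))"],
    intro conjI oracle_free_evaluator growth_soft_O allI impI)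
  fix n :: nat and f :: "nat set \<Rightarrow> real" and \<epsilon> :: real
  assume H: "submodular n f \<and> (\<forall>x \<in> cube n. 0 \<le> f x \<and> f x \<le> 1) \<and> \<epsilon> > 0"
  define k q l where "k = least_k \<epsilon>" and "q = least_exp k" and "l = least_exp (n + 1)"
  interpret L: learner_params n \<epsilon> k q l
    unfolding k_def q_def l_def using H learner_params_least by blast
  define T where "T = 2 powr real (400 * growth (least_k \<epsilon>)) * (real (max n 1))\<^sup>2"
  define N where "N = 2 powr real (400 * growth (least_k \<epsilon>)) * log 2 (real (max n 2))"
  have g: "growth (least_k \<epsilon>) = L.m ^ 3 * k" unfolding growth_def L.m_def by (simp add: k_def q_def)
  \<comment> \<open>The exponent 400 leaves room above 346, the power of \<open>X\<close> in the
    bounds for time, word size and sample.\<close>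
  have X: "2 powr real (400 * growth (least_k \<epsilon>)) = real (L.X ^ 400)"
  proof -
    have "2 powr real (400 * growth (least_k \<epsilon>)) = 2 ^ (growth (least_k \<epsilon>) * 400)"
      by (subst powr_realpow) (simp, simp only: mult.commute)
    also have "\<dots> = real (L.X ^ 400)" unfolding g L.X_def by (simp only: power_mult of_nat_power of_nat_numeral)
    finally show ?thesis .
  qed
  have T: "T = real (L.X ^ 400 * L.area)" unfolding T_def X L.area_def by simp
  have T_le: "real a \<le> T" if "a \<le> L.X ^ 346 * L.area" for a
    unfolding T of_nat_le_iff by (rule L.le_X_power[OF that]) simp
  have N_le: "real L.M \<le> N"
  proof (rule order_trans[OF L.M_le_log])
    show "real (L.X ^ 346) * log 2 (real (max n 2)) \<le> N"
      unfolding N_def X using L.X_ge(1)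
      by (intro mult_right_mono of_nat_mono power_increasing) auto
  qed
  \<comment> \<open>The stream has \<open>nat \<lfloor>T\<rfloor>\<close> positions, one per machine
    step; the word bound shows that the sample fits into it.\<close>
  have "L.M \<le> L.W" unfolding L.W_def by simp
  then have "L.M \<le> nat \<lfloor>T\<rfloor>" using L.W_le by (intro le_nat_floor T_le) simp
  then interpret learning n \<epsilon> k q l f "nat \<lfloor>T\<rfloor>" undefined
    using H by unfold_locales (auto simp: submodular_def cube_def)
  show "let D = examples n f;
             start = (learner, init n \<epsilon>);
             T = 2 powr real (400 * growth (least_k \<epsilon>)) * (real (max n 1))\<^sup>2;
             M = 2 powr real (400 * growth (least_k \<epsilon>)) * log 2 (real (max n 2))
         in runs_in_time D T start \<and>
            uses_examples D M start \<and>
            measure_pmf.prob (run D (nat \<lfloor>T\<rfloor>) start)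
              {(c, s). c = Skip \<and>
                 (\<exists>h :: nat set \<Rightarrow> real. describes D T n evaluator s h \<and>
                    l2_norm n (\<lambda>x. f x - h x) \<le> \<epsilon>)} \<ge> 2/3"
    unfolding Let_def T_def[symmetric] N_def[symmetric]
    using learner_correct[OF _ refl T_le[OF L.W_le] T_le[OF L.learner_time_le] T_le[OF L.evaluator_time_le] N_le] H
    by blast
qed

end
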